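(* Let $\lambda_p,\bar c,T>0$, let $f$ be an isotropic probability density on $\mathbb{R}^2$, and consider a Neyman-Scott cluster process with parent intensity $\lambda_p$, Poisson number of points per cluster with mean $\bar c$ and scattering density $f$, under Rayleigh fading without noise. Then the clustering gain $$G(R)=\frac{P_1(R,\bar c,\lambda_p)\,P_2(R,\bar c)}{P_p(\lambda_p\bar c)}$$ at transmitter-receiver distance $R$ satisfies $$\lim_{R\to\infty}G(R)=\infty .$$ Hence, for all sufficiently large $R$, the Poisson point process of intensity $\lambda_p\bar c$ has a lower success probability than the clustered process of the same intensity.
   Context: Neyman-Scott cluster process: the parents form a stationary Poisson point process on $\mathbb{R}^2$ of intensity $\lambda_p$; to each parent $x$ is attached an independent cluster with a Poisson number (mean $\bar c$) of points located at $x$ plus i.i.d. displacements with density $f$; $\phi$ is the union of all clusters (parents not included). With $z=(R,0)$, the success probability is $\mathbb{P}^{!0}(h\,g(z)/I_\phi(z)\ge T)$, where $I_\phi(z)=\sum_{x\in\phi}h_xg(x-z)$, $h$ and $h_x$ are i.i.d. exponential and independent of $\phi$, and $\mathbb{P}^{!0}$ is probability under the reduced Palm distribution of $\phi$ at the origin (conditioning on a point at the origin and removing it). For the cluster process it equals $P_1(R,\bar c,\lambda_p)P_2(R,\bar c)$, where $$P_1(R,\bar c,\lambda_p)=\exp\Big(-\lambda_p\int_{\mathbb{R}^2}\big[1-e^{-\bar c\beta(R,y)}\big]dy\Big),\qquad P_2(R,\bar c)=\int_{\mathbb{R}^2}e^{-\bar c\beta(R,y)}f(y)\,dy,$$ $$\beta(R,y)=\int_{\mathbb{R}^2}\frac{g(x-y-z)}{g(R)/T+g(x-y-z)}f(x)\,dx,\quad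 z=(R,0).$$ For a Poisson point process of intensity $\lambda$ it equals $P_p(\lambda)=\exp\big(-\lambda\int_{\mathbb{R}^2}\beta(R,y)\,dy\big)$ (depending on $R$). $g(R)$ is the value of $g$ at any point of norm $R$. The path-loss function $g:\mathbb{R}^2\setminus\{o\}\to\mathbb{R}^+$ is a continuous, positive, non-increasing function of $\|x\|$, with $\int_{\mathbb{R}^2\setminus B(o,\epsilon)}g(x)\,dx<\infty$ for all $\epsilon>0$, and $\lim_{\|x\|\to\infty}g(x)/g(x-y)=1$ for all $y\in\mathbb{R}^2$. *)

theory Defs
  imports "HOL-Probability.Probability"
begin

type_synonym plane = "real ^ 2"

definition path_loss :: "(plane \<Rightarrow> real) \<Rightarrow> bool" where
  "path_loss g \<longleftrightarrow>
     continuous_on (- {0}) g \<and>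
     (\<forall>x. x \<noteq> 0 \<longrightarrow> g x > 0) \<and>
     (\<forall>x y. x \<noteq> 0 \<longrightarrow> norm x \<le> norm y \<longrightarrow> g y \<le> g x) \<and>
     (\<forall>\<epsilon>>0. set_integrable lborel (- ball 0 \<epsilon>) g) \<and>
     (\<forall>y. ((\<lambda>x. g x / g (x - y)) \<longlongrightarrow> 1) at_infinity)"

definition prob_density :: "(plane \<Rightarrow> real) \<Rightarrow> bool" where
  "prob_density f \<longleftrightarrow> f \<in> borel_measurable borel \<and> (\<forall>x. 0 \<le> f x) \<and>
     (\<integral>\<^sup>+ x. ennreal (f x) \<partial>lborel) = 1"

definition isotropic :: "(plane \<Rightarrow> real) \<Rightarrow> bool" where
  "isotropic f \<longleftrightarrow> (\<forall>x y. norm x = norm y \<longrightarrow> f x = f y)"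


section \<open>The closed-form success probabilities and the clustering gain\<close>

definition rx :: "real \<Rightarrow> plane" where
  "rx R = vector [R, 0]"

definition \<beta> :: "(plane \<Rightarrow> real) \<Rightarrow> (plane \<Rightarrow> real) \<Rightarrow> real \<Rightarrow> real \<Rightarrow> plane \<Rightarrow> real" where
  "\<beta> g f T R y =
     (\<integral>x. g (x - y - rx R) / (g (rx R) / T + g (x - y - rx R)) * f x \<partial>lborel)"

definition P1 ::
  "(plane \<Rightarrow> real) \<Rightarrow> (plane \<Rightarrow> real) \<Rightarrow> real \<Rightarrow> real \<Rightarrow> real \<Rightarrow> real \<Rightarrow> real" where
  "P1 g f T R c lp = exp (- lp * (\<integral>y. 1 - exp (- c * \<beta> g f T R y) \<partial>lborel))"

definition P2 :: "(plane \<Rightarrow> real) \<Rightarrow> (plane \<Rightarrow> real) \<Rightarrow> real \<Rightarrow> real \<Rightarrow> real \<Rightarrow> real" where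
  "P2 g f T R c = (\<integral>y. exp (- c * \<beta> g f T R y) * f y \<partial>lborel)"

definition Pp :: "(plane \<Rightarrow> real) \<Rightarrow> (plane \<Rightarrow> real) \<Rightarrow> real \<Rightarrow> real \<Rightarrow> real \<Rightarrow> real" where
  "Pp g f T R l = exp (- l * (\<integral>y. \<beta> g f T R y \<partial>lborel))"

definition clustering_gain ::
  "(plane \<Rightarrow> real) \<Rightarrow> (plane \<Rightarrow> real) \<Rightarrow> real \<Rightarrow> real \<Rightarrow> real \<Rightarrow> real \<Rightarrow> real" where
  "clustering_gain g f T lp c R = P1 g f T R c lp * P2 g f T R c / Pp g f T R (lp * c)"


section \<open>Point processes\<close>

text \<open>All processes below are almost surely simple, so a point process is given by its
  random set of points.\<close>

definition locally_finite :: "plane set \<Rightarrow> bool" where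
  "locally_finite \<eta> \<longleftrightarrow> (\<forall>B. bounded B \<longrightarrow> finite (\<eta> \<inter> B))"

text \<open>The counting probabilities are written out because \<open>poisson_pmf\<close> is only specified for
  positive rates, whereas \<open>B\<close> may be a null set.\<close>

definition poisson_process :: "'w measure \<Rightarrow> real \<Rightarrow> ('w \<Rightarrow> plane set) \<Rightarrow> bool" where
  "poisson_process M l \<Phi> \<longleftrightarrow>
     prob_space M \<and>
     (AE \<omega> in M. locally_finite (\<Phi> \<omega>)) \<and>
     (\<forall>B. B \<in> sets borel \<and> bounded B \<longrightarrow>
        (\<lambda>\<omega>. card (\<Phi> \<omega> \<inter> B)) \<in> M \<rightarrow>\<^sub>M count_space UNIV \<and>
        (\<forall>k. measure M {\<omega> \<in> space M. card (\<Phi> \<omega> \<inter> B) = k} =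
           (l * measure lborel B) ^ k / fact k * exp (- (l * measure lborel B)))) \<and>
     (\<forall>n (B :: nat \<Rightarrow> plane set).
        (\<forall>i<n. B i \<in> sets borel \<and> bounded (B i)) \<and> disjoint_family_on B {..<n} \<longrightarrow>
        prob_space.indep_vars M (\<lambda>_. count_space UNIV) (\<lambda>i \<omega>. card (\<Phi> \<omega> \<inter> B i)) {..<n})"

text \<open>\<open>X\<close> enumerates the parents, \<open>N n\<close> is the number of points of the cluster of parent \<open>X n\<close>, and
  \<open>D (n, k)\<close> is the displacement of its \<open>k\<close>-th point. The equation between the joint law and the
  product law states both the marginal laws of \<open>N\<close> and \<open>D\<close> and the mutual independence of the
  parent process, the cluster sizes and the displacements.\<close>

definition neyman_scott_process ::
  "'w measure \<Rightarrow> real \<Rightarrow> real \<Rightarrow> (plane \<Rightarrow> real) \<Rightarrow> ('w \<Rightarrow> plane set) \<Rightarrow> bool" where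
  "neyman_scott_process M lp c f \<Phi> \<longleftrightarrow>
     (\<exists>(X :: nat \<Rightarrow> 'w \<Rightarrow> plane) (N :: nat \<Rightarrow> 'w \<Rightarrow> nat) (D :: nat \<times> nat \<Rightarrow> 'w \<Rightarrow> plane).
        (\<forall>n. X n \<in> M \<rightarrow>\<^sub>M borel) \<and>
        (\<forall>n. N n \<in> M \<rightarrow>\<^sub>M count_space UNIV) \<and>
        (\<forall>i. D i \<in> M \<rightarrow>\<^sub>M borel) \<and>
        poisson_process M lp (\<lambda>\<omega>. range (\<lambda>n. X n \<omega>)) \<and>
        (AE \<omega> in M. inj (\<lambda>n. X n \<omega>)) \<and>
        distr M
          (PiM UNIV (\<lambda>_. borel) \<Otimes>\<^sub>M PiM UNIV (\<lambda>_. count_space UNIV) \<Otimes>\<^sub>M PiM UNIV (\<lambda>_. borel))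
          (\<lambda>\<omega>. (\<lambda>n. X n \<omega>, \<lambda>n. N n \<omega>, \<lambda>i. D i \<omega>)) =
        distr M (PiM UNIV (\<lambda>_. borel)) (\<lambda>\<omega> n. X n \<omega>)
          \<Otimes>\<^sub>M PiM UNIV (\<lambda>_. measure_pmf (poisson_pmf c))
          \<Otimes>\<^sub>M PiM UNIV (\<lambda>_. density lborel (\<lambda>x. ennreal (f x))) \<and>
        (AE \<omega> in M. \<Phi> \<omega> = {X n \<omega> + D (n, k) \<omega> | n k. k < N n \<omega>}))"


section \<open>Reduced Palm distribution and success probability\<close>

text \<open>For a stationary process, the intensity is the mean number of points in the unit square \<open>U\<close>,
  and the reduced Palm distribution at the origin is determined by
  \<open>E\<^sup>!\<^sup>0[F] = E[\<Sum>x\<in>\<Phi>\<inter>U. F ((\<Phi> - x) \<setminus> {0})] / intensity\<close>.\<close>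

definition intensity :: "'w measure \<Rightarrow> ('w \<Rightarrow> plane set) \<Rightarrow> ennreal" where
  "intensity M \<Phi> = (\<integral>\<^sup>+ \<omega>. emeasure (count_space UNIV) (\<Phi> \<omega> \<inter> cbox 0 One) \<partial>M)"

definition reduced_palm_expectation ::
  "'w measure \<Rightarrow> ('w \<Rightarrow> plane set) \<Rightarrow> (plane set \<Rightarrow> ennreal) \<Rightarrow> ennreal" where
  "reduced_palm_expectation M \<Phi> F =
     (\<integral>\<^sup>+ \<omega>. (\<integral>\<^sup>+ x. F ((\<lambda>y. y - x) ` \<Phi> \<omega> - {0}) \<partial>count_space (\<Phi> \<omega> \<inter> cbox 0 One)) \<partial>M)
       / intensity M \<Phi>"

definition interference ::
  "(plane \<Rightarrow> real) \<Rightarrow> plane set \<Rightarrow> (plane \<Rightarrow> real) \<Rightarrow> plane \<Rightarrow> ennreal" where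
  "interference g \<eta> hx z = (\<integral>\<^sup>+ x. ennreal (hx x * g (x - z)) \<partial>count_space \<eta>)"

definition exponential_measure :: "real \<Rightarrow> real measure" where
  "exponential_measure \<mu> = density lborel (\<lambda>x. ennreal (exponential_density \<mu> x))"

text \<open>Success probability given the interferers \<open>\<eta>\<close>: the fading variables are independent of the
  point process, so conditionally on it they are still i.i.d. exponential. The quotient is taken in
  \<^typ>\<open>ennreal\<close>, so that zero interference means success.\<close>

definition conditional_success ::
  "real \<Rightarrow> (plane \<Rightarrow> real) \<Rightarrow> real \<Rightarrow> plane \<Rightarrow> plane set \<Rightarrow> ennreal" where
  "conditional_success \<mu> g T z \<eta> =
     (let F = exponential_measure \<mu> \<Otimes>\<^sub>M PiM \<eta> (\<lambda>_. exponential_measure \<mu>)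
      in emeasure F {(h, hx) \<in> space F. ennreal (h * g z) / interference g \<eta> hx z \<ge> ennreal T})"

definition success_probability ::
  "'w measure \<Rightarrow> ('w \<Rightarrow> plane set) \<Rightarrow> real \<Rightarrow> (plane \<Rightarrow> real) \<Rightarrow> real \<Rightarrow> real \<Rightarrow> ennreal" where
  "success_probability M \<Phi> \<mu> g T R =
     reduced_palm_expectation M \<Phi> (conditional_success \<mu> g T (rx R))"

end

theory Submission
  imports Defs
begin

text \<open>For a point process \<open>\<Phi>\<close> put \<open>L(w) = E[\<Prod>x\<in>\<Phi>. w x]\<close>. Integrating out the fading turns the
  success probability into a Palm expectation \<open>E[\<Sum>x\<in>\<Phi>\<inter>U. \<Prod>y\<in>\<Phi>-{x}. v (y - x)]\<close> with \<open>0 \<le> v \<le> 1\<close>.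
  No Palm calculus is needed to bound it: if \<open>b \<le> a\<close> differ by the constant \<open>s\<close> on a small cell \<open>C\<close>
  and agree elsewhere, telescoping gives
  \<open>s (\<Sum>x\<in>\<Phi>\<inter>C. \<Prod>y\<in>\<Phi>-{x}. b y) \<le> \<Prod>x\<in>\<Phi>. a x - \<Prod>x\<in>\<Phi>. b x \<le> s (\<Sum>x\<in>\<Phi>\<inter>C. \<Prod>y\<in>\<Phi>-{x}. a y)\<close>,
  so a difference of Laplace functionals controls the contribution of \<open>C\<close>. Refining the cells, the
  Poisson success probability is at most a constant times \<open>Pp\<close> and the clustered one at least a
  positive constant times \<open>P1\<close>, with constants independent of \<open>R\<close>; this loss is harmless because
  \<open>P1 / Pp = exp (lp * (\<integral>y. c \<beta> - 1 + exp (- c \<beta>)))\<close> tends to infinity: as \<open>R \<rightarrow> \<infinity>\<close> the kernel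
  \<open>\<beta>\<close> tends pointwise to \<open>T / (1 + T)\<close>, so the integrand tends to a positive constant on the whole plane,
  while \<open>exp (- c) \<le> P2 \<le> 1\<close>.\<close>

section \<open>Products over point configurations\<close>

text \<open>For weights in [0,1] this infimum of finite subproducts is the infinite product, defined
  for any set without an enumeration. It need not be measurable in \<omega>, and neither need the
  Palm sums. For such integrands the nonnegative integral is still monotone and insensitive to null
  sets, but not additive. Configurations are therefore compared pointwise, and additivity is invoked
  only for measurable versions. On a cell of diameter at most 2/m the moving weight
  \<open>v (y - x)\<close> is frozen to one function of y, a bound from above or below built from a
  radial envelope of the kernel. The difference of Laplace functionals is of order s / m^2 per cell
  and is divided by s, so s cancels and may depend on the mesh and on R. For the Poisson process the
  total is controlled by the number of covering cells, for the clustered one by the worst loss exp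
  (- c) inside a cluster, which takes the place of P2. All constants depend on \<open>lp\<close> and
  \<open>c\<close> only, hence one threshold for R serves every pair of processes.\<close>

definition config_prod :: "('a \<Rightarrow> real) \<Rightarrow> 'a set \<Rightarrow> real" where
  "config_prod w \<eta> = (INF F\<in>{F. finite F \<and> F \<subseteq> \<eta>}. \<Prod>x\<in>F. w x)"

context
  fixes w :: "'a \<Rightarrow> real"
  assumes w_nonneg: "\<And>x. 0 \<le> w x"
begin

lemma bdd_below_config_prod: "bdd_below ((\<lambda>F. \<Prod>x\<in>F. w x) ` {F. finite F \<and> F \<subseteq> \<eta>})"
  by (rule bdd_belowI[of _ 0]) (auto intro: prod_nonneg w_nonneg)

lemma config_prod_le: "finite F \<Longrightarrow> F \<subseteq> \<eta> \<Longrightarrow> config_prod w \<eta> \<le> (\<Prod>x\<in>F. w x)"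
  unfolding config_prod_def by (rule cINF_lower[OF bdd_below_config_prod]) auto

lemma config_prod_le_1: "config_prod w \<eta> \<le> 1"
  using config_prod_le[of "{}"] by simp

lemma config_prod_nonneg: "0 \<le> config_prod w \<eta>"
  unfolding config_prod_def by (rule cINF_greatest) (auto intro: prod_nonneg w_nonneg)

text \<open>A strict upper bound has a finite witness; this reduces limits of infinite products to
  limits of finite ones.\<close>

lemma config_prod_less_iff:
  "config_prod w \<eta> < r \<longleftrightarrow> (\<exists>F. finite F \<and> F \<subseteq> \<eta> \<and> (\<Prod>x\<in>F. w x) < r)"
  unfolding config_prod_def
  by (subst cINF_less_iff) (auto intro!: bdd_below_config_prod)

end

lemma le_config_prod:
  "(\<And>F. finite F \<Longrightarrow> F \<subseteq> \<eta> \<Longrightarrow> r \<le> (\<Prod>x\<in>F. w x)) \<Longrightarrow> r \<le> config_prod w \<eta>"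
  unfolding config_prod_def by (rule cINF_greatest) auto

lemma config_prod_mono:
  assumes "\<And>x. 0 \<le> w x" "\<And>x. x \<in> \<eta> \<Longrightarrow> w x \<le> w' x"
  shows "config_prod w \<eta> \<le> config_prod w' \<eta>"
proof (rule le_config_prod)
  fix F assume F: "finite F" "F \<subseteq> \<eta>"
  have "config_prod w \<eta> \<le> (\<Prod>x\<in>F. w x)" using assms F by (intro config_prod_le)
  also have "\<dots> \<le> (\<Prod>x\<in>F. w' x)" using assms F by (intro prod_mono) auto
  finally show "config_prod w \<eta> \<le> (\<Prod>x\<in>F. w' x)" .
qed

lemma config_prod_image:
  assumes "inj_on h \<eta>" "\<And>x. 0 \<le> w x"
  shows "config_prod w (h ` \<eta>) = config_prod (\<lambda>x. w (h x)) \<eta>"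
proof (rule antisym; rule le_config_prod)
  fix F assume F: "finite F" "F \<subseteq> \<eta>"
  then have "inj_on h F" using assms inj_on_subset by blast
  then have "(\<Prod>x\<in>F. w (h x)) = (\<Prod>x\<in>h ` F. w x)" by (simp add: prod.reindex)
  then show "config_prod w (h ` \<eta>) \<le> (\<Prod>x\<in>F. w (h x))"
    using F assms by (auto intro!: config_prod_le)
next
  fix F assume F: "finite F" "F \<subseteq> h ` \<eta>"
  then obtain G where G: "G \<subseteq> \<eta>" "finite G" "F = h ` G" by (metis finite_subset_image)
  then have "inj_on h G" using assms inj_on_subset by blast
  then have "(\<Prod>x\<in>F. w x) = (\<Prod>x\<in>G. w (h x))" by (simp add: prod.reindex G)
  then show "config_prod (\<lambda>x. w (h x)) \<eta> \<le> (\<Prod>x\<in>F. w x)"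
    using G assms by (auto intro!: config_prod_le)
qed

text \<open>A finite witness for an upper bound of the infimum lies in some \<open>F n\<close>,
  since the sets form a chain, and further factors, all at most 1, only lower the product. Every
  finite exhaustion thus computes the same value.\<close>

lemma config_prod_tendsto:
  assumes w: "\<And>x. 0 \<le> w x" "\<And>x. w x \<le> 1"
    and F: "\<And>m. finite (F m)" "mono F" "(\<Union>m. F m) = \<eta>"
  shows "(\<lambda>m::nat. \<Prod>x\<in>F m. w x) \<longlonglongrightarrow> config_prod w \<eta>"
proof (rule decreasing_tendsto)
  show "\<forall>\<^sub>F m in sequentially. config_prod w \<eta> \<le> (\<Prod>x\<in>F m. w x)"
    using F by (intro always_eventually allI config_prod_le w) auto
next
  fix r assume "config_prod w \<eta> < r"
  then obtain A where A: "finite A" "A \<subseteq> \<eta>" "(\<Prod>x\<in>A. w x) < r"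
    by (auto simp: config_prod_less_iff[of w, OF w(1)])
  have "subset.chain UNIV (range F)"
    unfolding subset.chain_def
  proof (intro conjI ballI)
    fix X Y assume "X \<in> range F" "Y \<in> range F"
    then obtain i j where "X = F i" "Y = F j" by blast
    then show "(\<subset>)\<^sup>=\<^sup>= X Y \<or> (\<subset>)\<^sup>=\<^sup>= Y X"
      using linorder_linear[of i j] monoD[OF F(2), of i j] monoD[OF F(2), of j i] by blast
  qed simp
  then obtain n where n: "A \<subseteq> F n"
    using finite_subset_Union_chain[of A "range F" UNIV] A F(3) by (metis UNIV_not_empty empty_is_image imageE)
  have "(\<Prod>x\<in>F m. w x) < r" if "m \<ge> n" for m
  proof -
    have sub: "A \<subseteq> F m" using n F(2) that by (auto simp: mono_def)
    have "(\<Prod>x\<in>F m. w x) = (\<Prod>x\<in>F m - A. w x) * (\<Prod>x\<in>A. w x)"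
      using prod.subset_diff[OF sub F(1)] by simp
    also have "\<dots> \<le> 1 * (\<Prod>x\<in>A. w x)"
      by (intro mult_right_mono prod_le_1 prod_nonneg) (auto simp: w)
    finally show ?thesis using A by simp
  qed
  then show "\<forall>\<^sub>F m in sequentially. (\<Prod>x\<in>F m. w x) < r"
    unfolding eventually_sequentially by blast
qed

text \<open>Both inequalities work through the finite set A \<union> F, whose factors outside F are
  at most 1. The case of a vanishing product over A is separate because the upper bound divides by
  it.\<close>

lemma config_prod_split:
  assumes w: "\<And>x. 0 \<le> w x" "\<And>x. w x \<le> 1" and A: "finite A" "A \<subseteq> \<eta>"
  shows "config_prod w \<eta> = (\<Prod>x\<in>A. w x) * config_prod w (\<eta> - A)"
proof (rule antisym)
  let ?a = "\<Prod>x\<in>A. w x"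
  have a0: "0 \<le> ?a" by (intro prod_nonneg) (auto simp: w)
  show "?a * config_prod w (\<eta> - A) \<le> config_prod w \<eta>"
  proof (rule le_config_prod)
    fix F assume F: "finite F" "F \<subseteq> \<eta>"
    have "?a * config_prod w (\<eta> - A) \<le> ?a * (\<Prod>x\<in>F-A. w x)"
      using F by (intro mult_left_mono a0 config_prod_le w) auto
    also have "\<dots> = (\<Prod>x\<in>A \<union> (F - A). w x)"
      using F A by (subst prod.union_disjoint) auto
    also have "A \<union> (F - A) = F \<union> (A - F)" by auto
    also have "(\<Prod>x\<in>F \<union> (A - F). w x) = (\<Prod>x\<in>F. w x) * (\<Prod>x\<in>A-F. w x)"
      using F A by (subst prod.union_disjoint) auto
    also have "\<dots> \<le> (\<Prod>x\<in>F. w x) * 1"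
      by (intro mult_left_mono prod_le_1 prod_nonneg) (auto simp: w)
    finally show "?a * config_prod w (\<eta> - A) \<le> (\<Prod>x\<in>F. w x)" by simp
  qed
  show "config_prod w \<eta> \<le> ?a * config_prod w (\<eta> - A)"
  proof (cases "?a = 0")
    case True
    then show ?thesis using config_prod_le[of w, OF w(1) A] by simp
  next
    case False
    then have pos: "?a > 0" using a0 by simp
    have "config_prod w \<eta> / ?a \<le> config_prod w (\<eta> - A)"
    proof (rule le_config_prod)
      fix F assume F: "finite F" "F \<subseteq> \<eta> - A"
      have "config_prod w \<eta> \<le> (\<Prod>x\<in>A \<union> F. w x)" using F A by (intro config_prod_le w) auto
      also have "\<dots> = ?a * (\<Prod>x\<in>F. w x)" using F A by (subst prod.union_disjoint) auto
      finally show "config_prod w \<eta> / ?a \<le> (\<Prod>x\<in>F. w x)" using pos by (simp add: field_simps)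
    qed
    then show ?thesis using pos by (simp add: field_simps)
  qed
qed

text \<open>With P and Q the products of a and b over A, adding z turns P - Q into
  \<open>(a z - b z) * P + b z * (P - Q)\<close>, which is also
  \<open>(a z - b z) * Q + a z * (P - Q)\<close>. With Q \<le> P, the first form gives the lower
  bound and the second the upper one.\<close>

lemma prod_diff_bounds:
  fixes a b :: "'a \<Rightarrow> real"
  assumes "finite A" and ab: "\<And>x. 0 \<le> b x" "\<And>x. b x \<le> a x"
  shows "(\<Sum>x\<in>A. (a x - b x) * (\<Prod>y\<in>A-{x}. b y)) \<le> (\<Prod>x\<in>A. a x) - (\<Prod>x\<in>A. b x)"
    and "(\<Prod>x\<in>A. a x) - (\<Prod>x\<in>A. b x) \<le> (\<Sum>x\<in>A. (a x - b x) * (\<Prod>y\<in>A-{x}. a y))"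
proof -
  have a0: "0 \<le> a x" for x using ab[of x] by linarith
  \<comment> \<open>Effect of a new index z on the telescoped sum: its own term, plus the old sum
    multiplied by \<open>h z\<close>.\<close>
  have ins: "(\<Sum>x\<in>insert z A. (a x - b x) * (\<Prod>y\<in>insert z A-{x}. h y)) =
      (a z - b z) * (\<Prod>y\<in>A. h y) + h z * (\<Sum>x\<in>A. (a x - b x) * (\<Prod>y\<in>A-{x}. h y))"
    if "finite A" "z \<notin> A" for z A and h :: "'a \<Rightarrow> real"
  proof -
    have "(\<Prod>y\<in>insert z A-{x}. h y) = h z * (\<Prod>y\<in>A-{x}. h y)" if "x \<in> A" for x
    proof -
      have "insert z A - {x} = insert z (A - {x})" using that \<open>z \<notin> A\<close> by auto
      then show ?thesis using \<open>finite A\<close> \<open>z \<notin> A\<close> by simp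
    qed
    then show ?thesis using that by (simp add: sum_distrib_left mult_ac)
  qed
  show "(\<Sum>x\<in>A. (a x - b x) * (\<Prod>y\<in>A-{x}. b y)) \<le> (\<Prod>x\<in>A. a x) - (\<Prod>x\<in>A. b x)"
    using \<open>finite A\<close>
  proof induction
    case (insert z A)
    have "b z * (\<Sum>x\<in>A. (a x - b x) * (\<Prod>y\<in>A-{x}. b y)) \<le> b z * ((\<Prod>x\<in>A. a x) - (\<Prod>x\<in>A. b x))"
      using insert ab by (intro mult_left_mono) auto
    moreover have "(a z - b z) * (\<Prod>x\<in>A. b x) \<le> (a z - b z) * (\<Prod>x\<in>A. a x)"
      using ab by (intro mult_left_mono prod_mono) auto
    ultimately show ?case unfolding ins[OF insert(1,2)] using insert(1,2) by (simp add: algebra_simps)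
  qed auto
  show "(\<Prod>x\<in>A. a x) - (\<Prod>x\<in>A. b x) \<le> (\<Sum>x\<in>A. (a x - b x) * (\<Prod>y\<in>A-{x}. a y))"
    using \<open>finite A\<close>
  proof induction
    case (insert z A)
    have "a z * ((\<Prod>x\<in>A. a x) - (\<Prod>x\<in>A. b x)) \<le> a z * (\<Sum>x\<in>A. (a x - b x) * (\<Prod>y\<in>A-{x}. a y))"
      using insert a0 by (intro mult_left_mono) auto
    moreover have "(a z - b z) * (\<Prod>x\<in>A. b x) \<le> (a z - b z) * (\<Prod>x\<in>A. a x)"
      using ab by (intro mult_left_mono prod_mono) auto
    ultimately show ?case unfolding ins[OF insert(1,2)] using insert(1,2) by (simp add: algebra_simps)
  qed auto
qed

text \<open>Since a and b agree off C, the points outside C contribute the same factor r to every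
  product, and only the finitely many points in C enter the telescoping.\<close>

lemma config_prod_diff_bounds:
  assumes ab: "\<And>x. 0 \<le> b x" "\<And>x. b x \<le> a x" "\<And>x. a x \<le> 1"
    and off: "\<And>x. x \<notin> C \<Longrightarrow> a x = b x" and fin: "finite (\<eta> \<inter> C)"
  shows "(\<Sum>x\<in>\<eta>\<inter>C. (a x - b x) * config_prod b (\<eta> - {x})) \<le> config_prod a \<eta> - config_prod b \<eta>"
    and "config_prod a \<eta> - config_prod b \<eta> \<le> (\<Sum>x\<in>\<eta>\<inter>C. (a x - b x) * config_prod a (\<eta> - {x}))"
proof -
  let ?A = "\<eta> \<inter> C"
  have a0: "0 \<le> a x" for x using ab(1,2)[of x] by linarith
  have b1: "b x \<le> 1" for x using ab(2,3)[of x] by linarith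
  define r where "r = config_prod a (\<eta> - ?A)"
  have rb: "r = config_prod b (\<eta> - ?A)"
    unfolding r_def using ab a0 off by (intro antisym config_prod_mono) auto
  have r0: "0 \<le> r" unfolding r_def by (intro config_prod_nonneg a0)
  have sp: "config_prod h \<eta> = (\<Prod>x\<in>?A. h x) * config_prod h (\<eta> - ?A)"
    "x \<in> ?A \<Longrightarrow> config_prod h (\<eta> - {x}) = (\<Prod>y\<in>?A-{x}. h y) * config_prod h (\<eta> - ?A)"
    if "\<And>x. 0 \<le> h x" "\<And>x. h x \<le> 1" for h :: "'a \<Rightarrow> real" and x
  proof -
    show "config_prod h \<eta> = (\<Prod>x\<in>?A. h x) * config_prod h (\<eta> - ?A)"
      by (rule config_prod_split[OF that fin]) auto
    assume x: "x \<in> ?A"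
    have "config_prod h (\<eta> - {x}) = (\<Prod>y\<in>?A-{x}. h y) * config_prod h ((\<eta> - {x}) - (?A - {x}))"
      by (rule config_prod_split[OF that]) (use fin in auto)
    moreover have "(\<eta> - {x}) - (?A - {x}) = \<eta> - ?A" using x by auto
    ultimately show "config_prod h (\<eta> - {x}) = (\<Prod>y\<in>?A-{x}. h y) * config_prod h (\<eta> - ?A)" by simp
  qed
  note spa = sp[where h = a, OF a0 ab(3), folded r_def] and spb = sp[where h = b, OF ab(1) b1, folded rb]
  have diff: "config_prod a \<eta> - config_prod b \<eta> = ((\<Prod>x\<in>?A. a x) - (\<Prod>x\<in>?A. b x)) * r"
    using spa spb by (simp add: algebra_simps)
  have "(\<Sum>x\<in>?A. (a x - b x) * config_prod b (\<eta> - {x})) = (\<Sum>x\<in>?A. (a x - b x) * (\<Prod>y\<in>?A-{x}. b y)) * r"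
    by (simp add: sum_distrib_right spb mult.assoc)
  then show "(\<Sum>x\<in>\<eta>\<inter>C. (a x - b x) * config_prod b (\<eta> - {x})) \<le> config_prod a \<eta> - config_prod b \<eta>"
    unfolding diff using prod_diff_bounds(1)[of ?A b a] fin ab r0 by (auto intro: mult_right_mono)
  have "(\<Sum>x\<in>?A. (a x - b x) * config_prod a (\<eta> - {x})) = (\<Sum>x\<in>?A. (a x - b x) * (\<Prod>y\<in>?A-{x}. a y)) * r"
    by (simp add: sum_distrib_right spa mult.assoc)
  then show "config_prod a \<eta> - config_prod b \<eta> \<le> (\<Sum>x\<in>\<eta>\<inter>C. (a x - b x) * config_prod a (\<eta> - {x}))"
    unfolding diff using prod_diff_bounds(2)[of ?A b a] fin ab r0 by (auto intro: mult_right_mono)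
qed

section \<open>Laplace functional of a Poisson process\<close>

text \<open>A finite witness for an upper bound of the limit involves finitely many points, so
  pointwise convergence of the weights suffices. The matching lower bound comes from
  \<open>u n\<close> lying above w; this is why weights are later discretised by rounding
  up.\<close>

lemma config_prod_tendsto_above:
  assumes w: "\<And>x. 0 \<le> w x" "\<And>n x. w x \<le> u n x" "\<And>x. (\<lambda>n. u n x) \<longlonglongrightarrow> w x"
  shows "(\<lambda>n::nat. config_prod (u n) \<eta>) \<longlonglongrightarrow> config_prod w \<eta>"
proof (rule decreasing_tendsto)
  have u0: "0 \<le> u n x" for n x using w(1)[of x] w(2)[of x n] by linarith
  show "\<forall>\<^sub>F n in sequentially. config_prod w \<eta> \<le> config_prod (u n) \<eta>"
    using w by (intro always_eventually allI config_prod_mono) auto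
  fix r assume "config_prod w \<eta> < r"
  then obtain F where F: "finite F" "F \<subseteq> \<eta>" "(\<Prod>x\<in>F. w x) < r"
    by (auto simp: config_prod_less_iff[of w, OF w(1)])
  have "(\<lambda>n. \<Prod>x\<in>F. u n x) \<longlonglongrightarrow> (\<Prod>x\<in>F. w x)" by (intro tendsto_prod w)
  then have "\<forall>\<^sub>F n in sequentially. (\<Prod>x\<in>F. u n x) < r" using F(3) by (rule order_tendstoD)
  then show "\<forall>\<^sub>F n in sequentially. config_prod (u n) \<eta> < r"
    by eventually_elim (use config_prod_le[of "u _" F \<eta>] u0 F in \<open>meson le_less_trans\<close>)
qed

section \<open>Generating functions of Poisson counts\<close>

lemma nn_integral_nat_valued:
  fixes N :: "'w \<Rightarrow> nat" and h :: "nat \<Rightarrow> ennreal"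
  assumes [measurable]: "N \<in> M \<rightarrow>\<^sub>M count_space UNIV"
  shows "(\<integral>\<^sup>+ \<omega>. h (N \<omega>) \<partial>M) = (\<Sum>k. h k * emeasure M {\<omega> \<in> space M. N \<omega> = k})"
proof -
  have "(\<integral>\<^sup>+ \<omega>. h (N \<omega>) \<partial>M) = (\<integral>\<^sup>+ \<omega>. (\<Sum>k. h k * indicator {\<omega> \<in> space M. N \<omega> = k} \<omega>) \<partial>M)"
  proof (rule nn_integral_cong)
    fix \<omega> assume "\<omega> \<in> space M"
    then have "(\<Sum>k. h k * indicator {\<omega> \<in> space M. N \<omega> = k} \<omega>) = (\<Sum>k\<in>{N \<omega>}. h k * indicator {\<omega> \<in> space M. N \<omega> = k} \<omega>)"
      by (intro suminf_finite) auto
    then show "h (N \<omega>) = (\<Sum>k. h k * indicator {\<omega> \<in> space M. N \<omega> = k} \<omega>)"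
      using \<open>\<omega> \<in> space M\<close> by simp
  qed
  also have "\<dots> = (\<Sum>k. h k * emeasure M {\<omega> \<in> space M. N \<omega> = k})"
    by (subst nn_integral_suminf) (auto simp: nn_integral_cmult_indicator)
  finally show ?thesis .
qed

text \<open>Generating function of the Poisson law, in the form of the counting probabilities; r = 0
  is included because cells of measure zero occur.\<close>

lemma poisson_generating_sums:
  fixes q r :: real
  shows "(\<lambda>k. q ^ k * (r ^ k / fact k * exp (- r))) sums exp (- r * (1 - q))"
proof -
  have "(\<lambda>k. (q * r) ^ k /\<^sub>R fact k) sums exp (q * r)" by (rule exp_converges)
  then have "(\<lambda>k. (q * r) ^ k /\<^sub>R fact k * exp (- r)) sums (exp (q * r) * exp (- r))"
    by (rule sums_mult2)
  then show ?thesis by (simp add: field_simps power_mult_distrib flip: exp_add)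
qed

lemma poisson_process_prob_space: "poisson_process M l \<Phi> \<Longrightarrow> prob_space M"
  by (simp add: poisson_process_def)

lemma poisson_process_measurable_card:
  "poisson_process M l \<Phi> \<Longrightarrow> B \<in> sets borel \<Longrightarrow> bounded B \<Longrightarrow>
    (\<lambda>\<omega>. card (\<Phi> \<omega> \<inter> B)) \<in> M \<rightarrow>\<^sub>M count_space UNIV"
  by (simp add: poisson_process_def)

lemma poisson_process_prob_card:
  "poisson_process M l \<Phi> \<Longrightarrow> B \<in> sets borel \<Longrightarrow> bounded B \<Longrightarrow>
    measure M {\<omega> \<in> space M. card (\<Phi> \<omega> \<inter> B) = k} =
      (l * measure lborel B) ^ k / fact k * exp (- (l * measure lborel B))"
  by (simp add: poisson_process_def)

lemma poisson_process_indep: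
  "poisson_process M l \<Phi> \<Longrightarrow> (\<And>i. i < (n::nat) \<Longrightarrow> B i \<in> sets borel \<and> bounded (B i)) \<Longrightarrow>
    disjoint_family_on B {..<n} \<Longrightarrow>
    prob_space.indep_vars M (\<lambda>_. count_space UNIV) (\<lambda>i \<omega>. card (\<Phi> \<omega> \<inter> B i)) {..<n}"
proof -
  assume B: "\<And>i. i < n \<Longrightarrow> B i \<in> sets borel \<and> bounded (B i)" "disjoint_family_on B {..<n}"
  assume "poisson_process M l \<Phi>"
  then have "\<forall>n (B :: nat \<Rightarrow> plane set).
        (\<forall>i<n. B i \<in> sets borel \<and> bounded (B i)) \<and> disjoint_family_on B {..<n} \<longrightarrow>
        prob_space.indep_vars M (\<lambda>_. count_space UNIV) (\<lambda>i \<omega>. card (\<Phi> \<omega> \<inter> B i)) {..<n}"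
    unfolding poisson_process_def by (elim conjE)
  from this[rule_format, of n B] show ?thesis using B by blast
qed

lemma poisson_process_count:
  assumes P: "poisson_process M l \<Phi>" and l: "0 \<le> l"
    and B: "B \<in> sets borel" "bounded B" and q: "0 \<le> q"
  shows "(\<integral>\<^sup>+ \<omega>. ennreal (q ^ card (\<Phi> \<omega> \<inter> B)) \<partial>M) = ennreal (exp (- (l * measure lborel B * (1 - q))))"
proof -
  interpret prob_space M using P by (rule poisson_process_prob_space)
  note [measurable] = poisson_process_measurable_card[OF P B]
  note pr = poisson_process_prob_card[OF P B]
  define r where "r = l * measure lborel B"
  have r: "0 \<le> r" using l by (simp add: r_def)
  have "(\<integral>\<^sup>+ \<omega>. ennreal (q ^ card (\<Phi> \<omega> \<inter> B)) \<partial>M) =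
      (\<Sum>k. ennreal (q ^ k) * emeasure M {\<omega> \<in> space M. card (\<Phi> \<omega> \<inter> B) = k})"
    by (rule nn_integral_nat_valued) simp
  also have "\<dots> = (\<Sum>k. ennreal (q ^ k * (r ^ k / fact k * exp (- r))))"
    using q r unfolding emeasure_eq_measure pr r_def[symmetric]
    by (intro suminf_cong) (simp only: ennreal_mult' zero_le_power)
  also have "\<dots> = ennreal (exp (- r * (1 - q)))"
    using poisson_generating_sums[of q r] q r
    by (intro suminf_ennreal_eq) auto
  finally show ?thesis by (simp add: r_def)
qed

text \<open>Point configurations enter only through the functional \<open>\<omega> \<mapsto> config_prod w (\<Phi> \<omega>)\<close>, which need
  not be measurable itself, hence the detour through a measurable version \<open>Y\<close>.\<close>

definition has_laplace_exponent ::
  "'w measure \<Rightarrow> ('w \<Rightarrow> plane set) \<Rightarrow> ((plane \<Rightarrow> real) \<Rightarrow> real) \<Rightarrow> bool" where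
  "has_laplace_exponent M \<Phi> \<Lambda> \<longleftrightarrow>
     (\<forall>w. w \<in> borel_measurable borel \<and> (\<forall>x. 0 \<le> w x \<and> w x \<le> 1) \<and> integrable lborel (\<lambda>x. 1 - w x) \<longrightarrow>
        (\<exists>Y \<in> borel_measurable M. (AE \<omega> in M. config_prod w (\<Phi> \<omega>) = Y \<omega>) \<and> (\<integral>\<omega>. Y \<omega> \<partial>M) = exp (- \<Lambda> w)))"

text \<open>The weight w is replaced by a function \<open>u K\<close> with finitely many values that
  equals 1 off a ball. The counts on its level sets are independent Poisson variables, so the mean
  product factorises into generating functions. As K grows, both sides converge by
  domination.\<close>

lemma poisson_process_laplace:
  assumes P: "poisson_process M l \<Phi>" and l: "0 \<le> l"
  shows "has_laplace_exponent M \<Phi> (\<lambda>w. l * (\<integral>x. 1 - w x \<partial>lborel))"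
  unfolding has_laplace_exponent_def
proof (intro allI impI, elim conjE)
  fix w :: "plane \<Rightarrow> real"
  assume w[measurable]: "w \<in> borel_measurable borel" and w01: "\<forall>x. 0 \<le> w x \<and> w x \<le> 1"
    and int: "integrable lborel (\<lambda>x. 1 - w x)"
  interpret prob_space M using P by (rule poisson_process_prob_space)
  have w0: "0 \<le> w x" and w1: "w x \<le> 1" for x using w01 by auto
  \<comment> \<open>Rounding (K + 1) w up yields the levels 0, ..., K + 1, hence the index range
    \<open>{..<Suc (Suc K)}\<close> below.\<close>
  define A where "A K j = {x \<in> ball 0 (real (Suc K)). \<lceil>real (Suc K) * w x\<rceil> = int j}" for K j :: nat
  define u where "u K x = (if x \<in> ball 0 (real (Suc K)) then real_of_int \<lceil>real (Suc K) * w x\<rceil> / real (Suc K) else 1)" for K x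
  have A[measurable]: "A K j \<in> sets borel" for K j unfolding A_def by measurable
  have Ab: "bounded (A K j)" for K j unfolding A_def by (rule bounded_subset[OF bounded_ball[of 0 "real (Suc K)"]]) auto
  have lev: "\<lceil>real (Suc K) * w x\<rceil> \<in> {0..int (Suc K)}" for K x
  proof -
    have "0 \<le> real (Suc K) * w x" using w0[of x] by simp
    moreover have "real (Suc K) * w x \<le> real (Suc K)" using mult_left_mono[OF w1[of x], of "real (Suc K)"] by simp
    ultimately show ?thesis by (simp only: atLeastAtMost_iff zero_le_ceiling ceiling_le_iff) auto
  qed
  have wu: "w x \<le> u K x" and u1: "u K x \<le> 1" for K x
    using lev[of K x] w1[of x] le_of_int_ceiling[of "real (Suc K) * w x"]
    by (auto simp: u_def field_simps simp del: of_nat_Suc)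
  have u0: "0 \<le> u K x" for K x using wu[of x K] w0[of x] by linarith
  have [measurable]: "u K \<in> borel_measurable borel" for K unfolding u_def mem_ball by measurable
  have ulim: "(\<lambda>K. u K x) \<longlonglongrightarrow> w x" for x
  proof (rule tendsto_sandwich)
    show "\<forall>\<^sub>F K in sequentially. w x \<le> u K x" using wu by simp
    obtain K0 :: nat where K0: "norm x < real K0" using reals_Archimedean2 by blast
    show "\<forall>\<^sub>F K in sequentially. u K x \<le> w x + 1 / real (Suc K)"
      using eventually_ge_at_top[of K0]
    proof eventually_elim
      case (elim K)
      then have "x \<in> ball 0 (real (Suc K))" using K0 by auto
      moreover have "real_of_int \<lceil>real (Suc K) * w x\<rceil> \<le> real (Suc K) * w x + 1"
        using ceiling_correct[of "real (Suc K) * w x"] by linarith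
      ultimately show ?case by (simp add: u_def field_simps del: of_nat_Suc)
    qed
    show "(\<lambda>K. w x + 1 / real (Suc K)) \<longlonglongrightarrow> w x"
      using LIMSEQ_inverse_real_of_nat_add[of "w x"] by (simp only: inverse_eq_divide)
  qed simp
  \<comment> \<open>The product of \<open>u K\<close> over the points, written through counts and
    therefore measurable. At level 0 the convention 0^0 = 1 lets an empty level set contribute
    1.\<close>
  define W where "W K \<omega> = (\<Prod>j<Suc (Suc K). (real j / real (Suc K)) ^ card (\<Phi> \<omega> \<inter> A K j))" for K \<omega>
  have card_meas[measurable]: "(\<lambda>\<omega>. card (\<Phi> \<omega> \<inter> A K j)) \<in> M \<rightarrow>\<^sub>M count_space UNIV" for K j
    by (rule poisson_process_measurable_card[OF P A Ab])
  have [measurable]: "W K \<in> borel_measurable M" for K unfolding W_def by measurable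
  have W01: "0 \<le> W K \<omega>" "W K \<omega> \<le> 1" for K \<omega>
  proof -
    have "0 \<le> (real j / real (Suc K)) ^ card (\<Phi> \<omega> \<inter> A K j) \<and> (real j / real (Suc K)) ^ card (\<Phi> \<omega> \<inter> A K j) \<le> 1"
      if "j < Suc (Suc K)" for j
      using that by (intro conjI zero_le_power power_le_one) (auto simp del: of_nat_Suc)
    then show "0 \<le> W K \<omega>" "W K \<omega> \<le> 1"
      unfolding W_def by (auto intro!: prod_nonneg prod_le_1 simp del: prod.lessThan_Suc of_nat_Suc)
  qed
  have WX: "W K \<omega> = config_prod (u K) (\<Phi> \<omega>)" if "locally_finite (\<Phi> \<omega>)" for K \<omega>
  proof -
    let ?b = "ball 0 (real (Suc K)) :: plane set"
    let ?S = "\<Phi> \<omega> \<inter> ?b"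
    let ?g = "\<lambda>x. nat \<lceil>real (Suc K) * w x\<rceil>"
    have fin: "finite ?S" using that unfolding locally_finite_def by (meson bounded_ball)
    have "config_prod (u K) (\<Phi> \<omega>) = (\<Prod>x\<in>?S. u K x) * config_prod (u K) (\<Phi> \<omega> - ?S)"
      by (rule config_prod_split[OF u0 u1 fin]) auto
    also have "config_prod (u K) (\<Phi> \<omega> - ?S) = 1"
    proof (rule antisym)
      show "1 \<le> config_prod (u K) (\<Phi> \<omega> - ?S)"
      proof (rule le_config_prod)
        fix F assume "F \<subseteq> \<Phi> \<omega> - ?S"
        then have "(\<Prod>x\<in>F. u K x) = (\<Prod>x\<in>F. 1)" by (intro prod.cong) (auto simp: u_def)
        then show "1 \<le> (\<Prod>x\<in>F. u K x)" by simp
      qed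
    qed (rule config_prod_le_1[OF u0])
    also have "(\<Prod>x\<in>?S. u K x) = (\<Prod>j<Suc (Suc K). \<Prod>x\<in>{x\<in>?S. ?g x = j}. u K x)"
    proof (rule prod.group[symmetric, OF fin])
      have "?g x < Suc (Suc K)" for x using lev[of K x] unfolding atLeastAtMost_iff by linarith
      then show "?g ` ?S \<subseteq> {..<Suc (Suc K)}" by blast
    qed auto
    also have "\<dots> = W K \<omega>"
      unfolding W_def
    proof (rule prod.cong[OF refl])
      fix j
      have "{x\<in>?S. ?g x = j} = \<Phi> \<omega> \<inter> A K j"
        using lev[of K] unfolding A_def by auto
      moreover have "(\<Prod>x\<in>{x\<in>?S. ?g x = j}. u K x) = (\<Prod>x\<in>{x\<in>?S. ?g x = j}. real j / real (Suc K))"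
        by (rule prod.cong[OF refl]) (use lev[of K] in \<open>auto simp: u_def\<close>)
      ultimately show "(\<Prod>x\<in>{x\<in>?S. ?g x = j}. u K x) = (real j / real (Suc K)) ^ card (\<Phi> \<omega> \<inter> A K j)"
        by simp
    qed
    finally show ?thesis by simp
  qed
  have intW: "(\<integral>\<omega>. W K \<omega> \<partial>M) = exp (- (l * (\<integral>x. 1 - u K x \<partial>lborel)))" for K
  proof -
    let ?q = "\<lambda>j. real j / real (Suc K)"
    have indep: "indep_vars (\<lambda>_. count_space UNIV) (\<lambda>j \<omega>. card (\<Phi> \<omega> \<inter> A K j)) {..<Suc (Suc K)}"
    proof -
      have "disjoint_family_on (A K) {..<Suc (Suc K)}" by (auto simp: disjoint_family_on_def A_def)
      then show ?thesis using A Ab by (intro poisson_process_indep[OF P]) auto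
    qed
    have "(\<integral>\<^sup>+\<omega>. ennreal (W K \<omega>) \<partial>M) =
        (\<integral>\<^sup>+\<omega>. (\<Prod>j<Suc (Suc K). ennreal (?q j ^ card (\<Phi> \<omega> \<inter> A K j))) \<partial>M)"
      unfolding W_def by (simp add: prod_ennreal del: prod.lessThan_Suc of_nat_Suc)
    also have "\<dots> = (\<Prod>j<Suc (Suc K). \<integral>\<^sup>+\<omega>. ennreal (?q j ^ card (\<Phi> \<omega> \<inter> A K j)) \<partial>M)"
      by (rule indep_vars_nn_integral[OF _ indep_vars_compose2[OF indep]]) auto
    also have "\<dots> = (\<Prod>j<Suc (Suc K). ennreal (exp (- (l * measure lborel (A K j) * (1 - ?q j)))))"
      by (intro prod.cong refl poisson_process_count[OF P l A Ab]) simp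
    also have "\<dots> = ennreal (exp (\<Sum>j<Suc (Suc K). - (l * measure lborel (A K j) * (1 - ?q j))))"
      by (simp only: prod_ennreal exp_ge_zero exp_sum finite_lessThan)
    also have "(\<Sum>j<Suc (Suc K). - (l * measure lborel (A K j) * (1 - ?q j))) =
       - (l * (\<Sum>j<Suc (Suc K). (1 - ?q j) * measure lborel (A K j)))"
      by (simp only: sum_distrib_left sum_negf mult_ac)
    \<comment> \<open>The sum is the integral of a step function: \<open>1 - u K\<close> has the
      value \<open>1 - ?q j\<close> on \<open>A K j\<close> and vanishes off the ball.\<close>
    also have "(\<Sum>j<Suc (Suc K). (1 - ?q j) * measure lborel (A K j)) = (\<integral>x. 1 - u K x \<partial>lborel)"
    proof -
      have "1 - u K x = (\<Sum>j<Suc (Suc K). (1 - ?q j) * indicator (A K j) x)" for x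
      proof (cases "x \<in> ball 0 (real (Suc K))")
        case True
        define i where "i = nat \<lceil>real (Suc K) * w x\<rceil>"
        have i: "\<lceil>real (Suc K) * w x\<rceil> = int i" "i < Suc (Suc K)" using lev[of K x] by (auto simp: i_def simp del: of_nat_Suc)
        have "(\<Sum>j<Suc (Suc K). (1 - ?q j) * indicator (A K j) x) = (\<Sum>j<Suc (Suc K). if j = i then 1 - ?q j else 0)"
          using True i(1) by (intro sum.cong) (auto simp: A_def simp del: of_nat_Suc)
        also have "\<dots> = 1 - ?q i" using i(2) by (subst sum.delta) auto
        also have "\<dots> = 1 - u K x" using True i(1) by (simp add: u_def del: of_nat_Suc)
        finally show ?thesis by simp
      next
        case False then show ?thesis by (simp add: u_def A_def)
      qed
      moreover have "emeasure lborel (A K j) < \<infinity>" for j using Ab by (rule emeasure_bounded_finite)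
      ultimately have "(\<integral>x. 1 - u K x \<partial>lborel) =
          (\<Sum>j<Suc (Suc K). \<integral>x. (1 - ?q j) * indicator (A K j) x \<partial>lborel)"
        by (simp only:) (intro Bochner_Integration.integral_sum integrable_mult_right integrable_real_indicator, auto)
      also have "\<dots> = (\<Sum>j<Suc (Suc K). (1 - ?q j) * measure lborel (A K j))"
        by (intro sum.cong refl) (simp del: of_nat_Suc)
      finally show ?thesis by simp
    qed
    finally show ?thesis
      using W01 by (subst integral_eq_nn_integral) auto
  qed
  \<comment> \<open>The limit is taken of the measurable W, which agrees with the products of
    \<open>u K\<close> on the almost sure event of local finiteness.\<close>
  define Y where "Y \<omega> = lim (\<lambda>K. W K \<omega>)" for \<omega>
  have Y[measurable]: "Y \<in> borel_measurable M" unfolding Y_def by measurable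
  have lf: "AE \<omega> in M. locally_finite (\<Phi> \<omega>)" using P by (simp add: poisson_process_def)
  have conv: "AE \<omega> in M. (\<lambda>K. W K \<omega>) \<longlonglongrightarrow> config_prod w (\<Phi> \<omega>)"
    using lf
  proof eventually_elim
    case (elim \<omega>)
    then show ?case using config_prod_tendsto_above[of w u "\<Phi> \<omega>"] w0 wu ulim by (simp add: WX)
  qed
  have "AE \<omega> in M. config_prod w (\<Phi> \<omega>) = Y \<omega>"
    using conv by eventually_elim (simp add: Y_def limI)
  moreover have "(\<integral>\<omega>. Y \<omega> \<partial>M) = exp (- (l * (\<integral>x. 1 - w x \<partial>lborel)))"
  proof (rule LIMSEQ_unique)
    show "(\<lambda>K. \<integral>\<omega>. W K \<omega> \<partial>M) \<longlonglongrightarrow> (\<integral>\<omega>. Y \<omega> \<partial>M)"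
      by (rule integral_dominated_convergence[where w = "\<lambda>_. 1"])
        (use conv W01 in \<open>auto simp: Y_def intro: convergent_LIMSEQ_iff[THEN iffD1, OF convergentI] elim!: eventually_mono\<close>)
    \<comment> \<open>Since \<open>u K\<close> lies between w and 1, the integrable function
      \<open>1 - w\<close> dominates \<open>1 - u K\<close>.\<close>
    have "(\<lambda>K. \<integral>x. 1 - u K x \<partial>lborel) \<longlonglongrightarrow> (\<integral>x. 1 - w x \<partial>lborel)"
      by (rule integral_dominated_convergence[where w = "\<lambda>x. 1 - w x"])
        (use int wu u1 in \<open>auto intro!: tendsto_diff ulim\<close>)
    then show "(\<lambda>K. \<integral>\<omega>. W K \<omega> \<partial>M) \<longlonglongrightarrow> exp (- (l * (\<integral>x. 1 - w x \<partial>lborel)))"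
      unfolding intW by (intro tendsto_intros)
  qed
  ultimately show "\<exists>Y\<in>borel_measurable M. (AE \<omega> in M. config_prod w (\<Phi> \<omega>) = Y \<omega>) \<and>
      (\<integral>\<omega>. Y \<omega> \<partial>M) = exp (- (l * (\<integral>x. 1 - w x \<partial>lborel)))"
    using Y by blast
qed

section \<open>Laplace functional of a Neyman-Scott process\<close>

text \<open>The integrand depends on the coordinates in I only, so the projection to I carries the
  infinite product measure to a finite one, where the product formula applies.\<close>

lemma nn_integral_PiM_prod:
  assumes M: "\<And>i. prob_space (M i)" and I: "finite I" "I \<subseteq> J"
    and h: "\<And>i. i \<in> I \<Longrightarrow> h i \<in> borel_measurable (M i)"
  shows "(\<integral>\<^sup>+ \<omega>. (\<Prod>i\<in>I. h i (\<omega> i)) \<partial>PiM J M) = (\<Prod>i\<in>I. \<integral>\<^sup>+ x. h i x \<partial>M i)"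
proof -
  interpret prob_space "M k" for k by (rule M)
  interpret product_prob_space M J by unfold_locales
  have meas: "(\<lambda>\<omega>. \<Prod>i\<in>I. h i (\<omega> i)) \<in> borel_measurable (PiM I M)"
    using h by (intro borel_measurable_prod_ennreal measurable_compose[OF measurable_component_singleton])
  have "(\<Prod>i\<in>I. \<integral>\<^sup>+ x. h i x \<partial>M i) = (\<integral>\<^sup>+ \<omega>. (\<Prod>i\<in>I. h i (\<omega> i)) \<partial>PiM I M)"
    by (rule product_nn_integral_prod[symmetric]) (use I h in auto)
  also have "\<dots> = (\<integral>\<^sup>+ \<omega>. (\<Prod>i\<in>I. h i (restrict \<omega> I i)) \<partial>PiM J M)"
    by (subst distr_PiM_restrict_finite[OF I, symmetric], subst nn_integral_distr)
      (use meas I in \<open>auto intro!: measurable_restrict_subset\<close>)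
  also have "\<dots> = (\<integral>\<^sup>+ \<omega>. (\<Prod>i\<in>I. h i (\<omega> i)) \<partial>PiM J M)" by simp
  finally show ?thesis by simp
qed

text \<open>With the j-th coordinate fixed, the i-th would have to hit one single point, a null
  event for an atomless law. Applied to displacements, this separates the points of all clusters
  almost surely.\<close>

lemma AE_PiM_neq_translate:
  fixes M :: "'i \<Rightarrow> 'a::euclidean_space measure" and i j :: 'i
  assumes M: "\<And>i. prob_space (M i)" and s: "\<And>i. sets (M i) = sets borel"
    and atomless: "\<And>i x. emeasure (M i) {x} = 0"
    and ij: "i \<noteq> j" "i \<in> J" "j \<in> J"
  shows "AE \<omega> in PiM J M. a + \<omega> i \<noteq> b + \<omega> j"
proof -
  interpret prob_space "M k" for k by (rule M)
  interpret product_prob_space M J by unfold_locales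
  let ?I = "{i, j}"
  let ?f = "\<lambda>\<omega>. indicator {\<omega>. a + \<omega> i = b + \<omega> j} \<omega> :: ennreal"
  have meas: "(\<lambda>\<omega>. ?f \<omega>) \<in> borel_measurable (PiM K M)" if "i \<in> K" "j \<in> K" for K
  proof -
    note [measurable] = measurable_component_singleton[OF \<open>i \<in> K\<close>, of "\<lambda>_. borel :: 'a measure"]
      measurable_component_singleton[OF \<open>j \<in> K\<close>, of "\<lambda>_. borel :: 'a measure"]
    \<comment> \<open>Equality is tested as vanishing of the distance, a real-valued function whose
      measurability is immediate.\<close>
    have "(\<lambda>\<omega>. indicator {0} (dist (a + \<omega> i) (b + \<omega> j)) :: ennreal) \<in> borel_measurable (PiM K (\<lambda>_. borel))"
      by measurable
    moreover have "sets (PiM K M) = sets (PiM K (\<lambda>_. borel))" by (intro sets_PiM_cong) (auto simp: s)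
    ultimately have "(\<lambda>\<omega>. indicator {0} (dist (a + \<omega> i) (b + \<omega> j)) :: ennreal) \<in> borel_measurable (PiM K M)"
      by (simp cong: measurable_cong_sets)
    then show ?thesis by (simp add: indicator_def)
  qed
  have "(\<integral>\<^sup>+ \<omega>. ?f \<omega> \<partial>PiM ?I M) = (\<integral>\<^sup>+ x. (\<integral>\<^sup>+ y. ?f (x(i := y)) \<partial>M i) \<partial>PiM {j} M)"
    by (rule product_nn_integral_insert) (use ij(1) meas[of ?I] in simp_all)
  also have "\<dots> = (\<integral>\<^sup>+ x. 0 \<partial>PiM {j} M)"
  proof (rule nn_integral_cong)
    fix x
    have "(\<integral>\<^sup>+ y. ?f (x(i := y)) \<partial>M i) = (\<integral>\<^sup>+ y. indicator {b + x j - a} y \<partial>M i)"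
      using ij by (intro nn_integral_cong) (auto simp: indicator_def algebra_simps)
    also have "\<dots> = 0" using atomless by (subst nn_integral_indicator) (auto simp: s)
    finally show "(\<integral>\<^sup>+ y. ?f (x(i := y)) \<partial>M i) = 0" .
  qed
  finally have z: "(\<integral>\<^sup>+ \<omega>. ?f \<omega> \<partial>PiM ?I M) = 0" by simp
  have "(\<integral>\<^sup>+ \<omega>. ?f \<omega> \<partial>PiM ?I M) = (\<integral>\<^sup>+ \<omega>. ?f (restrict \<omega> ?I) \<partial>PiM J M)"
    by (subst distr_PiM_restrict_finite[symmetric], simp, use ij in simp, subst nn_integral_distr)
      (use meas[of ?I] ij in \<open>auto intro!: measurable_restrict_subset\<close>)
  also have "\<dots> = (\<integral>\<^sup>+ \<omega>. ?f \<omega> \<partial>PiM J M)" by (intro nn_integral_cong) (simp add: indicator_def)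
  finally have "AE \<omega> in PiM J M. ?f \<omega> = 0"
    using z meas[OF ij(2,3)] by (simp add: nn_integral_0_iff_AE)
  then show ?thesis by eventually_elim (auto simp: indicator_def split: if_splits)
qed

text \<open>Mean of h at a random point of a cluster with parent p. For h = 1 - w it is the mean
  loss of weight per point; for the interference kernel it is \<beta> up to a reflection.\<close>

definition smear :: "(plane \<Rightarrow> real) \<Rightarrow> (plane \<Rightarrow> real) \<Rightarrow> plane \<Rightarrow> real" where
  "smear f h p = (\<integral>d. h (p + d) * f d \<partial>lborel)"

lemma prob_density_measurable: "prob_density f \<Longrightarrow> f \<in> borel_measurable borel"
  and prob_density_nonneg: "prob_density f \<Longrightarrow> 0 \<le> f x"
  and prob_density_nn_integral: "prob_density f \<Longrightarrow> (\<integral>\<^sup>+ x. ennreal (f x) \<partial>lborel) = 1"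
  by (auto simp: prob_density_def)

lemma prob_density_integrable: "prob_density f \<Longrightarrow> integrable lborel f"
  by (rule integrableI_nonneg) (auto simp: prob_density_def)

lemma prob_density_integral: "prob_density f \<Longrightarrow> (\<integral>x. f x \<partial>lborel) = 1"
  by (subst integral_eq_nn_integral) (auto simp: prob_density_def)

lemma prob_space_prob_density:
  "prob_density f \<Longrightarrow> prob_space (density lborel (\<lambda>x. ennreal (f x)))"
  by (rule prob_spaceI) (auto simp: prob_density_def emeasure_density)

section \<open>Averages over the displacement of a cluster point\<close>

context
  fixes f h :: "plane \<Rightarrow> real"
  assumes f: "prob_density f" and h[measurable]: "h \<in> borel_measurable borel"
    and h01: "\<And>x. 0 \<le> h x" "\<And>x. h x \<le> 1"
begin

lemma smear_integrand_integrable: "integrable lborel (\<lambda>d. h (p + d) * f d)"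
proof (rule Bochner_Integration.integrable_bound[OF prob_density_integrable[OF f]])
  note [measurable] = prob_density_measurable[OF f]
  show "(\<lambda>d. h (p + d) * f d) \<in> borel_measurable lborel" by measurable
  show "AE d in lborel. norm (h (p + d) * f d) \<le> norm (f d)"
    using h01 prob_density_nonneg[OF f] by (auto simp: abs_mult mult_left_le_one_le)
qed

lemma smear_nonneg: "0 \<le> smear f h p"
  unfolding smear_def by (rule integral_nonneg_AE) (use h01 prob_density_nonneg[OF f] in auto)

lemma smear_le_1: "smear f h p \<le> 1"
proof -
  have "smear f h p \<le> (\<integral>d. f d \<partial>lborel)" unfolding smear_def
    by (rule integral_mono[OF smear_integrand_integrable prob_density_integrable[OF f]])
      (use h01 prob_density_nonneg[OF f] in \<open>auto simp: mult_left_le_one_le\<close>)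
  then show ?thesis by (simp add: prob_density_integral[OF f])
qed

lemma smear_measurable[measurable]: "smear f h \<in> borel_measurable borel"
proof -
  note [measurable] = prob_density_measurable[OF f]
  show ?thesis unfolding smear_def by measurable
qed

lemma ennreal_smear: "ennreal (smear f h p) = (\<integral>\<^sup>+ d. ennreal (h (p + d)) * ennreal (f d) \<partial>lborel)"
  unfolding smear_def using h01 prob_density_nonneg[OF f]
  by (subst nn_integral_eq_integral[symmetric, OF smear_integrand_integrable]) (auto simp: ennreal_mult)

text \<open>Tonelli and translation invariance: displacements move mass but preserve it. This is why
  a clustered process and a Poisson process of equal intensity agree to first order in the
  exponent.\<close>

lemma nn_integral_smear: "(\<integral>\<^sup>+ p. ennreal (smear f h p) \<partial>lborel) = (\<integral>\<^sup>+ p. ennreal (h p) \<partial>lborel)"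
proof -
  note [measurable] = prob_density_measurable[OF f]
  have "(\<integral>\<^sup>+ p. ennreal (smear f h p) \<partial>lborel) =
      (\<integral>\<^sup>+ d. \<integral>\<^sup>+ p. ennreal (h (p + d)) * ennreal (f d) \<partial>lborel \<partial>lborel)"
    unfolding ennreal_smear by (rule lborel_pair.Fubini'[symmetric]) measurable
  also have "\<dots> = (\<integral>\<^sup>+ d. (\<integral>\<^sup>+ p. ennreal (h p) \<partial>lborel) * ennreal (f d) \<partial>lborel)"
  proof (rule nn_integral_cong)
    fix d
    have "(\<integral>\<^sup>+ p. ennreal (h p) \<partial>lborel) = (\<integral>\<^sup>+ p. ennreal (h (p + d)) \<partial>lborel)"
      by (subst lborel_distr_plus[of d, symmetric], subst nn_integral_distr) (auto simp: add.commute)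
    then show "(\<integral>\<^sup>+ p. ennreal (h (p + d)) * ennreal (f d) \<partial>lborel) = (\<integral>\<^sup>+ p. ennreal (h p) \<partial>lborel) * ennreal (f d)"
      by (subst nn_integral_multc) auto
  qed
  also have "\<dots> = (\<integral>\<^sup>+ p. ennreal (h p) \<partial>lborel)"
    by (subst nn_integral_cmult) (auto simp: prob_density_nn_integral[OF f])
  finally show ?thesis .
qed

lemma smear_integrable:
  assumes "integrable lborel h"
  shows "integrable lborel (smear f h)"
  by (rule integrableI_nonneg)
    (use assms smear_nonneg h01 in \<open>auto simp: nn_integral_smear nn_integral_eq_integral\<close>)

lemma integral_smear: "(\<integral>p. smear f h p \<partial>lborel) = (\<integral>p. h p \<partial>lborel)"
  using smear_nonneg h01 by (simp add: integral_eq_nn_integral nn_integral_smear)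

end

lemma exp_diff_bounds:
  fixes x :: real
  assumes "0 \<le> x"
  shows "0 \<le> 1 - exp (- x)" "1 - exp (- x) \<le> x" "1 - exp (-x) \<le> 1"
  using assms exp_ge_add_one_self[of "- x"] by auto

lemma exp_smear_integrable:
  assumes f: "prob_density f" and h[measurable]: "h \<in> borel_measurable borel"
    and h01: "\<And>x. 0 \<le> h x" "\<And>x. h x \<le> 1" and int: "integrable lborel h" and c: "0 \<le> c"
  shows "integrable lborel (\<lambda>p. 1 - exp (- c * smear f h p))"
proof (rule Bochner_Integration.integrable_bound)
  show "integrable lborel (\<lambda>p. c * smear f h p)"
    using smear_integrable[OF f h h01 int] by simp
  note [measurable] = smear_measurable[OF f h h01]
  show "(\<lambda>p. 1 - exp (- c * smear f h p)) \<in> borel_measurable lborel" by measurable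
  show "AE p in lborel. norm (1 - exp (- c * smear f h p)) \<le> norm (c * smear f h p)"
    using exp_diff_bounds[of "c * smear f h _"] smear_nonneg[OF f h h01] c by auto
qed

text \<open>The clusters are integrated out in two stages. Given parents and sizes, each
  displacement contributes a factor \<open>q p\<close>; the Poisson size then turns
  \<open>q p ^ u\<close> into \<open>Q p\<close>. What remains is the Laplace functional of the
  parent process at the weight Q. The computation treats the first m parents, and bounded
  convergence removes the truncation.\<close>

lemma neyman_scott_process_laplace:
  fixes M :: "'w measure"
  assumes NS: "neyman_scott_process M lp c f \<Phi>" and lp: "0 < lp" and c: "0 < c" and f: "prob_density f"
  shows "has_laplace_exponent M \<Phi> (\<lambda>w. lp * (\<integral>p. 1 - exp (- c * smear f (\<lambda>x. 1 - w x) p) \<partial>lborel))"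
  unfolding has_laplace_exponent_def
proof (intro allI impI, elim conjE)
  fix w :: "plane \<Rightarrow> real"
  assume w[measurable]: "w \<in> borel_measurable borel" and w01: "\<forall>x. 0 \<le> w x \<and> w x \<le> 1"
    and int: "integrable lborel (\<lambda>x. 1 - w x)"
  have w0: "0 \<le> w x" and w1: "w x \<le> 1" for x using w01 by auto
  let ?\<nu> = "density lborel (\<lambda>x. ennreal (f x)) :: plane measure"
  let ?PN = "PiM UNIV (\<lambda>_::nat. measure_pmf (poisson_pmf c))"
  let ?PD = "PiM UNIV (\<lambda>_::nat \<times> nat. ?\<nu>)"
  obtain X :: "nat \<Rightarrow> 'w \<Rightarrow> plane" and N :: "nat \<Rightarrow> 'w \<Rightarrow> nat" and D :: "nat \<times> nat \<Rightarrow> 'w \<Rightarrow> plane"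
    where X': "\<forall>n. X n \<in> M \<rightarrow>\<^sub>M borel"
      and N': "\<forall>n. N n \<in> M \<rightarrow>\<^sub>M count_space UNIV"
      and D': "\<forall>i. D i \<in> M \<rightarrow>\<^sub>M borel"
      and P: "poisson_process M lp (\<lambda>\<omega>. range (\<lambda>n. X n \<omega>))"
      and inj: "AE \<omega> in M. inj (\<lambda>n. X n \<omega>)"
      and law: "distr M
          (PiM UNIV (\<lambda>_. borel) \<Otimes>\<^sub>M PiM UNIV (\<lambda>_. count_space UNIV) \<Otimes>\<^sub>M PiM UNIV (\<lambda>_. borel))
          (\<lambda>\<omega>. (\<lambda>n. X n \<omega>, \<lambda>n. N n \<omega>, \<lambda>i. D i \<omega>)) =
        distr M (PiM UNIV (\<lambda>_. borel)) (\<lambda>\<omega> n. X n \<omega>) \<Otimes>\<^sub>M ?PN \<Otimes>\<^sub>M ?PD"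
      and \<Phi>: "AE \<omega> in M. \<Phi> \<omega> = {X n \<omega> + D (n, k) \<omega> | n k. k < N n \<omega>}"
    using NS unfolding neyman_scott_process_def by (elim exE conjE) (rule that; assumption)
  have X[measurable]: "X n \<in> M \<rightarrow>\<^sub>M borel" and N[measurable]: "N n \<in> M \<rightarrow>\<^sub>M count_space UNIV"
    and D[measurable]: "D i \<in> M \<rightarrow>\<^sub>M borel" for n i
    by (rule X'[rule_format] N'[rule_format] D'[rule_format])+
  interpret M: prob_space M using P by (rule poisson_process_prob_space)
  interpret nu: prob_space ?\<nu> by (rule prob_space_prob_density[OF f])
  interpret PN: prob_space ?PN by (intro prob_space_PiM measure_pmf.prob_space_axioms)
  interpret PD: prob_space ?PD by (intro prob_space_PiM nu.prob_space_axioms)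
  let ?S = "PiM UNIV (\<lambda>_::nat. borel :: plane measure) \<Otimes>\<^sub>M
    PiM UNIV (\<lambda>_::nat. count_space (UNIV :: nat set)) \<Otimes>\<^sub>M PiM UNIV (\<lambda>_::nat \<times> nat. borel :: plane measure)"
  let ?PX = "distr M (PiM UNIV (\<lambda>_. borel)) (\<lambda>\<omega> n. X n \<omega>)"
  let ?J = "\<lambda>\<omega>. (\<lambda>n. X n \<omega>, \<lambda>n. N n \<omega>, \<lambda>i. D i \<omega>)"
  have Xm[measurable]: "(\<lambda>\<omega> n. X n \<omega>) \<in> M \<rightarrow>\<^sub>M PiM UNIV (\<lambda>_. borel)"
    by (rule measurable_PiM_single') auto
  have J[measurable]: "?J \<in> M \<rightarrow>\<^sub>M ?S"
    by (intro measurable_Pair measurable_PiM_single') auto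
  have nu0: "emeasure ?\<nu> {x} = 0" for x
    using prob_density_measurable[OF f]
    by (subst emeasure_density) (auto intro!: nn_integral_null_set simp: null_sets_def)
  interpret PX: prob_space ?PX by (rule M.prob_space_distr[OF Xm])
  interpret ND: pair_prob_space ?PN ?PD ..
  interpret XND: pair_prob_space ?PX "?PN \<Otimes>\<^sub>M ?PD" ..
  have setsL: "sets (?PX \<Otimes>\<^sub>M ?PN \<Otimes>\<^sub>M ?PD) = sets ?S"
    by (simp only: law[symmetric] sets_distr)

  \<comment> \<open>The process is recorded as a set, so a product over index pairs is a product
    over points only when no two pairs give the same point.\<close>
  have distinct: "AE \<omega> in M. \<forall>n k m l. (n, k) \<noteq> (m, l) \<longrightarrow> X n \<omega> + D (n, k) \<omega> \<noteq> X m \<omega> + D (m, l) \<omega>"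
  proof -
    have "AE \<omega> in M. X n \<omega> + D (n, k) \<omega> \<noteq> X m \<omega> + D (m, l) \<omega>" if "(n, k) \<noteq> (m, l)" for n k m l
    proof -
      let ?P = "\<lambda>z::(nat \<Rightarrow> plane) \<times> (nat \<Rightarrow> nat) \<times> (nat \<times> nat \<Rightarrow> plane).
        0 < dist (fst z n + snd (snd z) (n, k)) (fst z m + snd (snd z) (m, l))"
      have meas: "{z \<in> space ?S. ?P z} \<in> sets ?S" by measurable
      have sp: "space (?PX \<Otimes>\<^sub>M ?PN \<Otimes>\<^sub>M ?PD) = space ?S" using setsL by (rule sets_eq_imp_space_eq)
      have "AE z in ?PX \<Otimes>\<^sub>M ?PN \<Otimes>\<^sub>M ?PD. ?P z"
      proof (rule XND.AE_pair_measure)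
        show "{z \<in> space (?PX \<Otimes>\<^sub>M ?PN \<Otimes>\<^sub>M ?PD). ?P z} \<in> sets (?PX \<Otimes>\<^sub>M ?PN \<Otimes>\<^sub>M ?PD)"
          using meas unfolding setsL sp .
        show "AE x in ?PX. AE y in ?PN \<Otimes>\<^sub>M ?PD. ?P (x, y)"
        proof (rule AE_I2, rule ND.AE_pair_measure)
          fix x
          have [measurable_cong]: "sets ?PD = sets (PiM UNIV (\<lambda>_. borel))"
            by (intro sets_PiM_cong) auto
          have "Measurable.pred (?PN \<Otimes>\<^sub>M ?PD) (\<lambda>y. 0 < dist (x n + snd y (n, k)) (x m + snd y (m, l)))"
            by measurable
          then show "{y \<in> space (?PN \<Otimes>\<^sub>M ?PD). ?P (x, y)} \<in> sets (?PN \<Otimes>\<^sub>M ?PD)"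
            by (simp add: pred_def)
          show "AE u in ?PN. AE d in ?PD. ?P (x, (u, d))"
            using AE_PiM_neq_translate[of "\<lambda>_. ?\<nu>" "(n, k)" "(m, l)" UNIV "x n" "x m"] that nu0
            by (simp add: nu.prob_space_axioms)
        qed
      qed
      then have "AE z in distr M ?S ?J. ?P z" by (simp only: law)
      from AE_distrD[OF J this] show ?thesis by simp
    qed
    then show ?thesis by (simp add: AE_all_countable)
  qed

  \<comment> \<open>\<open>q p\<close> is the mean weight of one point and \<open>Q p\<close> the
    mean weight of the whole cluster of a parent at p.\<close>
  define q where "q p = smear f w p" for p
  define Q where "Q p = exp (- c * smear f (\<lambda>x. 1 - w x) p)" for p
  have h: "(\<lambda>x. 1 - w x) \<in> borel_measurable borel" "\<And>x. 0 \<le> 1 - w x" "\<And>x. 1 - w x \<le> 1"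
    using w0 w1 by auto
  have qh: "smear f (\<lambda>x. 1 - w x) p = 1 - q p" for p
  proof -
    have "smear f (\<lambda>x. 1 - w x) p = (\<integral>d. f d - w (p + d) * f d \<partial>lborel)"
      by (simp add: smear_def algebra_simps)
    also have "\<dots> = (\<integral>d. f d \<partial>lborel) - q p"
      unfolding q_def smear_def
      by (rule Bochner_Integration.integral_diff[OF prob_density_integrable[OF f] smear_integrand_integrable[OF f w w0 w1]])
    finally show ?thesis by (simp add: prob_density_integral[OF f])
  qed
  have q01: "0 \<le> q p" "q p \<le> 1" for p
    unfolding q_def using smear_nonneg[OF f w w0 w1] smear_le_1[OF f w w0 w1] by auto
  have [measurable]: "q \<in> borel_measurable borel"
    unfolding q_def[abs_def] by (rule smear_measurable[OF f w w0 w1])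
  have Q01: "0 \<le> Q p" "Q p \<le> 1" for p
    using q01[of p] c by (auto simp: Q_def qh)
  have Qm[measurable]: "Q \<in> borel_measurable borel" unfolding Q_def qh by measurable
  have Qint: "integrable lborel (\<lambda>x. 1 - Q x)"
    unfolding Q_def using exp_smear_integrable[OF f h int] c by simp

  \<comment> \<open>W collects the weights of the clusters of the first m parents, V replaces each
    cluster by its mean weight. The two agree in mean only, which is enough because both are bounded
    by 1.\<close>
  define W where "W m \<omega> = (\<Prod>i<m. \<Prod>k<N i \<omega>. w (X i \<omega> + D (i, k) \<omega>))" for m \<omega>
  define V where "V m \<omega> = (\<Prod>i<m. Q (X i \<omega>))" for m \<omega>
  \<comment> \<open>The number of factors is random; measurability follows by splitting over the
    countably many values of \<open>N i\<close>.\<close>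
  have [measurable]: "(\<lambda>\<omega>. \<Prod>k<N i \<omega>. w (X i \<omega> + D (i, k) \<omega>)) \<in> borel_measurable M" for i
    by (rule measurable_compose_countable[where f = "\<lambda>n \<omega>. \<Prod>k<n. w (X i \<omega> + D (i, k) \<omega>)" and g = "N i"])
      measurable
  have [measurable]: "W m \<in> borel_measurable M" "V m \<in> borel_measurable M" for m
    unfolding W_def V_def by measurable
  have W01: "0 \<le> W m \<omega>" "W m \<omega> \<le> 1" and V01: "0 \<le> V m \<omega>" "V m \<omega> \<le> 1" for m \<omega>
    unfolding W_def V_def by (auto intro!: prod_nonneg prod_le_1 simp: w0 w1 Q01)

  have WV: "(\<integral>\<omega>. W m \<omega> \<partial>M) = (\<integral>\<omega>. V m \<omega> \<partial>M)" for m
  proof -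
    let ?G = "\<lambda>z::(nat \<Rightarrow> plane) \<times> (nat \<Rightarrow> nat) \<times> (nat \<times> nat \<Rightarrow> plane).
      ennreal (\<Prod>i<m. \<Prod>k<fst (snd z) i. w (fst z i + snd (snd z) (i, k)))"
    have "(\<lambda>z::(nat \<Rightarrow> plane) \<times> (nat \<Rightarrow> nat) \<times> (nat \<times> nat \<Rightarrow> plane).
       \<Prod>k<fst (snd z) i. w (fst z i + snd (snd z) (i, k))) \<in> borel_measurable ?S" for i
      by (rule measurable_compose_countable[where g = "\<lambda>z. fst (snd z) i"
         and f = "\<lambda>n z. \<Prod>k<n. w (fst z i + snd (snd z) (i, k))"]) measurable
    then have Gm: "?G \<in> borel_measurable ?S" by measurable
    have GmL: "?G \<in> borel_measurable (?PX \<Otimes>\<^sub>M ?PN \<Otimes>\<^sub>M ?PD)"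
      using Gm setsL by (simp cong: measurable_cong_sets)
    have inner: "(\<integral>\<^sup>+ d. ?G (x, u, d) \<partial>?PD) = (\<Prod>i<m. ennreal (q (x i) ^ u i))" for x u
    proof -
      let ?I = "Sigma {..<m} (\<lambda>i. {..<u i})"
      have "(\<integral>\<^sup>+ d. ?G (x, u, d) \<partial>?PD) = (\<integral>\<^sup>+ d. (\<Prod>ik\<in>?I. ennreal (w (x (fst ik) + d ik))) \<partial>?PD)"
        by (simp add: prod.Sigma prod_ennreal w0 split_beta)
      also have "\<dots> = (\<Prod>ik\<in>?I. \<integral>\<^sup>+ d. ennreal (w (x (fst ik) + d)) \<partial>?\<nu>)"
        by (rule nn_integral_PiM_prod) (auto simp: nu.prob_space_axioms)
      also have "\<dots> = (\<Prod>ik\<in>?I. ennreal (q (x (fst ik))))"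
        using prob_density_measurable[OF f] prob_density_nonneg[OF f]
        by (intro prod.cong refl) (simp add: q_def ennreal_smear[OF f w w0 w1] nn_integral_density mult.commute)
      also have "\<dots> = (\<Prod>i<m. ennreal (q (x i) ^ u i))"
        using prod.Sigma[of "{..<m}" "\<lambda>i. {..<u i}" "\<lambda>i _. ennreal (q (x i))"]
        by (simp add: q01 ennreal_power split_beta)
      finally show ?thesis .
    qed
    have middle: "(\<integral>\<^sup>+ u. (\<Prod>i<m. ennreal (q (x i) ^ u i)) \<partial>?PN) = (\<Prod>i<m. ennreal (Q (x i)))" for x
    proof -
      have "(\<integral>\<^sup>+ u. (\<Prod>i<m. ennreal (q (x i) ^ u i)) \<partial>?PN) =
          (\<Prod>i<m. \<integral>\<^sup>+ u. ennreal (q (x i) ^ u) \<partial>measure_pmf (poisson_pmf c))"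
        by (rule nn_integral_PiM_prod) (auto simp: measure_pmf.prob_space_axioms)
      also have "\<dots> = (\<Prod>i<m. ennreal (Q (x i)))"
      proof (rule prod.cong[OF refl])
        fix i
        have "(\<integral>\<^sup>+ u. ennreal (q (x i) ^ u) \<partial>measure_pmf (poisson_pmf c)) =
            (\<Sum>u. ennreal (q (x i) ^ u * (c ^ u / fact u * exp (- c))))"
          unfolding nn_integral_measure_pmf nn_integral_count_space_nat
          using q01 c by (intro suminf_cong) (simp add: ennreal_mult'[symmetric] mult_ac)
        also have "\<dots> = ennreal (exp (- c * (1 - q (x i))))"
          using poisson_generating_sums[of "q (x i)" c] q01 c by (intro suminf_ennreal_eq) auto
        finally show "(\<integral>\<^sup>+ u. ennreal (q (x i) ^ u) \<partial>measure_pmf (poisson_pmf c)) = ennreal (Q (x i))"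
          by (simp add: Q_def qh)
      qed
      finally show ?thesis .
    qed
    \<comment> \<open>The joint law is a product, so the mean becomes an iterated integral:
      displacements innermost, then sizes, then parents.\<close>
    have "(\<integral>\<^sup>+ \<omega>. ennreal (W m \<omega>) \<partial>M) = (\<integral>\<^sup>+ z. ?G z \<partial>distr M ?S ?J)"
      using Gm J by (subst nn_integral_distr) (auto simp: W_def)
    also have "\<dots> = (\<integral>\<^sup>+ x. (\<integral>\<^sup>+ y. ?G (x, y) \<partial>(?PN \<Otimes>\<^sub>M ?PD)) \<partial>?PX)"
      unfolding law by (rule ND.nn_integral_fst[symmetric, OF GmL])
    also have "\<dots> = (\<integral>\<^sup>+ x. (\<integral>\<^sup>+ u. (\<integral>\<^sup>+ d. ?G (x, u, d) \<partial>?PD) \<partial>?PN) \<partial>?PX)"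
    proof (rule nn_integral_cong)
      fix x assume "x \<in> space ?PX"
      then have "(\<lambda>y. ?G (x, y)) \<in> borel_measurable (?PN \<Otimes>\<^sub>M ?PD)"
        using measurable_compose[OF measurable_Pair1' GmL] by simp
      then show "(\<integral>\<^sup>+ y. ?G (x, y) \<partial>(?PN \<Otimes>\<^sub>M ?PD)) = (\<integral>\<^sup>+ u. (\<integral>\<^sup>+ d. ?G (x, u, d) \<partial>?PD) \<partial>?PN)"
        by (rule PD.nn_integral_fst[symmetric])
    qed
    also have "\<dots> = (\<integral>\<^sup>+ x. (\<Prod>i<m. ennreal (Q (x i))) \<partial>?PX)"
      unfolding inner middle ..
    also have "\<dots> = (\<integral>\<^sup>+ \<omega>. ennreal (V m \<omega>) \<partial>M)"
      using Xm by (subst nn_integral_distr) (auto simp: V_def prod_ennreal Q01)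
    finally show ?thesis using W01 V01 by (simp add: integral_eq_nn_integral)
  qed

  have convW: "AE \<omega> in M. (\<lambda>m. W m \<omega>) \<longlonglongrightarrow> config_prod w (\<Phi> \<omega>)"
    using distinct \<Phi>
  proof eventually_elim
    case (elim \<omega>)
    let ?F = "\<lambda>m. (\<lambda>(n, k). X n \<omega> + D (n, k) \<omega>) ` Sigma {..<m} (\<lambda>n. {..<N n \<omega>})"
    have injF: "inj_on (\<lambda>(n, k). X n \<omega> + D (n, k) \<omega>) A" for A
      using elim(1) by (auto simp: inj_on_def)
    have "(\<Prod>x\<in>?F m. w x) = W m \<omega>" for m
      unfolding W_def by (subst prod.reindex[OF injF]) (simp add: prod.Sigma split_beta)
    moreover have "(\<lambda>m. \<Prod>x\<in>?F m. w x) \<longlonglongrightarrow> config_prod w (\<Phi> \<omega>)"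
    proof (rule config_prod_tendsto[OF w0 w1])
      show "mono ?F" by (intro monoI image_mono) auto
      show "(\<Union>m. ?F m) = \<Phi> \<omega>" unfolding elim(2) by force
    qed auto
    ultimately show ?case by simp
  qed
  have convV: "AE \<omega> in M. (\<lambda>m. V m \<omega>) \<longlonglongrightarrow> config_prod Q (range (\<lambda>n. X n \<omega>))"
    using inj
  proof eventually_elim
    case (elim \<omega>)
    let ?F = "\<lambda>m. (\<lambda>n. X n \<omega>) ` {..<m}"
    have "(\<Prod>x\<in>?F m. Q x) = V m \<omega>" for m
      unfolding V_def using elim by (subst prod.reindex) (auto intro: inj_on_subset)
    moreover have "(\<lambda>m. \<Prod>x\<in>?F m. Q x) \<longlonglongrightarrow> config_prod Q (range (\<lambda>n. X n \<omega>))"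
    proof (rule config_prod_tendsto[OF Q01])
      show "mono ?F" by (intro monoI image_mono) auto
    qed auto
    ultimately show ?case by simp
  qed
  obtain Y' where Y'[measurable]: "Y' \<in> borel_measurable M"
    and Y'1: "AE \<omega> in M. config_prod Q (range (\<lambda>n. X n \<omega>)) = Y' \<omega>"
    and Y'2: "(\<integral>\<omega>. Y' \<omega> \<partial>M) = exp (- (lp * (\<integral>x. 1 - Q x \<partial>lborel)))"
    using poisson_process_laplace[OF P less_imp_le[OF lp], unfolded has_laplace_exponent_def, rule_format, of Q]
      Qm Q01 Qint by blast
  define Y where "Y \<omega> = lim (\<lambda>m. W m \<omega>)" for \<omega>
  have Y[measurable]: "Y \<in> borel_measurable M" unfolding Y_def by measurable
  have AEY: "AE \<omega> in M. config_prod w (\<Phi> \<omega>) = Y \<omega>"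
    using convW by eventually_elim (simp add: Y_def limI)
  have "(\<integral>\<omega>. Y \<omega> \<partial>M) = (\<integral>\<omega>. Y' \<omega> \<partial>M)"
  proof (rule LIMSEQ_unique)
    have "AE \<omega> in M. (\<lambda>m. W m \<omega>) \<longlonglongrightarrow> Y \<omega>"
      using convW AEY by eventually_elim simp
    then show "(\<lambda>m. \<integral>\<omega>. W m \<omega> \<partial>M) \<longlonglongrightarrow> (\<integral>\<omega>. Y \<omega> \<partial>M)"
      by (intro integral_dominated_convergence[where w = "\<lambda>_. 1"]) (use W01 in auto)
    have "AE \<omega> in M. (\<lambda>m. V m \<omega>) \<longlonglongrightarrow> Y' \<omega>"
      using convV Y'1 by eventually_elim simp
    then show "(\<lambda>m. \<integral>\<omega>. W m \<omega> \<partial>M) \<longlonglongrightarrow> (\<integral>\<omega>. Y' \<omega> \<partial>M)"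
      unfolding WV by (intro integral_dominated_convergence[where w = "\<lambda>_. 1"]) (use V01 in auto)
  qed
  then show "\<exists>Y\<in>borel_measurable M. (AE \<omega> in M. config_prod w (\<Phi> \<omega>) = Y \<omega>) \<and>
      (\<integral>\<omega>. Y \<omega> \<partial>M) = exp (- (lp * (\<integral>p. 1 - exp (- c * smear f (\<lambda>x. 1 - w x) p) \<partial>lborel)))"
    using AEY Y Y'2 by (auto simp: Q_def)
qed

section \<open>Success probability given the interferers\<close>

context
  fixes \<mu> :: real
  assumes \<mu>: "0 < \<mu>"
begin

lemma sets_exponential_measure[simp]: "sets (exponential_measure \<mu>) = sets borel"
  by (simp add: exponential_measure_def)

lemma space_exponential_measure[simp]: "space (exponential_measure \<mu>) = UNIV"
  by (simp add: exponential_measure_def)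

lemma prob_space_exponential_measure: "prob_space (exponential_measure \<mu>)"
  unfolding exponential_measure_def by (rule prob_space_exponential_density[OF \<mu>])

lemma AE_exponential_measure_pos: "AE x in exponential_measure \<mu>. 0 < x"
proof -
  have "AE x in lborel. x \<noteq> (0::real)" by (rule AE_lborel_singleton)
  then show ?thesis
    unfolding exponential_measure_def
    by (subst AE_density) (auto simp: exponential_density_def elim!: eventually_mono)
qed

text \<open>The known tail formula concerns the open half-line and the endpoint is a null set. The
  closed half-line is what the non-strict success event produces.\<close>

lemma exponential_measure_tail:
  assumes "0 \<le> t"
  shows "emeasure (exponential_measure \<mu>) {t..} = ennreal (exp (- \<mu> * t))"
proof -
  interpret prob_space "exponential_measure \<mu>" by (rule prob_space_exponential_measure)
  have "distributed (exponential_measure \<mu>) lborel (\<lambda>x. x) (exponential_density \<mu>)"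
    unfolding distributed_def exponential_measure_def
    by (auto simp: distr_id2 exponential_density_nonneg[OF \<mu>])
  from exponential_distributedD_gt[OF this assms \<mu>]
  have "prob {t<..} = exp (- t * \<mu>)" by (simp add: greaterThan_def)
  moreover have "emeasure (exponential_measure \<mu>) {t..} = emeasure (exponential_measure \<mu>) {t<..}"
  proof (rule emeasure_eq_AE)
    have "AE x in lborel. x \<noteq> t" by (rule AE_lborel_singleton)
    then show "AE x in exponential_measure \<mu>. (x \<in> {t..}) = (x \<in> {t<..})"
      unfolding exponential_measure_def
      by (subst AE_density) (auto elim!: eventually_mono)
  qed auto
  ultimately show ?thesis by (simp add: emeasure_eq_measure mult.commute)
qed

text \<open>Exponential tilting: \<mu> e^(-\<mu> h) e^(-k h) is \<mu> / (\<mu> + k) times the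
  exponential density of rate \<mu> + k.\<close>

lemma exponential_measure_laplace:
  assumes k: "0 \<le> k"
  shows "(\<integral>\<^sup>+ h. ennreal (exp (- k * h)) \<partial>exponential_measure \<mu>) = ennreal (\<mu> / (\<mu> + k))"
proof -
  have pos: "0 < \<mu> + k" using \<mu> k by simp
  interpret E: prob_space "density lborel (exponential_density (\<mu> + k))"
    by (rule prob_space_exponential_density[OF pos])
  have "(\<integral>\<^sup>+ h. ennreal (exp (- k * h)) \<partial>exponential_measure \<mu>) =
      (\<integral>\<^sup>+ h. ennreal (\<mu> / (\<mu> + k)) * ennreal (exponential_density (\<mu> + k) h) \<partial>lborel)"
    unfolding exponential_measure_def
  proof (subst nn_integral_density, simp, simp, rule nn_integral_cong)
    fix h :: real
    have "exponential_density \<mu> h * exp (- k * h) = \<mu> / (\<mu> + k) * exponential_density (\<mu> + k) h"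
      using pos by (simp add: exponential_density_def mult_exp_exp) (simp add: algebra_simps)
    then show "ennreal (exponential_density \<mu> h) * ennreal (exp (- k * h)) =
        ennreal (\<mu> / (\<mu> + k)) * ennreal (exponential_density (\<mu> + k) h)"
      using exponential_density_nonneg[OF \<mu>] exponential_density_nonneg[OF pos] pos \<mu>
      by (simp only: ennreal_mult'[symmetric] exp_ge_zero divide_nonneg_pos less_imp_le)
  qed
  also have "\<dots> = ennreal (\<mu> / (\<mu> + k)) * emeasure (density lborel (exponential_density (\<mu> + k))) UNIV"
    by (subst nn_integral_cmult) (auto simp: emeasure_density)
  finally show ?thesis using E.emeasure_space_1 by simp
qed

text \<open>For fixed fading of the interferers and finite positive interference I, success means
  that h is at least T I / g z, an event of probability exp (- \<mu> T I / g z). This factorises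
  over the interferers, and the Laplace transform of each fading variable gives one factor, from
  which \<mu> cancels. The truncation at 0 mirrors the passage to \<open>ennreal\<close> in
  \<open>interference\<close>: the value of a path-loss function at the origin is arbitrary.\<close>

lemma conditional_success_eq:
  assumes T: "0 < T" and gz: "0 < g z" and \<eta>: "countable \<eta>"
  shows "conditional_success \<mu> g T z \<eta> =
    ennreal (config_prod (\<lambda>x. 1 / (1 + T * max 0 (g (x - z)) / g z)) \<eta>)"
proof -
  let ?E = "exponential_measure \<mu>"
  let ?\<Pi> = "PiM \<eta> (\<lambda>_. ?E)"
  interpret E: prob_space ?E by (rule prob_space_exponential_measure)
  interpret \<Pi>: prob_space ?\<Pi> by (intro prob_space_PiM E.prob_space_axioms)
  interpret P: pair_prob_space ?E ?\<Pi> ..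
  \<comment> \<open>Coefficient of the interference in the exponent of the tail.\<close>
  define \<kappa> where "\<kappa> = \<mu> * T / g z"
  have \<kappa>: "0 < \<kappa>" using \<mu> T gz by (simp add: \<kappa>_def)
  define g' where "g' x = max 0 (g (x - z))" for x
  define v where "v x = 1 / (1 + T * g' x / g z)" for x
  have v01: "0 \<le> v x" "v x \<le> 1" for x
  proof -
    have "0 \<le> T * g' x / g z" using T gz by (simp add: g'_def)
    then show "0 \<le> v x" "v x \<le> 1" by (auto simp: v_def)
  qed
  \<comment> \<open>Finite exhaustion of \<eta> along an enumeration: partial sums approximate the
    interference and finite products the configuration product.\<close>
  define F where "F m = {x \<in> \<eta>. to_nat_on \<eta> x < m}" for m
  have F: "finite (F m)" "mono F" "(\<Union>m. F m) = \<eta>" "F m \<subseteq> \<eta>" for m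
  proof -
    have "inj_on (to_nat_on \<eta>) (F m)"
      by (rule inj_on_subset[OF inj_on_to_nat_on[OF \<eta>]]) (auto simp: F_def)
    moreover have "to_nat_on \<eta> ` F m \<subseteq> {..<m}" by (auto simp: F_def)
    ultimately show "finite (F m)" by (metis finite_imageD finite_lessThan finite_subset)
    show "mono F" by (intro monoI) (auto simp: F_def)
  qed (auto simp: F_def)
  let ?I = "\<lambda>hx. interference g \<eta> hx z"
  have I_SUP: "?I hx = (SUP m. \<Sum>x\<in>F m. ennreal (hx x * g (x - z)))" for hx
  proof -
    have "?I hx = (\<integral>\<^sup>+ x. (SUP m. ennreal (hx x * g (x - z)) * indicator (F m) x) \<partial>count_space \<eta>)"
      unfolding interference_def
    proof (rule nn_integral_cong)
      fix x assume "x \<in> space (count_space \<eta>)"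
      then obtain m where "x \<in> F m" using F(3) by auto
      then show "ennreal (hx x * g (x - z)) = (SUP m. ennreal (hx x * g (x - z)) * indicator (F m) x)"
        by (intro antisym SUP_upper2[of m] SUP_least) (auto simp: indicator_def)
    qed
    also have "\<dots> = (SUP m. \<integral>\<^sup>+ x. ennreal (hx x * g (x - z)) * indicator (F m) x \<partial>count_space \<eta>)"
    proof (rule nn_integral_monotone_convergence_SUP)
      show "incseq (\<lambda>m x. ennreal (hx x * g (x - z)) * indicator (F m) x)"
        using F(2) by (auto simp: incseq_def le_fun_def mono_def indicator_def)
    qed simp
    also have "\<dots> = (SUP m. \<Sum>x\<in>F m. ennreal (hx x * g (x - z)))"
    proof (rule SUP_cong[OF refl])
      fix m
      have "(\<integral>\<^sup>+ x. ennreal (hx x * g (x - z)) * indicator (F m) x \<partial>count_space \<eta>) =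
          (\<Sum>x\<in>F m. ennreal (hx x * g (x - z)) * indicator (F m) x)"
        by (rule nn_integral_count_space') (use F(1,4) in auto)
      then show "(\<integral>\<^sup>+ x. ennreal (hx x * g (x - z)) * indicator (F m) x \<partial>count_space \<eta>) =
          (\<Sum>x\<in>F m. ennreal (hx x * g (x - z)))" by simp
    qed
    finally show ?thesis .
  qed
  have comp: "(\<lambda>hx. hx x) \<in> borel_measurable ?\<Pi>" if "x \<in> \<eta>" for x
    using measurable_component_singleton[OF that, of "\<lambda>_. ?E"] by (simp cong: measurable_cong_sets)
  have Im[measurable]: "?I \<in> borel_measurable ?\<Pi>"
    unfolding I_SUP[abs_def]
    by (intro borel_measurable_SUP borel_measurable_sum measurable_compose[OF _ measurable_ennreal]
        borel_measurable_times comp) (use F(4) in auto)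
  define A where "A = {(h, hx) \<in> space (?E \<Otimes>\<^sub>M ?\<Pi>). ennreal (h * g z) / ?I hx \<ge> ennreal T}"
  have A: "A \<in> sets (?E \<Otimes>\<^sub>M ?\<Pi>)"
  proof -
    have [measurable]: "fst \<in> borel_measurable (?E \<Otimes>\<^sub>M ?\<Pi>)"
      using measurable_fst[of ?E ?\<Pi>] by (subst (asm) measurable_cong_sets[OF refl sets_exponential_measure])
    have [measurable]: "(\<lambda>p. ?I (snd p)) \<in> borel_measurable (?E \<Otimes>\<^sub>M ?\<Pi>)"
      by (rule measurable_compose[OF measurable_snd Im])
    have "{p \<in> space (?E \<Otimes>\<^sub>M ?\<Pi>). ennreal (fst p * g z) / ?I (snd p) \<ge> ennreal T} \<in> sets (?E \<Otimes>\<^sub>M ?\<Pi>)"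
      by measurable
    then show ?thesis unfolding A_def by (simp add: split_beta')
  qed
  have slice: "(\<lambda>h. (h, hx)) -` A = {h. ennreal (h * g z) / ?I hx \<ge> ennreal T}" if "hx \<in> space ?\<Pi>" for hx
    using that by (auto simp: A_def space_pair_measure)
  define u where "u hx = emeasure ?E ((\<lambda>h. (h, hx)) -` A)" for hx
  have um: "u \<in> borel_measurable ?\<Pi>" unfolding u_def[abs_def] by (rule P.measurable_emeasure_Pair2[OF A])
  define r where "r m hx = (\<Sum>x\<in>F m. hx x * g' x)" for m hx
  have rm[measurable]: "r m \<in> borel_measurable ?\<Pi>" for m
    unfolding r_def by (intro borel_measurable_sum borel_measurable_times comp) (use F(4) in auto)
  \<comment> \<open>Countability of \<eta> gives one null set off which all fading variables are
    positive; there the partial sums \<open>r m\<close> increase to the interference.\<close>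
  have pos: "AE hx in ?\<Pi>. \<forall>x\<in>\<eta>. 0 < hx x"
    unfolding AE_ball_countable[OF \<eta>]
    by (intro ballI AE_PiM_component E.prob_space_axioms AE_exponential_measure_pos)
  have term0: "0 \<le> hx x * g' x" if "\<forall>x\<in>\<eta>. 0 < hx x" "x \<in> \<eta>" for hx x
    using that by (intro mult_nonneg_nonneg) (auto simp: g'_def less_imp_le)
  have conv: "AE hx in ?\<Pi>. (\<lambda>m. ennreal (exp (- \<kappa> * r m hx))) \<longlonglongrightarrow> u hx"
    using pos AE_space
  proof eventually_elim
    case (elim hx)
    have r0: "0 \<le> r m hx" for m
      unfolding r_def using elim F(4) by (intro sum_nonneg term0) auto
    have "(\<Sum>x\<in>F m. ennreal (hx x * g (x - z))) = ennreal (r m hx)" for m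
    proof -
      have "ennreal (hx x * g (x - z)) = ennreal (hx x * g' x)" "0 \<le> hx x * g' x" if "x \<in> F m" for x
        using elim F(4) that
        by (auto simp: g'_def max_def ennreal_neg mult_nonneg_nonpos less_imp_le subset_iff)
      then show ?thesis unfolding r_def by (simp add: sum_ennreal)
    qed
    then have I: "?I hx = (SUP m. ennreal (r m hx))" by (simp add: I_SUP)
    have "incseq (\<lambda>m. ennreal (r m hx))"
    proof (rule incseq_SucI)
      fix m
      have "r m hx \<le> r (Suc m) hx"
        unfolding r_def using elim F(4)
        by (intro sum_mono2 F(1) F(2)[THEN monoD] term0) auto
      then show "ennreal (r m hx) \<le> ennreal (r (Suc m) hx)" by (rule ennreal_leI)
    qed
    then have lim: "(\<lambda>m. ennreal (r m hx)) \<longlonglongrightarrow> ?I hx" unfolding I by (rule LIMSEQ_SUP)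
    show ?case
    proof (cases "?I hx")
      \<comment> \<open>Infinite interference makes the quotient 0, so success has probability 0, in
        accordance with exp (- \<kappa> r) tending to 0.\<close>
      case top
      then have "filterlim (\<lambda>m. r m hx) at_top sequentially"
        using lim by (simp add: ennreal_tendsto_top_eq_at_top)
      then have "filterlim (\<lambda>m. - \<kappa> * r m hx) at_bot sequentially"
        using \<kappa> by (intro filterlim_tendsto_neg_mult_at_bot[OF tendsto_const]) auto
      then have "(\<lambda>m. exp (- \<kappa> * r m hx)) \<longlonglongrightarrow> 0" by (rule filterlim_compose[OF exp_at_bot])
      then have "(\<lambda>m. ennreal (exp (- \<kappa> * r m hx))) \<longlonglongrightarrow> ennreal 0" by (rule tendsto_ennrealI)
      moreover have "u hx = 0" unfolding u_def slice[OF elim(2)] top using T by simp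
      ultimately show ?thesis by simp
    next
      case (real i)
      have "(\<lambda>m. r m hx) \<longlonglongrightarrow> i"
        using lim real r0 by (simp add: tendsto_ennreal_iff)
      then have "(\<lambda>m. ennreal (exp (- \<kappa> * r m hx))) \<longlonglongrightarrow> ennreal (exp (- \<kappa> * i))"
        by (intro tendsto_ennrealI tendsto_intros)
      moreover have "u hx = ennreal (exp (- \<kappa> * i))"
      proof (cases "i = 0")
        \<comment> \<open>Without interference the quotient is infinite for h > 0, while 0 / 0 = 0
          for h \<le> 0; success then has probability 1.\<close>
        case True
        have *: "ennreal T \<le> ennreal (h * g z) / 0 \<longleftrightarrow> 0 < h" for h
        proof (cases "0 < h")
          case True
          then have "ennreal (h * g z) / 0 = top" using gz by (simp add: ennreal_divide_zero)
          then show ?thesis using True by simp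
        next
          case False
          then have "ennreal (h * g z) = 0" using gz by (simp add: ennreal_neg mult_nonpos_nonneg)
          then show ?thesis using False T by simp
        qed
        have "u hx = emeasure ?E {h. 0 < h}"
          unfolding u_def slice[OF elim(2)] real(2) True using * by simp
        also have "\<dots> = emeasure ?E (space ?E)"
          by (rule emeasure_eq_AE) (use AE_exponential_measure_pos in auto)
        finally show ?thesis using True E.emeasure_space_1 by simp
      next
        case False
        then have i: "0 < i" using real by simp
        have "ennreal T \<le> ennreal (h * g z) / ennreal i \<longleftrightarrow> T * i / g z \<le> h" for h
        proof (cases "0 \<le> h")
          case True
          then have "ennreal (h * g z) / ennreal i = ennreal (h * g z / i)"
            using i gz by (simp add: divide_ennreal)
          then show ?thesis using i gz T True by (simp add: ennreal_le_iff field_simps)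
        next
          case False
          then have "ennreal (h * g z) = 0" using gz by (simp add: ennreal_neg mult_nonpos_nonneg)
          moreover have "0 < T * i / g z" using T i gz by simp
          ultimately show ?thesis using False T by simp
        qed
        then have "u hx = emeasure ?E {T * i / g z..}"
          unfolding u_def slice[OF elim(2)] real(2) by (simp add: atLeast_def)
        also have "\<dots> = ennreal (exp (- \<mu> * (T * i / g z)))"
          using T i gz by (intro exponential_measure_tail) simp
        finally show ?thesis by (simp add: \<kappa>_def mult_ac)
      qed
      ultimately show ?thesis by simp
    qed
  qed
  have int_r: "(\<integral>\<^sup>+ hx. ennreal (exp (- \<kappa> * r m hx)) \<partial>?\<Pi>) = ennreal (\<Prod>x\<in>F m. v x)" for m
  proof -
    have "(\<integral>\<^sup>+ hx. ennreal (exp (- \<kappa> * r m hx)) \<partial>?\<Pi>) =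
        (\<integral>\<^sup>+ hx. (\<Prod>x\<in>F m. ennreal (exp (- (\<kappa> * g' x) * hx x))) \<partial>?\<Pi>)"
      using F(1) by (simp add: r_def sum_distrib_left exp_sum prod_ennreal mult_ac flip: sum_negf)
    also have "\<dots> = (\<Prod>x\<in>F m. \<integral>\<^sup>+ h. ennreal (exp (- (\<kappa> * g' x) * h)) \<partial>?E)"
      by (rule nn_integral_PiM_prod[OF E.prob_space_axioms F(1,4)])
        (simp cong: measurable_cong_sets[OF sets_exponential_measure refl])
    also have "\<dots> = (\<Prod>x\<in>F m. ennreal (v x))"
    proof (rule prod.cong[OF refl])
      fix x
      have "0 \<le> \<kappa> * g' x" using \<kappa> by (simp add: g'_def)
      then have "(\<integral>\<^sup>+ h. ennreal (exp (- (\<kappa> * g' x) * h)) \<partial>?E) = ennreal (\<mu> / (\<mu> + \<kappa> * g' x))"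
        by (rule exponential_measure_laplace)
      moreover have "\<mu> / (\<mu> + \<kappa> * g' x) = v x"
      proof -
        have "\<mu> + \<kappa> * g' x = \<mu> * (1 + T * g' x / g z)" by (simp add: \<kappa>_def algebra_simps)
        then show ?thesis using \<mu> by (simp add: v_def)
      qed
      ultimately show "(\<integral>\<^sup>+ h. ennreal (exp (- (\<kappa> * g' x) * h)) \<partial>?E) = ennreal (v x)" by simp
    qed
    finally show ?thesis by (simp add: prod_ennreal v01)
  qed
  have "conditional_success \<mu> g T z \<eta> = emeasure (?E \<Otimes>\<^sub>M ?\<Pi>) A"
    unfolding conditional_success_def A_def Let_def ..
  also have "\<dots> = (\<integral>\<^sup>+ hx. u hx \<partial>?\<Pi>)"
    unfolding u_def by (rule P.emeasure_pair_measure_alt2[OF A])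
  also have "\<dots> = ennreal (config_prod v \<eta>)"
  proof (rule LIMSEQ_unique)
    show "(\<lambda>m. \<integral>\<^sup>+ hx. ennreal (exp (- \<kappa> * r m hx)) \<partial>?\<Pi>) \<longlonglongrightarrow> (\<integral>\<^sup>+ hx. u hx \<partial>?\<Pi>)"
    proof (rule nn_integral_dominated_convergence[where w = "\<lambda>_. 1"])
      show "AE hx in ?\<Pi>. ennreal (exp (- \<kappa> * r m hx)) \<le> 1" for m
        using pos
      proof eventually_elim
        case (elim hx)
        have "0 \<le> r m hx"
          unfolding r_def using elim F(4) by (intro sum_nonneg term0) auto
        then show ?case using \<kappa> by (simp add: ennreal_le_1)
      qed
      show "(\<integral>\<^sup>+ hx. 1 \<partial>?\<Pi>) < \<infinity>" by (simp add: \<Pi>.emeasure_space_1)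
    qed (use um conv in auto)
    show "(\<lambda>m. \<integral>\<^sup>+ hx. ennreal (exp (- \<kappa> * r m hx)) \<partial>?\<Pi>) \<longlonglongrightarrow> ennreal (config_prod v \<eta>)"
      unfolding int_r by (intro tendsto_ennrealI config_prod_tendsto v01 F)
  qed
  finally show ?thesis by (simp add: v_def[abs_def] g'_def[abs_def])
qed

end

section \<open>Palm sums and Laplace functionals\<close>

definition admissible :: "(plane \<Rightarrow> real) \<Rightarrow> bool" where
  "admissible w \<longleftrightarrow> w \<in> borel_measurable borel \<and> (\<forall>x. 0 \<le> w x \<and> w x \<le> 1) \<and> integrable lborel (\<lambda>x. 1 - w x)"

lemma admissibleD:
  assumes "admissible w"
  shows "w \<in> borel_measurable borel" "0 \<le> w x" "w x \<le> 1" "integrable lborel (\<lambda>x. 1 - w x)"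
  using assms by (auto simp: admissible_def)

lemma has_laplace_exponentE:
  assumes "has_laplace_exponent M \<Phi> \<Lambda>" "admissible w"
  obtains Y where "Y \<in> borel_measurable M" "AE \<omega> in M. config_prod w (\<Phi> \<omega>) = Y \<omega>"
    "(\<integral>\<omega>. Y \<omega> \<partial>M) = exp (- \<Lambda> w)"
proof -
  have "\<exists>Y\<in>borel_measurable M. (AE \<omega> in M. config_prod w (\<Phi> \<omega>) = Y \<omega>) \<and> (\<integral>\<omega>. Y \<omega> \<partial>M) = exp (- \<Lambda> w)"
    using assms(1)[unfolded has_laplace_exponent_def, rule_format, of w] assms(2)[unfolded admissible_def] by blast
  then show ?thesis using that by blast
qed

text \<open>The measurable versions inherit the bound 1 almost everywhere, which makes them
  integrable, so that the real integral can be split.\<close>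

lemma laplace_diff:
  assumes "prob_space M" and L: "has_laplace_exponent M \<Phi> \<Lambda>" and a: "admissible a" and b: "admissible b"
    and ba: "\<And>x. b x \<le> a x" and s: "0 < s"
  shows "(\<integral>\<^sup>+ \<omega>. ennreal ((config_prod a (\<Phi> \<omega>) - config_prod b (\<Phi> \<omega>)) / s) \<partial>M) =
    ennreal ((exp (- \<Lambda> a) - exp (- \<Lambda> b)) / s)"
proof -
  interpret prob_space M by fact
  obtain Ya where Ya[measurable]: "Ya \<in> borel_measurable M" and Ya1: "AE \<omega> in M. config_prod a (\<Phi> \<omega>) = Ya \<omega>"
    and Ya2: "(\<integral>\<omega>. Ya \<omega> \<partial>M) = exp (- \<Lambda> a)" by (rule has_laplace_exponentE[OF L a])
  obtain Yb where Yb[measurable]: "Yb \<in> borel_measurable M" and Yb1: "AE \<omega> in M. config_prod b (\<Phi> \<omega>) = Yb \<omega>"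
    and Yb2: "(\<integral>\<omega>. Yb \<omega> \<partial>M) = exp (- \<Lambda> b)" by (rule has_laplace_exponentE[OF L b])
  have bound: "\<bar>config_prod w (\<Phi> \<omega>)\<bar> \<le> 1" if "admissible w" for w \<omega>
    using config_prod_nonneg[of w "\<Phi> \<omega>"] config_prod_le_1[of w "\<Phi> \<omega>"] admissibleD(2)[OF that] by auto
  have inta: "integrable M Ya"
  proof (rule integrable_const_bound[where B = 1])
    show "AE \<omega> in M. norm (Ya \<omega>) \<le> 1" using Ya1 by eventually_elim (metis bound[OF a] real_norm_def)
  qed simp
  have intb: "integrable M Yb"
  proof (rule integrable_const_bound[where B = 1])
    show "AE \<omega> in M. norm (Yb \<omega>) \<le> 1" using Yb1 by eventually_elim (metis bound[OF b] real_norm_def)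
  qed simp
  have le: "config_prod b (\<Phi> \<omega>) \<le> config_prod a (\<Phi> \<omega>)" for \<omega>
    by (intro config_prod_mono ba admissibleD(2)[OF b])
  have "(\<integral>\<^sup>+ \<omega>. ennreal ((config_prod a (\<Phi> \<omega>) - config_prod b (\<Phi> \<omega>)) / s) \<partial>M) =
      (\<integral>\<^sup>+ \<omega>. ennreal ((Ya \<omega> - Yb \<omega>) / s) \<partial>M)"
    by (rule nn_integral_cong_AE) (use Ya1 Yb1 in eventually_elim, simp)
  also have "\<dots> = ennreal (\<integral>\<omega>. (Ya \<omega> - Yb \<omega>) / s \<partial>M)"
  proof (rule nn_integral_eq_integral)
    show "integrable M (\<lambda>\<omega>. (Ya \<omega> - Yb \<omega>) / s)" using inta intb by simp
    show "AE \<omega> in M. 0 \<le> (Ya \<omega> - Yb \<omega>) / s"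
      using Ya1 Yb1 by eventually_elim (use le s in \<open>auto intro!: divide_nonneg_pos\<close>, metis)
  qed
  also have "(\<integral>\<omega>. (Ya \<omega> - Yb \<omega>) / s \<partial>M) = (exp (- \<Lambda> a) - exp (- \<Lambda> b)) / s"
    using inta intb by (simp add: Ya2 Yb2)
  finally show ?thesis .
qed

text \<open>Moving the shift from the configuration to the weight lets all points x of a Palm sum
  refer to the same configuration; deleting the origin after the shift deletes x before it.\<close>

lemma config_prod_recenter:
  fixes v :: "plane \<Rightarrow> real"
  assumes "\<And>y. 0 \<le> v y"
  shows "config_prod v ((\<lambda>y. y - x) ` \<eta> - {0}) = config_prod (\<lambda>y. v (y - x)) (\<eta> - {x})"
proof -
  have "(\<lambda>y. y - x) ` \<eta> - {0} = (\<lambda>y. y - x) ` (\<eta> - {x})" by auto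
  then show ?thesis using config_prod_image[of "\<lambda>y. y - x" "\<eta> - {x}" v] assms by (simp add: inj_on_def)
qed

text \<open>On a cell the moving weight \<open>v (y - x)\<close> is bounded below by the fixed
  weight \<open>a i\<close>. When \<open>a i\<close> is lowered by s on the cell, telescoping bounds
  the drop of the product by s times the contribution of the cell. Disjoint cells inside U count no
  point twice.\<close>

lemma palm_sum_lower:
  fixes v :: "plane \<Rightarrow> real"
  assumes fin: "finite (\<eta> \<inter> U)" and I: "finite I" "disjoint_family_on C I" "\<And>i. i \<in> I \<Longrightarrow> C i \<subseteq> U"
    and s: "0 < s" and a: "\<And>i y. s * indicator (C i) y \<le> a i y" "\<And>i y. a i y \<le> 1"
    and av: "\<And>i x y. i \<in> I \<Longrightarrow> x \<in> C i \<Longrightarrow> a i y \<le> v (y - x)" and v: "\<And>y. 0 \<le> v y"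
  shows "(\<Sum>i\<in>I. ennreal ((config_prod (a i) \<eta> - config_prod (\<lambda>y. a i y - s * indicator (C i) y) \<eta>) / s))
    \<le> (\<integral>\<^sup>+ x. ennreal (config_prod v ((\<lambda>y. y - x) ` \<eta> - {0})) \<partial>count_space (\<eta> \<inter> U))"
proof -
  let ?F = "\<lambda>x. config_prod (\<lambda>y. v (y - x)) (\<eta> - {x})"
  have F0: "0 \<le> ?F x" for x by (intro config_prod_nonneg v)
  have a0: "0 \<le> a i y" for i y
  proof -
    have "0 \<le> s * indicator (C i) y" using s by (simp add: indicator_def)
    then show ?thesis using a(1)[of i y] by linarith
  qed
  have "(\<Sum>i\<in>I. ennreal ((config_prod (a i) \<eta> - config_prod (\<lambda>y. a i y - s * indicator (C i) y) \<eta>) / s))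
      \<le> (\<Sum>i\<in>I. \<Sum>x\<in>\<eta> \<inter> C i. ennreal (?F x))"
  proof (rule sum_mono)
    fix i assume i: "i \<in> I"
    have "finite (\<eta> \<inter> C i)" by (rule finite_subset[OF _ fin]) (use I(3)[OF i] in auto)
    from config_prod_diff_bounds(2)[of "\<lambda>y. a i y - s * indicator (C i) y" "a i" "C i" \<eta>] this a s
    have "config_prod (a i) \<eta> - config_prod (\<lambda>y. a i y - s * indicator (C i) y) \<eta> \<le>
        (\<Sum>x\<in>\<eta> \<inter> C i. (a i x - (a i x - s * indicator (C i) x)) * config_prod (a i) (\<eta> - {x}))"
      by (auto simp: indicator_def)
    also have "\<dots> = s * (\<Sum>x\<in>\<eta> \<inter> C i. config_prod (a i) (\<eta> - {x}))"
      by (simp add: sum_distrib_left)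
    also have "\<dots> \<le> s * (\<Sum>x\<in>\<eta> \<inter> C i. ?F x)"
      using s av[OF i] a0 by (intro mult_left_mono sum_mono config_prod_mono) auto
    finally have "(config_prod (a i) \<eta> - config_prod (\<lambda>y. a i y - s * indicator (C i) y) \<eta>) / s \<le> (\<Sum>x\<in>\<eta> \<inter> C i. ?F x)"
      using s by (simp add: field_simps)
    then show "ennreal ((config_prod (a i) \<eta> - config_prod (\<lambda>y. a i y - s * indicator (C i) y) \<eta>) / s)
        \<le> (\<Sum>x\<in>\<eta> \<inter> C i. ennreal (?F x))"
      using F0 by (simp add: sum_ennreal ennreal_leI)
  qed
  also have "\<dots> = (\<Sum>x\<in>(\<Union>i\<in>I. \<eta> \<inter> C i). ennreal (?F x))"
  proof (rule sum.UNION_disjoint[symmetric])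
    show "\<forall>i\<in>I. finite (\<eta> \<inter> C i)"
    proof
      fix i assume "i \<in> I"
      then have "\<eta> \<inter> C i \<subseteq> \<eta> \<inter> U" using I(3) by blast
      then show "finite (\<eta> \<inter> C i)" using fin by (rule finite_subset)
    qed
  qed (use I in \<open>auto simp: disjoint_family_on_def\<close>)
  also have "\<dots> \<le> (\<Sum>x\<in>\<eta> \<inter> U. ennreal (?F x))"
    using I(3) fin by (intro sum_mono2) auto
  also have "\<dots> = (\<integral>\<^sup>+ x. ennreal (config_prod v ((\<lambda>y. y - x) ` \<eta> - {0})) \<partial>count_space (\<eta> \<inter> U))"
    by (simp add: nn_integral_count_space_finite[OF fin] config_prod_recenter v)
  finally show ?thesis .
qed

lemma sum_UNION_le_ennreal:
  fixes h :: "'a \<Rightarrow> ennreal"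
  assumes "finite I" "\<And>i. i \<in> I \<Longrightarrow> finite (A i)"
  shows "(\<Sum>x\<in>(\<Union>i\<in>I. A i). h x) \<le> (\<Sum>i\<in>I. \<Sum>x\<in>A i. h x)"
  using assms
proof (induction I)
  case (insert i I)
  have "(\<Sum>x\<in>(\<Union>j\<in>insert i I. A j). h x) \<le>
      (\<Sum>x\<in>A i \<union> (\<Union>j\<in>I. A j). h x) + (\<Sum>x\<in>A i \<inter> (\<Union>j\<in>I. A j). h x)"
    by simp
  also have "\<dots> = (\<Sum>x\<in>A i. h x) + (\<Sum>x\<in>(\<Union>j\<in>I. A j). h x)"
    using insert by (intro sum.union_inter) auto
  also have "\<dots> \<le> (\<Sum>x\<in>A i. h x) + (\<Sum>j\<in>I. \<Sum>x\<in>A j. h x)"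
    using insert by (intro add_left_mono) auto
  finally show ?case using insert by simp
qed simp

text \<open>Dual to the lower bound: \<open>b i\<close> dominates the moving weight and is raised by
  s on the cell. The cells cover U; overlaps and parts outside U only enlarge the right-hand
  side.\<close>

lemma palm_sum_upper:
  fixes v :: "plane \<Rightarrow> real"
  assumes I: "finite I" "\<And>i. i \<in> I \<Longrightarrow> finite (\<eta> \<inter> C i)" "U \<subseteq> (\<Union>i\<in>I. C i)"
    and s: "0 < s" and b: "\<And>i y. 0 \<le> b i y" "\<And>i y. b i y + s * indicator (C i) y \<le> 1"
    and bv: "\<And>i x y. i \<in> I \<Longrightarrow> x \<in> C i \<Longrightarrow> v (y - x) \<le> b i y" and v: "\<And>y. 0 \<le> v y"
  shows "(\<integral>\<^sup>+ x. ennreal (config_prod v ((\<lambda>y. y - x) ` \<eta> - {0})) \<partial>count_space (\<eta> \<inter> U)) \<le>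
    (\<Sum>i\<in>I. ennreal ((config_prod (\<lambda>y. b i y + s * indicator (C i) y) \<eta> - config_prod (b i) \<eta>) / s))"
proof -
  let ?F = "\<lambda>x. config_prod (\<lambda>y. v (y - x)) (\<eta> - {x})"
  have F0: "0 \<le> ?F x" for x by (intro config_prod_nonneg v)
  have sub: "\<eta> \<inter> U \<subseteq> (\<Union>i\<in>I. \<eta> \<inter> C i)" using I(3) by auto
  have finU: "finite (\<Union>i\<in>I. \<eta> \<inter> C i)" using I(1,2) by (rule finite_UN_I)
  have fin: "finite (\<eta> \<inter> U)" using sub finU by (rule finite_subset)
  have "(\<integral>\<^sup>+ x. ennreal (config_prod v ((\<lambda>y. y - x) ` \<eta> - {0})) \<partial>count_space (\<eta> \<inter> U)) =
      (\<Sum>x\<in>\<eta> \<inter> U. ennreal (?F x))"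
    by (simp add: nn_integral_count_space_finite[OF fin] config_prod_recenter v)
  also have "\<dots> \<le> (\<Sum>x\<in>(\<Union>i\<in>I. \<eta> \<inter> C i). ennreal (?F x))"
    using sub finU by (intro sum_mono2) auto
  also have "\<dots> \<le> (\<Sum>i\<in>I. \<Sum>x\<in>\<eta> \<inter> C i. ennreal (?F x))"
    by (rule sum_UNION_le_ennreal) (use I in auto)
  also have "\<dots> \<le> (\<Sum>i\<in>I. ennreal ((config_prod (\<lambda>y. b i y + s * indicator (C i) y) \<eta> - config_prod (b i) \<eta>) / s))"
  proof (rule sum_mono)
    fix i assume i: "i \<in> I"
    have "(\<Sum>x\<in>\<eta> \<inter> C i. (b i x + s * indicator (C i) x - b i x) * config_prod (b i) (\<eta> - {x})) \<le>
        config_prod (\<lambda>y. b i y + s * indicator (C i) y) \<eta> - config_prod (b i) \<eta>"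
      by (rule config_prod_diff_bounds(1)[of "b i" "\<lambda>y. b i y + s * indicator (C i) y" "C i" \<eta>])
        (use I(2)[OF i] b s in \<open>auto simp: indicator_def\<close>)
    moreover have "(\<Sum>x\<in>\<eta> \<inter> C i. (b i x + s * indicator (C i) x - b i x) * config_prod (b i) (\<eta> - {x})) =
        s * (\<Sum>x\<in>\<eta> \<inter> C i. config_prod (b i) (\<eta> - {x}))"
      by (simp add: sum_distrib_left)
    moreover have "s * (\<Sum>x\<in>\<eta> \<inter> C i. ?F x) \<le> s * (\<Sum>x\<in>\<eta> \<inter> C i. config_prod (b i) (\<eta> - {x}))"
      using bv[OF i] v s by (intro mult_left_mono sum_mono config_prod_mono) auto
    ultimately have "s * (\<Sum>x\<in>\<eta> \<inter> C i. ?F x) \<le>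
        config_prod (\<lambda>y. b i y + s * indicator (C i) y) \<eta> - config_prod (b i) \<eta>"
      by linarith
    then have "(\<Sum>x\<in>\<eta> \<inter> C i. ?F x) \<le>
        (config_prod (\<lambda>y. b i y + s * indicator (C i) y) \<eta> - config_prod (b i) \<eta>) / s"
      using s by (simp add: field_simps)
    then show "(\<Sum>x\<in>\<eta> \<inter> C i. ennreal (?F x)) \<le>
        ennreal ((config_prod (\<lambda>y. b i y + s * indicator (C i) y) \<eta> - config_prod (b i) \<eta>) / s)"
      using F0 by (simp add: sum_ennreal ennreal_leI)
  qed
  finally show ?thesis .
qed

text \<open>The difference quotient of the k-th power at 1 tends to k. With step 1 / (n + 1) it
  recovers a count from products whose factors are slightly below 1.\<close>

lemma card_le_liminf_power:
  fixes k :: nat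
  assumes "\<And>n. ennreal ((1 - (1 - 1 / real (Suc n)) ^ k) / (1 / real (Suc n))) \<le> c n"
  shows "of_nat k \<le> liminf c"
proof -
  have "(\<lambda>n. \<Sum>i<k. (1 - 1 / real (Suc n)) ^ i) \<longlonglongrightarrow> (\<Sum>i<k. (1 - 0) ^ i)"
    using LIMSEQ_inverse_real_of_nat by (intro tendsto_intros) (simp add: inverse_eq_divide)
  moreover have "(1 - (1 - 1 / real (Suc n)) ^ k) / (1 / real (Suc n)) = (\<Sum>i<k. (1 - 1 / real (Suc n)) ^ i)" for n
    by (subst one_diff_power_eq) simp
  ultimately have "(\<lambda>n. ennreal ((1 - (1 - 1 / real (Suc n)) ^ k) / (1 / real (Suc n)))) \<longlonglongrightarrow> ennreal (real k)"
    by (intro tendsto_ennrealI) simp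
  then have "of_nat k = liminf (\<lambda>n. ennreal ((1 - (1 - 1 / real (Suc n)) ^ k) / (1 / real (Suc n))))"
    by (simp add: lim_imp_Liminf ennreal_of_nat_eq_real_of_nat)
  also have "\<dots> \<le> liminf c" using assms by (intro Liminf_mono) auto
  finally show ?thesis .
qed

lemma config_prod_thinned_le:
  assumes "finite X" "X \<subseteq> \<eta> \<inter> U" "0 \<le> s" "s \<le> 1"
  shows "config_prod (\<lambda>x. 1 - s * indicator U x) \<eta> \<le> (1 - s) ^ card X"
proof -
  have "config_prod (\<lambda>x. 1 - s * indicator U x) \<eta> \<le> (\<Prod>x\<in>X. 1 - s * indicator U x)"
    using assms by (intro config_prod_le) (auto simp: indicator_def)
  also have "\<dots> = (\<Prod>x\<in>X. 1 - s)" using assms by (intro prod.cong) auto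
  finally show ?thesis by simp
qed

lemma admissible_thinned:
  assumes [measurable]: "U \<in> sets borel" and U: "emeasure lborel U < \<infinity>" and s: "0 \<le> s" "s \<le> 1"
  shows "admissible (\<lambda>x. 1 - s * indicator U x)"
proof -
  have "integrable lborel (\<lambda>x. s * indicator U x)"
    using U by (intro integrable_mult_right integrable_real_indicator) auto
  then show ?thesis using s by (auto simp: admissible_def indicator_def)
qed

text \<open>The mean count is minus the derivative at s = 0 of the Laplace functional at the weight
  1 - s on U. Fatou's lemma carries a bound on the difference quotients over to the mean. Finiteness
  on U comes out as well; the definition of a cluster process does not state it.\<close>

lemma expected_count_le:
  assumes "prob_space M" and L: "has_laplace_exponent M \<Phi> \<Lambda>"
    and U: "U \<in> sets borel" "emeasure lborel U < \<infinity>"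
    and B: "\<And>s. 0 < s \<Longrightarrow> s \<le> 1 \<Longrightarrow> 0 \<le> \<Lambda> (\<lambda>x. 1 - s * indicator U x) \<and> \<Lambda> (\<lambda>x. 1 - s * indicator U x) \<le> s * B"
  shows "(\<integral>\<^sup>+ \<omega>. emeasure (count_space UNIV) (\<Phi> \<omega> \<inter> U) \<partial>M) \<le> ennreal B"
    and "AE \<omega> in M. finite (\<Phi> \<omega> \<inter> U)"
proof -
  interpret prob_space M by fact
  let ?s = "\<lambda>n. 1 / real (Suc n)"
  let ?w = "\<lambda>n x. 1 - ?s n * indicator U x"
  have s: "0 < ?s n" "?s n \<le> 1" for n by auto
  have w: "admissible (?w n)" for n using U s by (intro admissible_thinned) (auto intro: less_imp_le)
  have ex: "\<exists>Y. Y \<in> borel_measurable M \<and> (AE \<omega> in M. config_prod (?w n) (\<Phi> \<omega>) = Y \<omega>) \<and> (\<integral>\<omega>. Y \<omega> \<partial>M) = exp (- \<Lambda> (?w n))" for n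
    by (rule has_laplace_exponentE[OF L w[of n]]) blast
  \<comment> \<open>One measurable version for each n is fixed, so that the countably many null sets
    can be joined.\<close>
  define Y where "Y n = (SOME Y. Y \<in> borel_measurable M \<and> (AE \<omega> in M. config_prod (?w n) (\<Phi> \<omega>) = Y \<omega>) \<and>
      (\<integral>\<omega>. Y \<omega> \<partial>M) = exp (- \<Lambda> (?w n)))" for n
  have Y[measurable]: "Y n \<in> borel_measurable M"
    and Y1: "AE \<omega> in M. config_prod (?w n) (\<Phi> \<omega>) = Y n \<omega>"
    and Y2: "(\<integral>\<omega>. Y n \<omega> \<partial>M) = exp (- \<Lambda> (?w n))" for n
    using someI_ex[OF ex[of n], folded Y_def] by blast+
  define c where "c n \<omega> = ennreal ((1 - Y n \<omega>) / ?s n)" for n \<omega>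
  have [measurable]: "c n \<in> borel_measurable M" for n unfolding c_def by measurable
  have AEY: "AE \<omega> in M. \<forall>n. config_prod (?w n) (\<Phi> \<omega>) = Y n \<omega>"
    unfolding AE_all_countable using Y1 by blast
  have AEc: "AE \<omega> in M. emeasure (count_space UNIV) (\<Phi> \<omega> \<inter> U) \<le> liminf (\<lambda>n. c n \<omega>)"
    using AEY
  proof eventually_elim
    case (elim \<omega>)
    have fin: "of_nat (card X) \<le> liminf (\<lambda>n. c n \<omega>)" if "finite X" "X \<subseteq> \<Phi> \<omega> \<inter> U" for X
    proof (rule card_le_liminf_power)
      fix n
      have "Y n \<omega> \<le> (1 - ?s n) ^ card X"
        using config_prod_thinned_le[OF that, of "?s n"] s[of n] elim by simp
      then show "ennreal ((1 - (1 - ?s n) ^ card X) / ?s n) \<le> c n \<omega>"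
        unfolding c_def using s[of n] by (intro ennreal_leI divide_right_mono) auto
    qed
    show ?case
    proof (cases "finite (\<Phi> \<omega> \<inter> U)")
      case True
      then show ?thesis using fin[OF True] by (simp add: emeasure_count_space)
    next
      \<comment> \<open>An infinite set has finite subsets of every size, so the lower limit is at
        least every natural number.\<close>
      case False
      have "of_nat k \<le> liminf (\<lambda>n. c n \<omega>)" for k
        using infinite_arbitrarily_large[OF False, of k] fin by metis
      then have "(SUP k. of_nat k) \<le> liminf (\<lambda>n. c n \<omega>)" by (rule SUP_least)
      then have "liminf (\<lambda>n. c n \<omega>) = top" by (simp add: ennreal_SUP_of_nat_eq_top top_unique)
      then show ?thesis by simp
    qed
  qed
  have cint: "(\<integral>\<^sup>+ \<omega>. c n \<omega> \<partial>M) \<le> ennreal B" for n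
  proof -
    have "(\<integral>\<^sup>+ \<omega>. c n \<omega> \<partial>M) = (\<integral>\<^sup>+ \<omega>. ennreal ((1 - Y n \<omega>) / ?s n) \<partial>M)" by (simp add: c_def)
    also have "\<dots> = ennreal (\<integral>\<omega>. (1 - Y n \<omega>) / ?s n \<partial>M)"
    proof (rule nn_integral_eq_integral)
      have b01: "AE \<omega> in M. 0 \<le> Y n \<omega> \<and> Y n \<omega> \<le> 1"
        using Y1[of n]
      proof eventually_elim
        case (elim \<omega>)
        show ?case
          using config_prod_nonneg[of "?w n" "\<Phi> \<omega>"] config_prod_le_1[of "?w n" "\<Phi> \<omega>"] admissibleD(2)[OF w[of n]]
          unfolding elim by auto
      qed
      then have "integrable M (Y n)" by (intro integrable_const_bound[where B = 1]) auto
      then show "integrable M (\<lambda>\<omega>. (1 - Y n \<omega>) / ?s n)" by simp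
      show "AE \<omega> in M. 0 \<le> (1 - Y n \<omega>) / ?s n"
        using b01 by eventually_elim auto
    qed
    also have "\<dots> = ennreal ((1 - exp (- \<Lambda> (?w n))) / ?s n)"
    proof -
      \<comment> \<open>The integral equals an exponential and is nonzero, whereas the integral of a
        non-integrable function is 0 by convention.\<close>
      have "integrable M (Y n)"
        using Y2[of n] not_integrable_integral_eq[of M "Y n"] by fastforce
      then show ?thesis by (simp add: Y2 prob_space)
    qed
    also have "\<dots> \<le> ennreal B"
    proof (rule ennreal_leI)
      have "1 - exp (- \<Lambda> (?w n)) \<le> ?s n * B"
        using B[OF s[of n]] exp_diff_bounds(2)[of "\<Lambda> (?w n)"] by linarith
      then show "(1 - exp (- \<Lambda> (?w n))) / ?s n \<le> B" by (simp add: field_simps)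
    qed
    finally show ?thesis .
  qed
  have lim: "(\<integral>\<^sup>+ \<omega>. liminf (\<lambda>n. c n \<omega>) \<partial>M) \<le> ennreal B"
  proof -
    have "(\<integral>\<^sup>+ \<omega>. liminf (\<lambda>n. c n \<omega>) \<partial>M) \<le> liminf (\<lambda>n. \<integral>\<^sup>+ \<omega>. c n \<omega> \<partial>M)"
      by (rule nn_integral_liminf) measurable
    also have "\<dots> \<le> liminf (\<lambda>n::nat. ennreal B)" using cint by (intro Liminf_mono) auto
    finally show ?thesis by (simp add: Liminf_const)
  qed
  show "(\<integral>\<^sup>+ \<omega>. emeasure (count_space UNIV) (\<Phi> \<omega> \<inter> U) \<partial>M) \<le> ennreal B"
    using nn_integral_mono_AE[OF AEc] lim by (rule order_trans)
  have "(\<integral>\<^sup>+ \<omega>. liminf (\<lambda>n. c n \<omega>) \<partial>M) \<noteq> \<infinity>" using lim by (auto simp: top_unique)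
  then have "AE \<omega> in M. liminf (\<lambda>n. c n \<omega>) \<noteq> \<infinity>"
    by (intro nn_integral_PInf_AE) measurable
  then show "AE \<omega> in M. finite (\<Phi> \<omega> \<inter> U)"
    using AEc by eventually_elim (auto simp: emeasure_count_space top_unique split: if_splits)
qed

text \<open>A count is at least the indicator that U contains a point, which is one minus the
  product of the weight vanishing on U. For a Poisson process this gives one minus the void
  probability.\<close>

lemma expected_count_ge:
  assumes "prob_space M" and L: "has_laplace_exponent M \<Phi> \<Lambda>"
    and U: "U \<in> sets borel" "emeasure lborel U < \<infinity>"
  shows "ennreal (exp (- \<Lambda> (\<lambda>_. 1)) - exp (- \<Lambda> (\<lambda>x. 1 - indicator U x)))
    \<le> (\<integral>\<^sup>+ \<omega>. emeasure (count_space UNIV) (\<Phi> \<omega> \<inter> U) \<partial>M)"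
proof -
  have one: "config_prod (\<lambda>_. 1) \<eta> = 1" for \<eta> :: "plane set"
    by (intro antisym config_prod_le_1 le_config_prod) auto
  have adm: "admissible (\<lambda>x. 1 - indicator U x)" using admissible_thinned[OF U, of 1] by simp
  have "ennreal ((exp (- \<Lambda> (\<lambda>_. 1)) - exp (- \<Lambda> (\<lambda>x. 1 - indicator U x))) / 1) =
      (\<integral>\<^sup>+ \<omega>. ennreal ((config_prod (\<lambda>_. 1) (\<Phi> \<omega>) - config_prod (\<lambda>x. 1 - indicator U x) (\<Phi> \<omega>)) / 1) \<partial>M)"
    by (rule laplace_diff[symmetric, OF assms(1) L _ adm]) (auto simp: admissible_def)
  also have "\<dots> \<le> (\<integral>\<^sup>+ \<omega>. emeasure (count_space UNIV) (\<Phi> \<omega> \<inter> U) \<partial>M)"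
  proof (rule nn_integral_mono)
    fix \<omega>
    show "ennreal ((config_prod (\<lambda>_. 1) (\<Phi> \<omega>) - config_prod (\<lambda>x. 1 - indicator U x) (\<Phi> \<omega>)) / 1)
        \<le> emeasure (count_space UNIV) (\<Phi> \<omega> \<inter> U)"
    proof (cases "\<Phi> \<omega> \<inter> U = {}")
      case True
      have "1 \<le> config_prod (\<lambda>x. 1 - indicator U x) (\<Phi> \<omega>)"
      proof (rule le_config_prod)
        fix F assume "F \<subseteq> \<Phi> \<omega>"
        then have "(\<Prod>x\<in>F. 1 - indicator U x) = (\<Prod>x\<in>F. 1::real)"
          using True by (intro prod.cong) (auto simp: indicator_def)
        then show "1 \<le> (\<Prod>x\<in>F. 1 - indicator U x :: real)" by simp
      qed
      then show ?thesis by (simp add: one ennreal_neg)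
    next
      case False
      then obtain x where x: "x \<in> \<Phi> \<omega> \<inter> U" by blast
      have "0 \<le> config_prod (\<lambda>x. 1 - indicator U x) (\<Phi> \<omega>)"
        by (intro config_prod_nonneg) (auto simp: indicator_def)
      then have "ennreal ((config_prod (\<lambda>_. 1) (\<Phi> \<omega>) - config_prod (\<lambda>x. 1 - indicator U x) (\<Phi> \<omega>)) / 1) \<le> 1"
        by (simp add: one ennreal_le_1)
      also have "1 = emeasure (count_space UNIV) {x}" by simp
      also have "\<dots> \<le> emeasure (count_space UNIV) (\<Phi> \<omega> \<inter> U)"
        using x by (intro emeasure_mono) auto
      finally show ?thesis .
    qed
  qed
  finally show ?thesis by simp
qed

section \<open>Bounds on the success probabilities\<close>

text \<open>Additivity of the nonnegative integral asks for measurable summands, so each summand is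
  first replaced by an almost everywhere equal measurable \<open>D i\<close>.\<close>

lemma laplace_diff_sum:
  assumes P: "prob_space M" and L: "has_laplace_exponent M \<Phi> \<Lambda>" and a: "\<And>i. admissible (a i)" and b: "\<And>i. admissible (b i)"
    and ba: "\<And>i x. b i x \<le> a i x" and s: "0 < s"
  shows "(\<integral>\<^sup>+ \<omega>. (\<Sum>i\<in>I. ennreal ((config_prod (a i) (\<Phi> \<omega>) - config_prod (b i) (\<Phi> \<omega>)) / s)) \<partial>M) =
    (\<Sum>i\<in>I. ennreal ((exp (- \<Lambda> (a i)) - exp (- \<Lambda> (b i))) / s))"
proof (cases "finite I")
  case True
  let ?h = "\<lambda>i \<omega>. ennreal ((config_prod (a i) (\<Phi> \<omega>) - config_prod (b i) (\<Phi> \<omega>)) / s)"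
  have "\<exists>D\<in>borel_measurable M. AE \<omega> in M. ?h i \<omega> = D \<omega>" for i
  proof -
    obtain Ya where Ya[measurable]: "Ya \<in> borel_measurable M" "AE \<omega> in M. config_prod (a i) (\<Phi> \<omega>) = Ya \<omega>"
      by (rule has_laplace_exponentE[OF L a])
    obtain Yb where Yb[measurable]: "Yb \<in> borel_measurable M" "AE \<omega> in M. config_prod (b i) (\<Phi> \<omega>) = Yb \<omega>"
      by (rule has_laplace_exponentE[OF L b])
    have "(\<lambda>\<omega>. ennreal ((Ya \<omega> - Yb \<omega>) / s)) \<in> borel_measurable M" by measurable
    moreover have "AE \<omega> in M. ?h i \<omega> = ennreal ((Ya \<omega> - Yb \<omega>) / s)"
      using Ya(2) Yb(2) by eventually_elim simp
    ultimately show ?thesis by (intro bexI[of _ "\<lambda>\<omega>. ennreal ((Ya \<omega> - Yb \<omega>) / s)"])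
  qed
  then have "\<forall>i. \<exists>D. D \<in> borel_measurable M \<and> (AE \<omega> in M. ?h i \<omega> = D \<omega>)" by blast
  from choice[OF this] obtain D where D: "\<forall>i. D i \<in> borel_measurable M \<and> (AE \<omega> in M. ?h i \<omega> = D i \<omega>)" ..
  have "AE \<omega> in M. \<forall>i\<in>I. ?h i \<omega> = D i \<omega>"
    using D True by (simp add: AE_finite_all)
  then have "(\<integral>\<^sup>+ \<omega>. (\<Sum>i\<in>I. ?h i \<omega>) \<partial>M) = (\<integral>\<^sup>+ \<omega>. (\<Sum>i\<in>I. D i \<omega>) \<partial>M)"
    by (intro nn_integral_cong_AE) (auto elim!: eventually_mono)
  also have "\<dots> = (\<Sum>i\<in>I. \<integral>\<^sup>+ \<omega>. D i \<omega> \<partial>M)"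
    using D by (intro nn_integral_sum) auto
  also have "\<dots> = (\<Sum>i\<in>I. \<integral>\<^sup>+ \<omega>. ?h i \<omega> \<partial>M)"
  proof (rule sum.cong[OF refl], rule nn_integral_cong_AE)
    fix i
    have "AE \<omega> in M. ?h i \<omega> = D i \<omega>" using D by blast
    then show "AE \<omega> in M. D i \<omega> = ?h i \<omega>" by eventually_elim simp
  qed
  also have "\<dots> = (\<Sum>i\<in>I. ennreal ((exp (- \<Lambda> (a i)) - exp (- \<Lambda> (b i))) / s))"
    by (intro sum.cong refl laplace_diff[OF P L a b ba s])
  finally show ?thesis .
qed simp

section \<open>Grid of squares of side 1/m\<close>

definition corner :: "nat \<Rightarrow> nat \<times> nat \<Rightarrow> plane" where
  "corner m p = vector [real (fst p) / real m, real (snd p) / real m]"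

text \<open>For m > 0, the half-open square of side 1 / m with lower left corner
  \<open>corner m p\<close>; in the form with floors, disjointness is immediate.\<close>

definition cell :: "nat \<Rightarrow> nat \<times> nat \<Rightarrow> plane set" where
  "cell m p = {x. \<lfloor>real m * x $ 1\<rfloor> = int (fst p) \<and> \<lfloor>real m * x $ 2\<rfloor> = int (snd p)}"

lemma corner_nth[simp]: "corner m p $ 1 = real (fst p) / real m" "corner m p $ 2 = real (snd p) / real m"
  by (simp_all add: corner_def)

lemma mem_cell_iff:
  assumes "0 < m"
  shows "x \<in> cell m p \<longleftrightarrow>
    corner m p $ 1 \<le> x $ 1 \<and> x $ 1 < corner m p $ 1 + 1 / real m \<and>
    corner m p $ 2 \<le> x $ 2 \<and> x $ 2 < corner m p $ 2 + 1 / real m"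
  using assms by (auto simp: cell_def floor_eq_iff field_simps)

lemma disjoint_family_cell: "disjoint_family_on (cell m) I"
  by (auto simp: disjoint_family_on_def cell_def prod_eq_iff)

lemma cell_sets[measurable]: "cell m p \<in> sets borel"
proof -
  have [measurable]: "(\<lambda>x::plane. x $ i) \<in> borel_measurable borel" for i
    by (intro borel_measurable_continuous_onI continuous_intros)
  show ?thesis unfolding cell_def by measurable
qed

lemma mem_unit_box: "x \<in> cbox 0 One \<longleftrightarrow> 0 \<le> x $ 1 \<and> x $ 1 \<le> 1 \<and> 0 \<le> x $ 2 \<and> (x::plane) $ 2 \<le> 1"
proof -
  have "(One::plane) $ i = 1" for i
    by (simp add: cart_eq_inner_axis inner_sum_left_Basis axis_in_Basis_iff)
  then show ?thesis by (auto simp: mem_box_cart forall_2)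
qed

lemma cell_subset_unit_box:
  assumes "p \<in> {..<m} \<times> {..<m}"
  shows "cell m p \<subseteq> cbox 0 One"
proof
  fix x assume x: "x \<in> cell m p"
  have m: "0 < m" using assms by auto
  have "corner m p $ 1 + 1 / real m \<le> 1" "corner m p $ 2 + 1 / real m \<le> 1"
    using assms m by (auto simp: add_divide_distrib[symmetric])
  moreover have "0 \<le> corner m p $ 1" "0 \<le> corner m p $ 2" by simp_all
  ultimately show "x \<in> cbox 0 One"
    using x unfolding mem_cell_iff[OF m] mem_unit_box by linarith
qed

text \<open>The index m is included for points of the closed square with a coordinate equal to 1.
  The cover thus has (m + 1)^2 cells, against m^2 cells inside the square.\<close>

lemma unit_box_subset_cells:
  assumes m: "0 < m"
  shows "cbox 0 One \<subseteq> (\<Union>p\<in>{..m} \<times> {..m}. cell m p)"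
proof
  fix x :: plane assume x: "x \<in> cbox 0 One"
  define i where "i = nat \<lfloor>real m * x $ 1\<rfloor>"
  define j where "j = nat \<lfloor>real m * x $ 2\<rfloor>"
  have b: "0 \<le> real m * x $ k \<and> real m * x $ k \<le> real m" if "k = 1 \<or> k = 2" for k
    using x that m mult_left_mono[of "x $ k" 1 "real m"] by (auto simp: mem_unit_box)
  have "0 \<le> \<lfloor>real m * x $ k\<rfloor> \<and> \<lfloor>real m * x $ k\<rfloor> \<le> int m" if "k = 1 \<or> k = 2" for k
    using b[OF that] by (simp add: floor_le_iff)
  from this[of 1] this[of 2] have "i \<le> m" "j \<le> m" "x \<in> cell m (i, j)"
    unfolding i_def j_def cell_def by auto
  then show "x \<in> (\<Union>p\<in>{..m} \<times> {..m}. cell m p)" by blast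
qed

text \<open>A coarse bound through the sum of the coordinates; 2 / m is the displacement that the
  envelopes of the kernel have to absorb.\<close>

lemma cell_near_corner:
  assumes m: "0 < m" and "x \<in> cell m p"
  shows "norm (x - corner m p) \<le> 2 / real m"
proof -
  have "norm (x - corner m p) \<le> (\<Sum>i\<in>UNIV. \<bar>(x - corner m p) $ i\<bar>)" by (rule norm_le_l1_cart)
  also have "\<dots> = \<bar>x $ 1 - corner m p $ 1\<bar> + \<bar>x $ 2 - corner m p $ 2\<bar>" by (simp add: sum_2)
  also have "\<dots> \<le> 1 / real m + 1 / real m"
    using assms(2) unfolding mem_cell_iff[OF m] by linarith
  finally show ?thesis by simp
qed

text \<open>The cell lies between an open and a closed box of equal volume.\<close>

lemma emeasure_cell:
  assumes m: "0 < m"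
  shows "emeasure lborel (cell m p) = ennreal (1 / (real m)\<^sup>2)"
proof -
  define b :: plane where "b = (\<chi> i. corner m p $ i + 1 / real m)"
  have prod: "(\<Prod>i\<in>Basis. (b - corner m p) \<bullet> i) = 1 / (real m)\<^sup>2"
  proof -
    have "(b - corner m p) \<bullet> i = 1 / real m" if "i \<in> Basis" for i
      using that by (auto simp: Basis_vec_def b_def inner_axis)
    then show ?thesis by (simp add: power2_eq_square)
  qed
  have le: "\<And>i. i \<in> Basis \<Longrightarrow> corner m p \<bullet> i \<le> b \<bullet> i"
    by (auto simp: Basis_vec_def b_def inner_axis)
  have "box (corner m p) b \<subseteq> cell m p" "cell m p \<subseteq> cbox (corner m p) b"
    by (auto simp: mem_cell_iff[OF m] mem_box_cart forall_2 b_def)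
  then have "emeasure lborel (box (corner m p) b) \<le> emeasure lborel (cell m p)"
    "emeasure lborel (cell m p) \<le> emeasure lborel (cbox (corner m p) b)"
    by (auto intro!: emeasure_mono)
  moreover have "emeasure lborel (box (corner m p) b) = ennreal (1 / (real m)\<^sup>2)"
    "emeasure lborel (cbox (corner m p) b) = ennreal (1 / (real m)\<^sup>2)"
    using le by (simp_all add: emeasure_lborel_box_eq emeasure_lborel_cbox_eq prod)
  ultimately show ?thesis by simp
qed

lemma measure_cell: "0 < m \<Longrightarrow> measure lborel (cell m p) = 1 / (real m)\<^sup>2"
  by (simp add: measure_def emeasure_cell)

lemma emeasure_unit_box: "emeasure lborel (cbox 0 (One::plane)) = 1"
  by (simp add: emeasure_lborel_cbox_eq)

section \<open>Translation of integrals and of admissible weights\<close>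

lemma integral_lborel_shift:
  fixes h :: "plane \<Rightarrow> real"
  assumes h[measurable]: "h \<in> borel_measurable borel"
  shows "(\<integral>x. h (x - k) \<partial>lborel) = (\<integral>x. h x \<partial>lborel)"
proof -
  have "(\<integral>x. h x \<partial>lborel) = (\<integral>x. h x \<partial>distr lborel borel ((+) (- k)))" by (simp only: lborel_distr_plus)
  also have "\<dots> = (\<integral>x. h (x - k) \<partial>lborel)" by (subst integral_distr) auto
  finally show ?thesis by simp
qed

lemma integrable_lborel_shift:
  fixes h :: "plane \<Rightarrow> real"
  assumes h: "integrable lborel h"
  shows "integrable lborel (\<lambda>x. h (x - k))"
proof -
  have "integrable (distr lborel borel ((+) (- k))) h" unfolding lborel_distr_plus by (rule h)
  then show ?thesis by (subst (asm) integrable_distr_eq) (use h in auto)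
qed

lemma admissible_shift:
  assumes "admissible w"
  shows "admissible (\<lambda>x. w (x - k))"
proof -
  note [measurable] = admissibleD(1)[OF assms]
  have "(\<lambda>x. w (x - k)) \<in> borel_measurable borel" by measurable
  moreover have "integrable lborel (\<lambda>x. 1 - w (x - k))"
    using integrable_lborel_shift[OF admissibleD(4)[OF assms]] .
  ultimately show ?thesis using admissibleD(2,3)[OF assms] by (auto simp: admissible_def)
qed

lemma admissible_add_indicator:
  assumes w: "admissible w" and C[measurable]: "C \<in> sets borel" "emeasure lborel C < \<infinity>"
    and b: "\<And>x. 0 \<le> w x + t * indicator C x" "\<And>x. w x + t * indicator C x \<le> 1"
  shows "admissible (\<lambda>x. w x + t * indicator C x)"
proof -
  note [measurable] = admissibleD(1)[OF w]
  have "(\<lambda>x. w x + t * indicator C x) \<in> borel_measurable borel" by measurable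
  moreover have "integrable lborel (\<lambda>x. (1 - w x) - t * indicator C x)"
    using C by (intro Bochner_Integration.integrable_diff admissibleD(4)[OF w] integrable_mult_right integrable_real_indicator) auto
  then have "integrable lborel (\<lambda>x. 1 - (w x + t * indicator C x))" by (simp add: algebra_simps)
  ultimately show ?thesis using b by (auto simp: admissible_def)
qed

lemma neyman_scott_process_prob_space: "neyman_scott_process M lp c f \<Phi> \<Longrightarrow> prob_space M"
  unfolding neyman_scott_process_def by (elim exE conjE) (rule poisson_process_prob_space)

lemma neyman_scott_process_countable:
  assumes "neyman_scott_process M lp c f \<Phi>"
  shows "AE \<omega> in M. countable (\<Phi> \<omega>)"
proof -
  obtain X N D where "AE \<omega> in M. \<Phi> \<omega> = {X n \<omega> + D (n, k) \<omega> | (n::nat) (k::nat). k < N n \<omega>}"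
    using assms unfolding neyman_scott_process_def by (elim exE conjE) (rule that; assumption)
  then show ?thesis
  proof eventually_elim
    case (elim \<omega>)
    have "\<Phi> \<omega> \<subseteq> (\<lambda>(n, k). X n \<omega> + D (n, k) \<omega>) ` UNIV" unfolding elim by auto
    then show ?case by (rule countable_subset) simp
  qed
qed

lemma locally_finite_countable:
  assumes "locally_finite \<eta>"
  shows "countable \<eta>"
proof -
  have "\<eta> \<subseteq> (\<Union>n. \<eta> \<inter> ball 0 (real n))"
    using reals_Archimedean2 by (auto simp: dist_norm)
  moreover have "countable (\<eta> \<inter> ball 0 (real n))" for n
    using assms unfolding locally_finite_def by (meson bounded_ball countable_finite)
  ultimately show ?thesis by (meson countable_UN countable_subset uncountable_def countableI_type)
qed

text \<open>Factor by which an interferer at y multiplies the success probability at the receiver z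
  once its fading is integrated out.\<close>

definition survival :: "(plane \<Rightarrow> real) \<Rightarrow> real \<Rightarrow> plane \<Rightarrow> plane \<Rightarrow> real" where
  "survival g T z y = 1 / (1 + T * max 0 (g (y - z)) / g z)"

lemma survival_bounds: "0 < T \<Longrightarrow> 0 < g z \<Longrightarrow> 0 \<le> survival g T z y" "0 < T \<Longrightarrow> 0 < g z \<Longrightarrow> survival g T z y \<le> 1"
proof -
  assume "0 < T" "0 < g z"
  then have "0 \<le> T * max 0 (g (y - z)) / g z" by simp
  then show "0 \<le> survival g T z y" "survival g T z y \<le> 1" by (auto simp: survival_def)
qed

lemma palm_sum_conditional_success:
  assumes "0 < \<mu>" "0 < T" "0 < g z" "countable \<eta>"
  shows "(\<integral>\<^sup>+ x. conditional_success \<mu> g T z ((\<lambda>y. y - x) ` \<eta> - {0}) \<partial>count_space A) =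
    (\<integral>\<^sup>+ x. ennreal (config_prod (survival g T z) ((\<lambda>y. y - x) ` \<eta> - {0})) \<partial>count_space A)"
proof (rule nn_integral_cong)
  fix x
  have "countable ((\<lambda>y. y - x) ` \<eta> - {0})" using assms(4) by auto
  then show "conditional_success \<mu> g T z ((\<lambda>y. y - x) ` \<eta> - {0}) =
      ennreal (config_prod (survival g T z) ((\<lambda>y. y - x) ` \<eta> - {0}))"
    using conditional_success_eq[where g = g and z = z, OF assms(1-3)] by (simp add: survival_def[abs_def])
qed

lemma ennreal_inverse_antimono: "b \<le> b' \<Longrightarrow> inverse b' \<le> inverse (b::ennreal)"
proof (cases "b = 0 \<or> b' = top")
  case False
  assume le: "b \<le> b'"
  obtain r where r: "b' = ennreal r" "0 \<le> r" using False by (cases b') auto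
  obtain q where q: "b = ennreal q" "0 \<le> q" using False le r by (cases b) (auto simp: top_unique)
  have "0 < q" "q \<le> r" using False le r q by (auto simp: ennreal_le_iff)
  then show ?thesis using r q by (simp add: inverse_ennreal ennreal_leI le_imp_inverse_le)
qed auto

lemma ennreal_divide_left_mono: "b \<le> b' \<Longrightarrow> a / b' \<le> a / (b::ennreal)"
  unfolding divide_ennreal_def by (intro mult_left_mono ennreal_inverse_antimono) auto

text \<open>The cell bound is applied to w shifted to the corners, a majorant of the survival weight
  under displacements up to 2 / m. The shift leaves the exponent unchanged and a jump s on a cell
  lowers it by l s / m^2. The intensity is bounded below by the probability that the unit square
  contains a point.\<close>

lemma success_probability_poisson_le:
  assumes P: "poisson_process M l \<Phi>" and l: "0 < l" and pos: "0 < \<mu>" "0 < T" "0 < g (rx R)"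
    and w: "admissible w" and m: "0 < m"
    and near: "\<And>u e. norm e \<le> 2 / real m \<Longrightarrow> survival g T (rx R) (u - e) \<le> w u"
    and s: "0 < s" "s \<le> 1" "\<And>e. norm e \<le> 2 / real m \<Longrightarrow> w e + s \<le> 1"
  shows "success_probability M \<Phi> \<mu> g T R \<le>
    ennreal (4 * l * exp l * exp (- l * (\<integral>x. 1 - w x \<partial>lborel))) / ennreal (1 - exp (- l))"
proof -
  let ?\<Lambda> = "\<lambda>w. l * (\<integral>x. 1 - w x \<partial>lborel)"
  let ?v = "survival g T (rx R)"
  let ?I = "{..m} \<times> {..m}"
  let ?b = "\<lambda>p y. w (y - corner m p)"
  let ?a = "\<lambda>p y. ?b p y + s * indicator (cell m p) y"
  interpret prob_space M using P by (rule poisson_process_prob_space)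
  have L: "has_laplace_exponent M \<Phi> ?\<Lambda>" by (rule poisson_process_laplace[OF P]) (use l in simp)
  have cellfin: "emeasure lborel (cell m p) < \<infinity>" for p by (simp add: emeasure_cell[OF m])
  have b: "admissible (?b p)" for p by (rule admissible_shift[OF w])
  have ab: "0 \<le> ?a p y" "?a p y \<le> 1" "0 \<le> ?b p y" for p y
    using s cell_near_corner[OF m, of y p] admissibleD(2,3)[OF w, of "y - corner m p"]
    by (auto simp: indicator_def)
  have a: "admissible (?a p)" for p
    by (rule admissible_add_indicator[OF b cell_sets cellfin ab(1,2)])
  have \<Lambda>b: "?\<Lambda> (?b p) = ?\<Lambda> w" for p
    using integral_lborel_shift[of "\<lambda>x. 1 - w x" "corner m p"] admissibleD(1)[OF w] by simp
  have \<Lambda>a: "?\<Lambda> (?a p) = ?\<Lambda> w - l * s / (real m)\<^sup>2" for p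
  proof -
    have "(\<integral>x. 1 - ?a p x \<partial>lborel) = (\<integral>x. (1 - ?b p x) - s * indicator (cell m p) x \<partial>lborel)"
      by (simp add: algebra_simps)
    also have "\<dots> = (\<integral>x. 1 - ?b p x \<partial>lborel) - s * (1 / (real m)\<^sup>2)"
      using cellfin by (subst Bochner_Integration.integral_diff)
        (auto intro!: admissibleD(4)[OF b] integrable_real_indicator simp: measure_cell[OF m])
    finally have "?\<Lambda> (?a p) = ?\<Lambda> (?b p) - l * s / (real m)\<^sup>2" by (simp only: right_diff_distrib) simp
    then show ?thesis unfolding \<Lambda>b .
  qed
  have term_le: "(exp (- ?\<Lambda> (?a p)) - exp (- ?\<Lambda> (?b p))) / s \<le> l / (real m)\<^sup>2 * exp l * exp (- ?\<Lambda> w)" for p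
  proof -
    \<comment> \<open>Drop of the exponent caused by the jump on one cell; since t \<le> l, the
      factor exp l bounds exp t independently of m and s.\<close>
    define t where "t = l * s / (real m)\<^sup>2"
    have t0: "0 \<le> t" using l s by (simp add: t_def)
    have m1: "1 \<le> (real m)\<^sup>2" using m by (simp add: one_le_power)
    have tl: "t \<le> l"
    proof -
      have "t \<le> l * s / 1" unfolding t_def using l s m m1 by (intro divide_left_mono) auto
      also have "\<dots> \<le> l" using l s by (simp add: mult_left_le)
      finally show ?thesis .
    qed
    \<comment> \<open>Multiplied by exp (- t), this is 1 - t \<le> exp (- t).\<close>
    have "exp t - 1 \<le> t * exp t"
    proof -
      have "(1 - t) * exp t \<le> exp (- t) * exp t"
        using exp_ge_add_one_self[of "- t"] by (intro mult_right_mono) auto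
      then show ?thesis by (simp add: algebra_simps flip: exp_add)
    qed
    also have "\<dots> \<le> t * exp l" using t0 tl by (intro mult_left_mono) auto
    finally have "exp (- ?\<Lambda> w) * (exp t - 1) \<le> exp (- ?\<Lambda> w) * (t * exp l)"
      by (intro mult_left_mono) auto
    moreover have "exp (- ?\<Lambda> (?a p)) = exp (- ?\<Lambda> w) * exp t"
      unfolding \<Lambda>a t_def[symmetric] by (simp flip: exp_add)
    ultimately have "exp (- ?\<Lambda> (?a p)) - exp (- ?\<Lambda> (?b p)) \<le> s * (l / (real m)\<^sup>2 * exp l * exp (- ?\<Lambda> w))"
      unfolding \<Lambda>b by (simp add: algebra_simps t_def)
    then show ?thesis using s by (simp add: field_simps)
  qed
  have "(\<integral>\<^sup>+ \<omega>. (\<integral>\<^sup>+ x. conditional_success \<mu> g T (rx R) ((\<lambda>y. y - x) ` \<Phi> \<omega> - {0})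
        \<partial>count_space (\<Phi> \<omega> \<inter> cbox 0 One)) \<partial>M) \<le>
      (\<integral>\<^sup>+ \<omega>. (\<Sum>p\<in>?I. ennreal ((config_prod (?a p) (\<Phi> \<omega>) - config_prod (?b p) (\<Phi> \<omega>)) / s)) \<partial>M)"
  proof (rule nn_integral_mono_AE)
    have "AE \<omega> in M. locally_finite (\<Phi> \<omega>)" using P by (simp add: poisson_process_def)
    then show "AE \<omega> in M. (\<integral>\<^sup>+ x. conditional_success \<mu> g T (rx R) ((\<lambda>y. y - x) ` \<Phi> \<omega> - {0})
        \<partial>count_space (\<Phi> \<omega> \<inter> cbox 0 One)) \<le>
      (\<Sum>p\<in>?I. ennreal ((config_prod (?a p) (\<Phi> \<omega>) - config_prod (?b p) (\<Phi> \<omega>)) / s))"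
    proof eventually_elim
      case (elim \<omega>)
      have "bounded (cell m p)" for p
      proof (rule boundedI)
        fix x assume "x \<in> cell m p"
        then show "norm x \<le> 2 / real m + norm (corner m p)"
          using cell_near_corner[OF m, of x p] norm_triangle_sub[of x "corner m p"] by linarith
      qed
      then have fin: "finite (\<Phi> \<omega> \<inter> cell m p)" for p using elim unfolding locally_finite_def by blast
      have nearc: "?v (y - x) \<le> w (y - corner m p)" if "x \<in> cell m p" for p x y
        using near[OF cell_near_corner[OF m that], of "y - corner m p"] by simp
      show ?case
        unfolding palm_sum_conditional_success[where g = g and z = "rx R", OF pos locally_finite_countable[OF elim]]
        by (rule palm_sum_upper[OF _ fin unit_box_subset_cells[OF m] s(1) ab(3,2) nearc survival_bounds(1)[where g = g and z = "rx R", OF pos(2,3)]]) auto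
    qed
  qed
  also have "\<dots> = (\<Sum>p\<in>?I. ennreal ((exp (- ?\<Lambda> (?a p)) - exp (- ?\<Lambda> (?b p))) / s))"
    using s by (intro laplace_diff_sum[OF prob_space_axioms L a b]) auto
  also have "\<dots> \<le> (\<Sum>p\<in>?I. ennreal (l / (real m)\<^sup>2 * exp l * exp (- ?\<Lambda> w)))"
    by (intro sum_mono ennreal_leI term_le)
  also have "\<dots> = ennreal ((real m + 1)\<^sup>2 * (l / (real m)\<^sup>2 * exp l * exp (- ?\<Lambda> w)))"
    using l by (subst sum_ennreal) (auto simp: power2_eq_square algebra_simps)
  also have "\<dots> \<le> ennreal (4 * l * exp l * exp (- ?\<Lambda> w))"
  proof (rule ennreal_leI)
    \<comment> \<open>Origin of the constant 4: there are (m + 1)^2 covering cells of area 1 / m^2,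
      and m + 1 \<le> 2 m.\<close>
    have "(real m + 1)\<^sup>2 \<le> (2 * real m)\<^sup>2" using m by (intro power_mono) auto
    then have "(real m + 1)\<^sup>2 / (real m)\<^sup>2 \<le> 4" using m by (simp add: field_simps)
    from mult_right_mono[OF this, of "l * exp l * exp (- ?\<Lambda> w)"] l
    show "(real m + 1)\<^sup>2 * (l / (real m)\<^sup>2 * exp l * exp (- ?\<Lambda> w)) \<le> 4 * l * exp l * exp (- ?\<Lambda> w)"
      by (simp add: mult_ac)
  qed
  finally have num: "(\<integral>\<^sup>+ \<omega>. (\<integral>\<^sup>+ x. conditional_success \<mu> g T (rx R) ((\<lambda>y. y - x) ` \<Phi> \<omega> - {0})
        \<partial>count_space (\<Phi> \<omega> \<inter> cbox 0 One)) \<partial>M) \<le> ennreal (4 * l * exp l * exp (- ?\<Lambda> w))" .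
  have "ennreal (1 - exp (- (l * 1))) \<le> intensity M \<Phi>"
    using expected_count_ge[OF prob_space_axioms L, of "cbox 0 One"] emeasure_unit_box
    by (simp add: intensity_def measure_def)
  from order_trans[OF divide_right_mono_ennreal[OF num] ennreal_divide_left_mono[OF this]]
  show ?thesis unfolding success_probability_def reduced_palm_expectation_def by simp
qed


text \<open>From exp (- x) \<le> 1 / (1 + x); it bounds 1 - exp (- x) below by a linear function on
  [0, K].\<close>

lemma one_minus_exp_neg_ge:
  fixes x K :: real
  assumes "0 \<le> x" "x \<le> K"
  shows "x / (1 + K) \<le> 1 - exp (- x)"
proof -
  have "exp (- x) \<le> 1 / (1 + x)"
    using assms exp_ge_add_one_self[of x] by (simp add: exp_minus field_simps)
  then have "x / (1 + x) \<le> 1 - exp (- x)" using assms by (simp add: field_simps)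
  moreover have "x / (1 + K) \<le> x / (1 + x)" using assms by (intro divide_left_mono) auto
  ultimately show ?thesis by linarith
qed

text \<open>Here w is a minorant of the survival weight and is lowered by s on a cell, which raises
  the exponent by at least \<delta>. The factor exp (- c) is the worst damping by the loss already
  present, since a smeared loss is at most 1. The intensity is bounded above by
  \<open>lp * c\<close>.\<close>

lemma success_probability_neyman_scott_ge:
  assumes NS: "neyman_scott_process M lp c f \<Phi>" and lp: "0 < lp" and c: "0 < c" and f: "prob_density f"
    and pos: "0 < \<mu>" "0 < T" "0 < g (rx R)"
    and w: "admissible w" and m: "0 < m"
    and near: "\<And>u e. norm e \<le> 2 / real m \<Longrightarrow> w u \<le> survival g T (rx R) (u - e)"
    and s: "0 < s" "s \<le> 1" "\<And>e. norm e \<le> 2 / real m \<Longrightarrow> s \<le> w e"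
  shows "ennreal (exp (- c) / ((1 + c) * (1 + lp * c)) *
      exp (- lp * (\<integral>p. 1 - exp (- c * smear f (\<lambda>x. 1 - w x) p) \<partial>lborel)))
    \<le> success_probability M \<Phi> \<mu> g T R"
proof -
  let ?\<Lambda> = "\<lambda>w. lp * (\<integral>p. 1 - exp (- c * smear f (\<lambda>x. 1 - w x) p) \<partial>lborel)"
  let ?v = "survival g T (rx R)"
  let ?I = "{..<m} \<times> {..<m}"
  let ?a = "\<lambda>p y. w (y - corner m p)"
  let ?b = "\<lambda>p y. ?a p y - s * indicator (cell m p) y"
  interpret prob_space M using NS by (rule neyman_scott_process_prob_space)
  have L: "has_laplace_exponent M \<Phi> ?\<Lambda>" by (rule neyman_scott_process_laplace[OF NS lp c f])
  have cellfin: "emeasure lborel (cell m p) < \<infinity>" for p by (simp add: emeasure_cell[OF m])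
  have a: "admissible (?a p)" for p by (rule admissible_shift[OF w])
  have sa: "s * indicator (cell m p) y \<le> ?a p y" for p y
    using s(3)[OF cell_near_corner[OF m, of y p]] admissibleD(2)[OF w, of "y - corner m p"]
    by (auto simp: indicator_def)
  have b: "admissible (?b p)" for p
  proof -
    have "?b p y \<le> 1" for y
      using admissibleD(3)[OF w, of "y - corner m p"] s by (auto simp: indicator_def)
    then show ?thesis
      using admissible_add_indicator[OF a cell_sets cellfin, of p "- s" p] sa[of p] by simp
  qed
  have h: "(\<lambda>x. 1 - u x) \<in> borel_measurable borel" "\<And>x. 0 \<le> 1 - u x" "\<And>x. 1 - u x \<le> 1"
    "integrable lborel (\<lambda>x. 1 - u x)" if "admissible u" for u
    using admissibleD[OF that] by auto
  let ?ind = "\<lambda>p. indicator (cell m p) :: plane \<Rightarrow> real"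
  have i: "?ind p \<in> borel_measurable borel" "\<And>x. 0 \<le> ?ind p x" "\<And>x. ?ind p x \<le> 1" "integrable lborel (?ind p)" for p
    using cellfin[of p] by (auto simp: indicator_def[abs_def] intro!: integrable_real_indicator[unfolded indicator_def[abs_def]])
  have \<Lambda>a: "?\<Lambda> (?a p) = ?\<Lambda> w" for p
  proof -
    have "smear f (\<lambda>x. 1 - ?a p x) q = smear f (\<lambda>x. 1 - w x) (q - corner m p)" for q
      unfolding smear_def by (intro Bochner_Integration.integral_cong) (simp_all add: algebra_simps)
    moreover have "(\<lambda>q. 1 - exp (- c * smear f (\<lambda>x. 1 - w x) q)) \<in> borel_measurable borel"
      using smear_measurable[OF f h(1-3)[OF w]] by measurable
    ultimately show ?thesis
      using integral_lborel_shift[of "\<lambda>q. 1 - exp (- c * smear f (\<lambda>x. 1 - w x) q)" "corner m p"] by simp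
  qed
  have smear_b: "smear f (\<lambda>x. 1 - ?b p x) q = smear f (\<lambda>x. 1 - ?a p x) q + s * smear f (?ind p) q" for p q
  proof -
    have "smear f (\<lambda>x. 1 - ?b p x) q =
        (\<integral>d. (1 - ?a p (q + d)) * f d + s * (?ind p (q + d) * f d) \<partial>lborel)"
      unfolding smear_def by (intro Bochner_Integration.integral_cong) (simp_all add: algebra_simps)
    also have "\<dots> = smear f (\<lambda>x. 1 - ?a p x) q + s * smear f (?ind p) q"
      using smear_integrand_integrable[OF f h(1-3)[OF a[of p]], of q] smear_integrand_integrable[OF f i(1-3)[of p], of q]
      unfolding smear_def by simp
    finally show ?thesis .
  qed
  \<comment> \<open>With A the smeared loss and q the smeared cell indicator, the integrand of the
    exponent rises by exp (- c A) (1 - exp (- c s q)). Here A \<le> 1 gives the factor exp (- c), c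
    s q \<le> c gives c s q / (1 + c), and q has integral 1 / m^2.\<close>
  define \<delta> where "\<delta> = lp * (exp (- c) * (c * s / (1 + c) * (1 / (real m)\<^sup>2)))"
  have \<Lambda>b: "?\<Lambda> w + \<delta> \<le> ?\<Lambda> (?b p)" for p
  proof -
    let ?A = "smear f (\<lambda>x. 1 - ?a p x)" and ?q = "smear f (?ind p)"
    have ea: "integrable lborel (\<lambda>q. 1 - exp (- c * ?A q))"
      using c by (intro exp_smear_integrable[OF f h[OF a]]) simp
    have eb: "integrable lborel (\<lambda>q. 1 - exp (- c * smear f (\<lambda>x. 1 - ?b p x) q))"
      using c by (intro exp_smear_integrable[OF f h[OF b]]) simp
    have qi: "integrable lborel (\<lambda>q. exp (- c) * (c * s / (1 + c) * ?q q))"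
      using smear_integrable[OF f i] by simp
    have "(\<integral>q. (1 - exp (- c * ?A q)) + exp (- c) * (c * s / (1 + c) * ?q q) \<partial>lborel) \<le>
        (\<integral>q. 1 - exp (- c * smear f (\<lambda>x. 1 - ?b p x) q) \<partial>lborel)"
    proof (rule integral_mono[OF _ eb])
      show "integrable lborel (\<lambda>q. (1 - exp (- c * ?A q)) + exp (- c) * (c * s / (1 + c) * ?q q))"
        using ea qi by (rule Bochner_Integration.integrable_add)
      fix q
      have q01: "0 \<le> ?q q" "?q q \<le> 1" using smear_nonneg[OF f i(1-3)] smear_le_1[OF f i(1-3)] by auto
      have A1: "?A q \<le> 1" by (rule smear_le_1[OF f h(1-3)[OF a]])
      have "c * s * ?q q / (1 + c) \<le> 1 - exp (- (c * s * ?q q))"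
      proof (rule one_minus_exp_neg_ge)
        show "0 \<le> c * s * ?q q" using c s q01 by simp
        have "c * (s * ?q q) \<le> c * 1" using c s q01 by (intro mult_left_mono mult_le_one) auto
        then show "c * s * ?q q \<le> c" by (simp add: mult_ac)
      qed
      moreover have "exp (- c) \<le> exp (- c * ?A q)" using A1 c by simp
      ultimately have "exp (- c) * (c * s * ?q q / (1 + c)) \<le> exp (- c * ?A q) * (1 - exp (- (c * s * ?q q)))"
        using c s q01 by (intro mult_mono) auto
      moreover have "exp (- c * smear f (\<lambda>x. 1 - ?b p x) q) = exp (- c * ?A q) * exp (- (c * s * ?q q))"
        unfolding smear_b by (simp add: algebra_simps flip: exp_add)
      ultimately show "(1 - exp (- c * ?A q)) + exp (- c) * (c * s / (1 + c) * ?q q) \<le>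
          1 - exp (- c * smear f (\<lambda>x. 1 - ?b p x) q)"
        by (simp add: algebra_simps)
    qed
    moreover have "(\<integral>q. (1 - exp (- c * ?A q)) + exp (- c) * (c * s / (1 + c) * ?q q) \<partial>lborel) =
        (\<integral>q. 1 - exp (- c * ?A q) \<partial>lborel) + exp (- c) * (c * s / (1 + c) * (1 / (real m)\<^sup>2))"
    proof -
      have "(\<integral>q. exp (- c) * (c * s / (1 + c) * ?q q) \<partial>lborel) = exp (- c) * (c * s / (1 + c) * (1 / (real m)\<^sup>2))"
        using integral_smear[OF f i(1-3)[of p]] by (simp add: measure_cell[OF m])
      then show ?thesis by (subst Bochner_Integration.integral_add[OF ea qi]) simp
    qed
    ultimately have "lp * ((\<integral>q. 1 - exp (- c * ?A q) \<partial>lborel) + exp (- c) * (c * s / (1 + c) * (1 / (real m)\<^sup>2))) \<le> ?\<Lambda> (?b p)"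
      using lp by (intro mult_left_mono) auto
    moreover have "lp * ((\<integral>q. 1 - exp (- c * ?A q) \<partial>lborel) + exp (- c) * (c * s / (1 + c) * (1 / (real m)\<^sup>2))) = ?\<Lambda> (?a p) + \<delta>"
      by (simp only: distrib_left \<delta>_def)
    ultimately show ?thesis unfolding \<Lambda>a by (simp only:)
  qed
  have m1: "1 \<le> (real m)\<^sup>2" using m by (simp add: one_le_power)
  have \<delta>0: "0 \<le> \<delta>" using lp c s by (simp add: \<delta>_def)
  have \<delta>1: "\<delta> \<le> lp * c"
  proof -
    have "c * s \<le> c * 1" using c s by (intro mult_left_mono) auto
    also have "\<dots> \<le> c * (1 + c)" using c by simp
    finally have "c * s / (1 + c) \<le> c" using c by (simp add: field_simps)
    moreover have "1 / (real m)\<^sup>2 \<le> 1" using divide_left_mono[OF m1, of 1] m by simp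
    moreover have "0 \<le> c * s / (1 + c)" "exp (- c) \<le> 1" using c s by auto
    ultimately have "exp (- c) * (c * s / (1 + c) * (1 / (real m)\<^sup>2)) \<le> 1 * (c * 1)"
      using c by (intro mult_mono[of "exp (- c)"] mult_mono[of "c * s / (1 + c)"] mult_nonneg_nonneg) simp_all
    then show ?thesis unfolding \<delta>_def using lp by (intro mult_left_mono) auto
  qed
  \<comment> \<open>Chosen so that \<delta> / (1 + lp c) = s \<kappa> / m^2: division by s and
    summation over m^2 cells leave \<kappa>.\<close>
  define \<kappa> where "\<kappa> = lp * c * exp (- c) / ((1 + c) * (1 + lp * c))"
  have term_ge: "\<kappa> / (real m)\<^sup>2 * exp (- ?\<Lambda> w) \<le> (exp (- ?\<Lambda> (?a p)) - exp (- ?\<Lambda> (?b p))) / s" for p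
  proof -
    have "\<delta> / (1 + lp * c) \<le> 1 - exp (- \<delta>)" by (rule one_minus_exp_neg_ge[OF \<delta>0 \<delta>1])
    moreover have "\<delta> / (1 + lp * c) = s * (\<kappa> / (real m)\<^sup>2)" by (simp add: \<delta>_def \<kappa>_def mult_ac)
    ultimately have "exp (- ?\<Lambda> w) * (s * (\<kappa> / (real m)\<^sup>2)) \<le> exp (- ?\<Lambda> w) * (1 - exp (- \<delta>))"
      by (intro mult_left_mono) auto
    also have "\<dots> = exp (- ?\<Lambda> w) - exp (- (?\<Lambda> w + \<delta>))" by (simp add: right_diff_distrib exp_add exp_diff exp_minus field_simps)
    also have "\<dots> \<le> exp (- ?\<Lambda> (?a p)) - exp (- ?\<Lambda> (?b p))" unfolding \<Lambda>a using \<Lambda>b[of p] by simp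
    finally show ?thesis using s by (simp add: field_simps)
  qed
  have unit: "cbox 0 (One::plane) \<in> sets borel" "emeasure lborel (cbox 0 (One::plane)) < \<infinity>"
    by (auto simp: emeasure_unit_box)
  \<comment> \<open>By 1 - exp (- x) \<le> x and preservation of mass, thinning the unit square by t
    costs at most t times the mean count in the exponent.\<close>
  have expB: "0 \<le> ?\<Lambda> (\<lambda>x. 1 - t * indicator (cbox 0 One) x) \<and> ?\<Lambda> (\<lambda>x. 1 - t * indicator (cbox 0 One) x) \<le> t * (lp * c)"
    if t: "0 < t" "t \<le> 1" for t
  proof -
    let ?u = "\<lambda>x. 1 - t * indicator (cbox 0 One) x :: real"
    have u: "admissible ?u" using t by (intro admissible_thinned unit) auto
    let ?S = "smear f (\<lambda>x. 1 - ?u x)"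
    have S0: "0 \<le> ?S q" for q by (rule smear_nonneg[OF f h(1-3)[OF u]])
    have "(\<integral>q. 1 - exp (- c * ?S q) \<partial>lborel) \<le> (\<integral>q. c * ?S q \<partial>lborel)"
    proof (rule integral_mono)
      show "integrable lborel (\<lambda>q. 1 - exp (- c * ?S q))"
        using c by (intro exp_smear_integrable[OF f h[OF u]]) simp
      show "integrable lborel (\<lambda>q. c * ?S q)" using smear_integrable[OF f h[OF u]] by simp
      show "1 - exp (- c * ?S q) \<le> c * ?S q" for q using exp_diff_bounds(2)[of "c * ?S q"] S0 c by simp
    qed
    also have "\<dots> = c * (\<integral>x. 1 - ?u x \<partial>lborel)" using integral_smear[OF f h(1-3)[OF u]] by simp
    also have "(\<integral>x. 1 - ?u x \<partial>lborel) = t" using emeasure_unit_box by (simp add: measure_def)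
    finally have "(\<integral>q. 1 - exp (- c * ?S q) \<partial>lborel) \<le> c * t" .
    then have "lp * (\<integral>q. 1 - exp (- c * ?S q) \<partial>lborel) \<le> lp * (c * t)" using lp by (intro mult_left_mono) auto
    moreover have "0 \<le> (\<integral>q. 1 - exp (- c * ?S q) \<partial>lborel)"
      using exp_diff_bounds(1)[of "c * ?S _"] S0 c by (intro integral_nonneg_AE) auto
    ultimately show ?thesis using lp by (simp add: mult_ac)
  qed
  have count: "(\<integral>\<^sup>+ \<omega>. emeasure (count_space UNIV) (\<Phi> \<omega> \<inter> cbox 0 One) \<partial>M) \<le> ennreal (lp * c)"
    "AE \<omega> in M. finite (\<Phi> \<omega> \<inter> cbox 0 One)"
    by (rule expected_count_le[OF prob_space_axioms L unit]; use expB in blast)+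
  have "ennreal (\<kappa> * exp (- ?\<Lambda> w)) = (\<Sum>p\<in>?I. ennreal (\<kappa> / (real m)\<^sup>2 * exp (- ?\<Lambda> w)))"
    using lp c m by (subst sum_ennreal) (auto simp: \<kappa>_def power2_eq_square)
  also have "\<dots> \<le> (\<Sum>p\<in>?I. ennreal ((exp (- ?\<Lambda> (?a p)) - exp (- ?\<Lambda> (?b p))) / s))"
    by (intro sum_mono ennreal_leI term_ge)
  also have "\<dots> = (\<integral>\<^sup>+ \<omega>. (\<Sum>p\<in>?I. ennreal ((config_prod (?a p) (\<Phi> \<omega>) - config_prod (?b p) (\<Phi> \<omega>)) / s)) \<partial>M)"
    using s by (intro laplace_diff_sum[symmetric, OF prob_space_axioms L a b]) auto
  also have "\<dots> \<le> (\<integral>\<^sup>+ \<omega>. (\<integral>\<^sup>+ x. conditional_success \<mu> g T (rx R) ((\<lambda>y. y - x) ` \<Phi> \<omega> - {0})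
        \<partial>count_space (\<Phi> \<omega> \<inter> cbox 0 One)) \<partial>M)"
  proof (rule nn_integral_mono_AE)
    show "AE \<omega> in M. (\<Sum>p\<in>?I. ennreal ((config_prod (?a p) (\<Phi> \<omega>) - config_prod (?b p) (\<Phi> \<omega>)) / s)) \<le>
      (\<integral>\<^sup>+ x. conditional_success \<mu> g T (rx R) ((\<lambda>y. y - x) ` \<Phi> \<omega> - {0})
        \<partial>count_space (\<Phi> \<omega> \<inter> cbox 0 One))"
      using neyman_scott_process_countable[OF NS] count(2)
    proof eventually_elim
      case (elim \<omega>)
      have nearc: "w (y - corner m p) \<le> ?v (y - x)" if "x \<in> cell m p" for p x y
        using near[OF cell_near_corner[OF m that], of "y - corner m p"] by simp
      show ?case
        unfolding palm_sum_conditional_success[where g = g and z = "rx R", OF pos elim(1)]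
        by (rule palm_sum_lower[OF elim(2) _ disjoint_family_cell cell_subset_unit_box s(1) sa admissibleD(3)[OF w] nearc
              survival_bounds(1)[where g = g and z = "rx R", OF pos(2,3)]]) auto
    qed
  qed
  finally have num: "ennreal (\<kappa> * exp (- ?\<Lambda> w)) \<le> \<dots>" .
  have "intensity M \<Phi> \<le> ennreal (lp * c)" unfolding intensity_def by (rule count(1))
  then have "ennreal (\<kappa> * exp (- ?\<Lambda> w)) / ennreal (lp * c) \<le> success_probability M \<Phi> \<mu> g T R"
    unfolding success_probability_def reduced_palm_expectation_def
    by (rule order_trans[OF divide_right_mono_ennreal[OF num] ennreal_divide_left_mono])
  \<comment> \<open>Division by the bound on the intensity cancels the factor \<open>lp * c\<close>
    of \<kappa>.\<close>
  moreover have "ennreal (\<kappa> * exp (- ?\<Lambda> w)) / ennreal (lp * c) =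
      ennreal (exp (- c) / ((1 + c) * (1 + lp * c)) * exp (- ?\<Lambda> w))"
    using lp c by (subst divide_ennreal) (auto simp: \<kappa>_def)
  ultimately show ?thesis by simp
qed

section \<open>The interference kernel of a path-loss function\<close>

lemma rx_nth[simp]: "rx r $ 1 = r" "rx r $ 2 = 0"
  by (simp_all add: rx_def)

lemma norm_rx[simp]: "norm (rx r) = \<bar>r\<bar>"
  by (simp add: norm_vec_def L2_set_def sum_2)

lemma rx_eq_0_iff[simp]: "rx r = 0 \<longleftrightarrow> r = 0"
  using norm_rx[of r] by (metis abs_eq_0 norm_eq_zero)

lemma rx_diff: "rx r - rx s = rx (r - s)"
  by (simp add: vec_eq_iff forall_2)

lemma rx_eq_scaleR: "rx r = r *\<^sub>R rx 1"
  by (simp add: vec_eq_iff forall_2)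

lemma continuous_on_rx: "continuous_on A rx"
  by (subst rx_eq_scaleR[abs_def]) (intro continuous_intros)

lemma filterlim_rx_at_infinity: "filterlim rx at_infinity at_top"
  by (rule filterlim_norm_at_top_imp_at_infinity) (simp add: filterlim_abs_real)

text \<open>For \<kappa> = g (rx R) / T, one minus the survival factor of an interferer with value t
  of g at the receiver: t / (\<kappa> + t) = 1 - 1 / (1 + t / \<kappa>).\<close>

definition loss :: "real \<Rightarrow> real \<Rightarrow> real" where
  "loss \<kappa> t = t / (\<kappa> + t)"

lemma loss_nonneg: "0 < \<kappa> \<Longrightarrow> 0 \<le> t \<Longrightarrow> 0 \<le> loss \<kappa> t"
  and loss_less_1: "0 < \<kappa> \<Longrightarrow> 0 \<le> t \<Longrightarrow> loss \<kappa> t < 1"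
  and loss_pos: "0 < \<kappa> \<Longrightarrow> 0 < t \<Longrightarrow> 0 < loss \<kappa> t"
  and loss_mono: "0 < \<kappa> \<Longrightarrow> 0 \<le> t \<Longrightarrow> t \<le> t' \<Longrightarrow> loss \<kappa> t \<le> loss \<kappa> t'"
  and loss_le: "0 < \<kappa> \<Longrightarrow> 0 \<le> t \<Longrightarrow> loss \<kappa> t \<le> t / \<kappa>"
  by (auto simp: loss_def field_simps)

context
  fixes g :: "plane \<Rightarrow> real"
  assumes g: "path_loss g"
begin

section \<open>Regularity and decay of the path loss\<close>

lemma path_loss_pos: "x \<noteq> 0 \<Longrightarrow> 0 < g x"
  using g by (simp add: path_loss_def)

lemma path_loss_mono: "x \<noteq> 0 \<Longrightarrow> norm x \<le> norm y \<Longrightarrow> g y \<le> g x"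
  using g unfolding path_loss_def by blast

lemma path_loss_radial: "x \<noteq> 0 \<Longrightarrow> g x = g (rx (norm x))"
  by (intro antisym path_loss_mono) auto

text \<open>g is continuous off the origin, and prescribing its value at one point keeps it
  measurable.\<close>

lemma path_loss_measurable[measurable]: "g \<in> borel_measurable borel"
proof -
  have "continuous_on (- {0}) g" using g by (simp add: path_loss_def)
  then have "(\<lambda>x. if x \<in> - {0} then g x else g 0) \<in> borel_measurable borel"
    by (intro borel_measurable_continuous_on_if) auto
  moreover have "(\<lambda>x. if x \<in> - {0} then g x else g 0) = g" by auto
  ultimately show ?thesis by simp
qed

lemma path_loss_rx_measurable[measurable]: "(\<lambda>r. g (rx r)) \<in> borel_measurable borel"
  by (rule measurable_compose[OF borel_measurable_continuous_onI[OF continuous_on_rx] path_loss_measurable])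

lemma path_loss_rx_isCont: "0 < r \<Longrightarrow> isCont (\<lambda>r. g (rx r)) r"
proof -
  assume r: "0 < r"
  have "continuous_on (- {0}) g" using g by (simp add: path_loss_def)
  then have "isCont g (rx r)" using r by (subst (asm) continuous_on_eq_continuous_at) auto
  moreover have "isCont rx r" using continuous_on_rx[of UNIV] by (simp add: continuous_on_eq_continuous_at)
  ultimately show ?thesis using isCont_o2[of r rx g] by simp
qed

text \<open>The ratio condition along x = rx R speaks of g (rx R - u); off the origin g depends on
  the norm only, so the sign can be switched.\<close>

lemma path_loss_ratio:
  "((\<lambda>R. g (rx R) / g (u - rx R)) \<longlongrightarrow> 1) at_top"
proof -
  have "((\<lambda>x. g x / g (x - u)) \<longlongrightarrow> 1) at_infinity" using g by (simp add: path_loss_def)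
  then have lim: "((\<lambda>R. g (rx R) / g (rx R - u)) \<longlongrightarrow> 1) at_top"
    by (rule filterlim_compose[OF _ filterlim_rx_at_infinity])
  have "\<forall>\<^sub>F R in at_top. g (rx R) / g (rx R - u) = g (rx R) / g (u - rx R)"
    using eventually_gt_at_top[of "norm u"]
  proof eventually_elim
    case (elim R)
    then have "u \<noteq> rx R" by auto
    then have "g (rx R - u) = g (u - rx R)"
      by (intro antisym path_loss_mono) (auto simp: norm_minus_commute)
    then show ?case by simp
  qed
  with lim show ?thesis by (rule Lim_transform_eventually)
qed

text \<open>The ratio for a unit shift tends to 1, so it is eventually above 1/2. Doubling g then
  pays for moving one unit towards the receiver, which keeps the upper envelope integrable.\<close>

lemma path_loss_unit_shift: "\<exists>r0>1. \<forall>r\<ge>r0. g (rx (r - 1)) \<le> 2 * g (rx r)"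
proof -
  have "((\<lambda>x. g x / g (x - rx 1)) \<longlongrightarrow> 1) at_infinity" using g by (simp add: path_loss_def)
  then have "((\<lambda>R. g (rx R) / g (rx R - rx 1)) \<longlongrightarrow> 1) at_top"
    by (rule filterlim_compose[OF _ filterlim_rx_at_infinity])
  then have "\<forall>\<^sub>F R in at_top. 1 / 2 < g (rx R) / g (rx (R - 1))"
    unfolding rx_diff by (rule order_tendstoD) simp
  then obtain r0 where r0: "\<And>r. r \<ge> r0 \<Longrightarrow> 1 / 2 < g (rx r) / g (rx (r - 1))"
    unfolding eventually_at_top_linorder by blast
  \<comment> \<open>The maximum with 2 keeps r - 1 positive and the final threshold above 1.\<close>
  have "g (rx (r - 1)) \<le> 2 * g (rx r)" if "r \<ge> max r0 2" for r
    using r0[of r] that path_loss_pos[of "rx (r - 1)"] by (simp add: field_simps)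
  then show ?thesis by (intro exI[of _ "max r0 2"]) auto
qed

context
  fixes T R :: real
  assumes T: "0 < T" and R: "0 < R"
begin

section \<open>The kernel for fixed threshold and distance\<close>

lemma kappa_pos: "0 < g (rx R) / T"
  using T R path_loss_pos[of "rx R"] by simp

text \<open>Complement of the survival weight. The truncation at 0 can act only at u = rx R, where g
  is evaluated at the origin.\<close>

definition kernel :: "plane \<Rightarrow> real" where
  "kernel u = loss (g (rx R) / T) (max 0 (g (u - rx R)))"

lemma kernel_bounds: "0 \<le> kernel u" "kernel u \<le> 1"
  using loss_nonneg[OF kappa_pos, of "max 0 (g (u - rx R))"] loss_less_1[OF kappa_pos, of "max 0 (g (u - rx R))"]
  by (auto simp: kernel_def)

lemma kernel_measurable[measurable]: "kernel \<in> borel_measurable borel"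
  unfolding kernel_def[abs_def] loss_def by measurable

lemma survival_eq: "survival g T (rx R) y = 1 - kernel y"
proof -
  have z: "0 < g (rx R)" using R path_loss_pos[of "rx R"] by simp
  then have "0 < g (rx R) + T * max 0 (g (y - rx R))" using T by (intro add_pos_nonneg) auto
  then show ?thesis using z T by (simp add: survival_def kernel_def loss_def field_simps)
qed

text \<open>Radial bounds for \<open>kernel\<close> that are stable under displacements of length at most \<open>\<delta>\<close>.
  The value of \<open>g\<close> at the origin is arbitrary, hence the trivial bounds near the receiver.\<close>

definition kernel_lower :: "real \<Rightarrow> plane \<Rightarrow> real" where
  "kernel_lower \<delta> u = (if norm (u - rx R) \<le> \<delta> then 0 else loss (g (rx R) / T) (g (rx (norm (u - rx R) + \<delta>))))"

definition kernel_upper :: "real \<Rightarrow> plane \<Rightarrow> real" where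
  "kernel_upper \<delta> u = (if norm (u - rx R) \<le> \<delta> then 1 else loss (g (rx R) / T) (g (rx (norm (u - rx R) - \<delta>))))"

lemma kernel_lower_measurable[measurable]: "kernel_lower \<delta> \<in> borel_measurable borel"
  and kernel_upper_measurable[measurable]: "kernel_upper \<delta> \<in> borel_measurable borel"
proof -
  have [measurable]: "(\<lambda>u. g (rx (norm (u - rx R) + t))) \<in> borel_measurable borel" for t
    by (rule measurable_compose[OF _ path_loss_rx_measurable]) measurable
  show "kernel_lower \<delta> \<in> borel_measurable borel"
    unfolding kernel_lower_def[abs_def] loss_def by measurable
  have [measurable]: "(\<lambda>u. g (rx (norm (u - rx R) - \<delta>))) \<in> borel_measurable borel"
    by (rule measurable_compose[OF _ path_loss_rx_measurable]) measurable
  show "kernel_upper \<delta> \<in> borel_measurable borel"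
    unfolding kernel_upper_def[abs_def] loss_def by measurable
qed

lemma kernel_lower_bounds: "0 \<le> \<delta> \<Longrightarrow> 0 \<le> kernel_lower \<delta> u" "0 \<le> \<delta> \<Longrightarrow> kernel_lower \<delta> u \<le> 1"
  and kernel_upper_bounds: "0 \<le> \<delta> \<Longrightarrow> 0 \<le> kernel_upper \<delta> u" "0 \<le> \<delta> \<Longrightarrow> kernel_upper \<delta> u \<le> 1"
  using path_loss_pos[of "rx (norm (u - rx R) + \<delta>)"] path_loss_pos[of "rx (norm (u - rx R) - \<delta>)"]
  by (auto simp: kernel_lower_def kernel_upper_def intro!: loss_nonneg[OF kappa_pos] less_imp_le[OF loss_less_1[OF kappa_pos]])

text \<open>Beyond distance \<delta> the displaced point u - e still avoids the receiver, and it is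
  at most \<delta> further away than u; monotonicity of g and of \<open>loss\<close> does the
  rest.\<close>

lemma kernel_lower_le:
  assumes \<delta>: "0 < \<delta>" and e: "norm e \<le> \<delta>"
  shows "kernel_lower \<delta> u \<le> kernel (u - e)"
proof (cases "norm (u - rx R) \<le> \<delta>")
  case True
  then show ?thesis by (simp add: kernel_lower_def kernel_bounds)
next
  case False
  have n: "norm (u - e - rx R) \<le> norm (u - rx R) + \<delta>" "norm (u - rx R) - \<delta> \<le> norm (u - e - rx R)"
    using e norm_triangle_ineq4[of "u - rx R" e] norm_triangle_ineq2[of "u - rx R" e]
    by (auto simp: algebra_simps)
  then have nz: "u - e - rx R \<noteq> 0" using False by auto
  have "g (rx (norm (u - rx R) + \<delta>)) \<le> g (u - e - rx R)"
    using n nz \<delta> by (intro path_loss_mono) auto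
  then show ?thesis
    using False \<delta> path_loss_pos[of "rx (norm (u - rx R) + \<delta>)"]
    by (auto simp: kernel_lower_def kernel_def intro!: loss_mono[OF kappa_pos])
qed

lemma kernel_upper_ge:
  assumes \<delta>: "0 < \<delta>" and e: "norm e \<le> \<delta>"
  shows "kernel (u - e) \<le> kernel_upper \<delta> u"
proof (cases "norm (u - rx R) \<le> \<delta>")
  case True
  then show ?thesis by (simp add: kernel_upper_def kernel_bounds)
next
  case False
  have n: "norm (u - rx R) - \<delta> \<le> norm (u - e - rx R)"
    using e norm_triangle_ineq2[of "u - rx R" e] by (auto simp: algebra_simps)
  have "g (u - e - rx R) \<le> g (rx (norm (u - rx R) - \<delta>))"
    using n False by (intro path_loss_mono) auto
  then show ?thesis
    using False path_loss_pos[of "rx (norm (u - rx R) - \<delta>)"]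
    by (auto simp: kernel_upper_def kernel_def intro!: loss_mono[OF kappa_pos])
qed

lemma kernel_upper_mono:
  assumes "0 < \<delta>" "\<delta> \<le> \<delta>'"
  shows "kernel_upper \<delta> u \<le> kernel_upper \<delta>' u"
proof (cases "norm (u - rx R) \<le> \<delta>'")
  case True
  then show ?thesis using kernel_upper_bounds(2)[of \<delta> u] assms by (simp add: kernel_upper_def)
next
  case False
  then have "g (rx (norm (u - rx R) - \<delta>)) \<le> g (rx (norm (u - rx R) - \<delta>'))"
    using assms by (intro path_loss_mono) auto
  then show ?thesis
    using False assms path_loss_pos[of "rx (norm (u - rx R) - \<delta>)"]
    by (auto simp: kernel_upper_def intro!: loss_mono[OF kappa_pos])
qed

text \<open>Near the receiver the bound 1 suffices. Further out, \<open>loss_le\<close> and the unit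
  shift bound give a multiple of g (u - rx R), integrable away from the receiver. This envelope
  dominates all upper envelopes with 0 < \<delta> \<le> 1.\<close>

lemma kernel_upper_1_integrable: "integrable lborel (kernel_upper 1)"
proof -
  obtain r0 where r0: "r0 > 1" "\<And>r. r \<ge> r0 \<Longrightarrow> g (rx (r - 1)) \<le> 2 * g (rx r)"
    using path_loss_unit_shift by blast
  let ?h = "\<lambda>u. indicator (ball 0 r0) u + 2 / (g (rx R) / T) * (indicator (- ball 0 r0) u *\<^sub>R g u)"
  have "integrable lborel (indicator (ball 0 r0) :: plane \<Rightarrow> real)"
    using emeasure_lborel_ball_finite[of "0 :: plane" r0] by (intro integrable_real_indicator) auto
  moreover have "integrable lborel (\<lambda>u. indicator (- ball 0 r0) u *\<^sub>R g u)"
    using g r0 unfolding path_loss_def set_integrable_def by simp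
  ultimately have "integrable lborel ?h"
    by (intro Bochner_Integration.integrable_add integrable_mult_right)
  then have "integrable lborel (\<lambda>u. ?h (u - rx R))" by (rule integrable_lborel_shift)
  then show ?thesis
  proof (rule Bochner_Integration.integrable_bound)
    show "AE u in lborel. norm (kernel_upper 1 u) \<le> norm (?h (u - rx R))"
    proof (rule AE_I2)
      fix u
      define n where "n = norm (u - rx R)"
      have "kernel_upper 1 u \<le> ?h (u - rx R)"
      proof (cases "n < r0")
        case True
        then show ?thesis using kernel_upper_bounds(2)[of 1 u] by (simp add: n_def)
      next
        case False
        then have n: "n \<ge> r0" "n > 1" "u - rx R \<noteq> 0" using r0(1) by (auto simp: n_def)
        have "kernel_upper 1 u = loss (g (rx R) / T) (g (rx (n - 1)))" using n by (simp add: kernel_upper_def n_def)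
        also have "\<dots> \<le> g (rx (n - 1)) / (g (rx R) / T)"
          using path_loss_pos[of "rx (n - 1)"] n by (intro loss_le[OF kappa_pos]) auto
        also have "\<dots> \<le> 2 * g (rx n) / (g (rx R) / T)"
          using r0(2)[OF n(1)] kappa_pos by (intro divide_right_mono) auto
        also have "g (rx n) = g (u - rx R)" using path_loss_radial[OF n(3)] by (simp add: n_def)
        finally show ?thesis using False by (simp add: n_def mult_ac)
      qed
      then show "norm (kernel_upper 1 u) \<le> norm (?h (u - rx R))"
        using kernel_upper_bounds(1)[of 1 u] by simp
    qed
  qed simp
qed

lemma kernel_le_upper_1: "kernel u \<le> kernel_upper 1 u"
  using kernel_upper_ge[of 1 0 u] by simp

lemma kernel_integrable: "integrable lborel kernel"
  by (rule Bochner_Integration.integrable_bound[OF kernel_upper_1_integrable])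
    (use kernel_bounds kernel_le_upper_1 kernel_upper_bounds(1)[of 1] in auto)

lemma kernel_upper_integrable: "0 < \<delta> \<Longrightarrow> \<delta> \<le> 1 \<Longrightarrow> integrable lborel (kernel_upper \<delta>)"
  by (rule Bochner_Integration.integrable_bound[OF kernel_upper_1_integrable])
    (use kernel_upper_mono kernel_upper_bounds(1) in auto)

lemma kernel_lower_le_kernel: "0 < \<delta> \<Longrightarrow> kernel_lower \<delta> u \<le> kernel u"
  using kernel_lower_le[of \<delta> 0 u] by simp

lemma kernel_lower_integrable: "0 < \<delta> \<Longrightarrow> integrable lborel (kernel_lower \<delta>)"
  by (rule Bochner_Integration.integrable_bound[OF kernel_integrable])
    (use kernel_lower_le_kernel kernel_lower_bounds(1) kernel_bounds(1) in auto)

text \<open>Off the receiver the radial profile of the kernel is continuous, and for small \<delta>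
  both envelopes evaluate it at a distance changed by \<delta>.\<close>

lemma kernel_lower_upper_tendsto:
  assumes u: "u \<noteq> rx R" and \<delta>: "\<delta> \<longlonglongrightarrow> 0" "\<And>n. 0 < \<delta> n"
  shows "(\<lambda>n::nat. kernel_lower (\<delta> n) u) \<longlonglongrightarrow> kernel u" "(\<lambda>n. kernel_upper (\<delta> n) u) \<longlonglongrightarrow> kernel u"
proof -
  let ?n = "norm (u - rx R)"
  have pos: "0 < ?n" using u by simp
  have cont: "isCont (\<lambda>r. loss (g (rx R) / T) (g (rx r))) ?n"
    unfolding loss_def using path_loss_pos[of "rx ?n"] kappa_pos pos
    by (intro continuous_intros path_loss_rx_isCont[OF pos]) auto
  have val: "loss (g (rx R) / T) (g (rx ?n)) = kernel u"
    using path_loss_radial[of "u - rx R"] path_loss_pos[of "u - rx R"] u by (simp add: kernel_def)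
  have ev: "\<forall>\<^sub>F n in sequentially. \<delta> n < ?n" using order_tendstoD(2)[OF \<delta>(1) pos] .
  have "(\<lambda>n. loss (g (rx R) / T) (g (rx (?n + \<delta> n)))) \<longlonglongrightarrow> kernel u"
    using isCont_tendsto_compose[OF cont, of "\<lambda>n. ?n + \<delta> n"] tendsto_add[OF tendsto_const \<delta>(1), of ?n] val by simp
  moreover have "\<forall>\<^sub>F n in sequentially. loss (g (rx R) / T) (g (rx (?n + \<delta> n))) = kernel_lower (\<delta> n) u"
    using ev by eventually_elim (simp add: kernel_lower_def)
  ultimately show "(\<lambda>n. kernel_lower (\<delta> n) u) \<longlonglongrightarrow> kernel u" by (rule Lim_transform_eventually)
  have "(\<lambda>n. loss (g (rx R) / T) (g (rx (?n - \<delta> n)))) \<longlonglongrightarrow> kernel u"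
    using isCont_tendsto_compose[OF cont, of "\<lambda>n. ?n - \<delta> n"] tendsto_diff[OF tendsto_const \<delta>(1), of ?n] val by simp
  moreover have "\<forall>\<^sub>F n in sequentially. loss (g (rx R) / T) (g (rx (?n - \<delta> n))) = kernel_upper (\<delta> n) u"
    using ev by eventually_elim (simp add: kernel_upper_def)
  ultimately show "(\<lambda>n. kernel_upper (\<delta> n) u) \<longlonglongrightarrow> kernel u" by (rule Lim_transform_eventually)
qed

text \<open>In \<beta> the kernel is evaluated at x - y, that is at displacement x from a parent at
  - y. The single point where the truncation in \<open>kernel\<close> could matter is a null
  set.\<close>

lemma beta_eq_smear: "\<beta> g f T R y = smear f kernel (- y)"
  if "f \<in> borel_measurable borel"
  unfolding \<beta>_def smear_def
proof (rule integral_cong_AE)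
  have "AE x in lborel. x \<noteq> y + rx R" by (rule AE_lborel_singleton)
  then show "AE x in lborel. g (x - y - rx R) / (g (rx R) / T + g (x - y - rx R)) * f x = kernel (- y + x) * f x"
  proof eventually_elim
    case (elim x)
    then have "0 < g (x - y - rx R)" by (intro path_loss_pos) (auto simp: algebra_simps)
    then show ?case by (simp add: kernel_def loss_def)
  qed
qed (use that in measurable)

end

end

section \<open>Reflection of integrals and limits of averages\<close>

lemma integral_lborel_uminus:
  fixes h :: "plane \<Rightarrow> real"
  assumes h[measurable]: "h \<in> borel_measurable borel"
  shows "(\<integral>x. h (- x) \<partial>lborel) = (\<integral>x. h x \<partial>lborel)"
proof -
  have "lborel = (density (distr lborel borel (\<lambda>x. 0 + (-1) *\<^sub>R x)) (\<lambda>_. \<bar>-1::real\<bar> ^ DIM(plane)) :: plane measure)"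
    by (rule lborel_affine) simp
  then have eq: "(lborel :: plane measure) = distr lborel borel uminus" by (simp add: density_1)
  have "(\<integral>x. h x \<partial>lborel) = (\<integral>x. h x \<partial>distr lborel borel uminus)" by (subst eq) simp
  also have "\<dots> = (\<integral>x. h (- x) \<partial>lborel)" by (subst integral_distr) auto
  finally show ?thesis by simp
qed

text \<open>Convergence is allowed to fail at z, the receiver in the application; in the
  displacement variable this is again one point, a null set, and f dominates.\<close>

lemma smear_tendsto:
  assumes f: "prob_density f" and h: "\<And>n. h n \<in> borel_measurable borel" "\<And>n x. 0 \<le> h n x" "\<And>n x. h n x \<le> 1"
    and h'[measurable]: "h' \<in> borel_measurable borel"
    and lim: "\<And>x. x \<noteq> z \<Longrightarrow> (\<lambda>n::nat. h n x) \<longlonglongrightarrow> h' x"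
  shows "(\<lambda>n. smear f (h n) p) \<longlonglongrightarrow> smear f h' p"
  unfolding smear_def
proof (rule integral_dominated_convergence[where w = f])
  note [measurable] = prob_density_measurable[OF f] h(1)
  show "(\<lambda>d. h' (p + d) * f d) \<in> borel_measurable lborel" "(\<lambda>d. h n (p + d) * f d) \<in> borel_measurable lborel" for n
    by measurable
  show "integrable lborel f" by (rule prob_density_integrable[OF f])
  have "AE d in lborel. d \<noteq> z - p" by (rule AE_lborel_singleton)
  then show "AE d in lborel. (\<lambda>n. h n (p + d) * f d) \<longlonglongrightarrow> h' (p + d) * f d"
    by eventually_elim (intro tendsto_mult lim tendsto_const, auto simp: algebra_simps)
  show "AE d in lborel. norm (h n (p + d) * f d) \<le> f d" for n
    using h prob_density_nonneg[OF f] by (auto simp: abs_mult mult_left_le_one_le)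
qed

section \<open>The clustering gain\<close>

lemma LIMSEQ_two_over_Suc: "(\<lambda>n. 2 / real (Suc n)) \<longlonglongrightarrow> 0"
  using tendsto_mult_right[OF LIMSEQ_inverse_real_of_nat, of 2] by (simp add: inverse_eq_divide)

text \<open>Reflection removes the sign in \<beta> and preservation of mass removes f, leaving the
  integral of the kernel.\<close>

lemma Pp_eq:
  assumes g: "path_loss g" and TR: "0 < T" "0 < R" and f: "prob_density f"
  shows "Pp g f T R l = exp (- l * (\<integral>x. kernel g T R x \<partial>lborel))"
proof -
  note k = kernel_measurable[OF g TR] kernel_bounds[OF g TR]
  have "(\<integral>y. \<beta> g f T R y \<partial>lborel) = (\<integral>y. smear f (kernel g T R) (- y) \<partial>lborel)"
    using beta_eq_smear[OF g TR prob_density_measurable[OF f]] by simp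
  also have "\<dots> = (\<integral>x. kernel g T R x \<partial>lborel)"
    using smear_measurable[OF f k] by (simp add: integral_lborel_uminus integral_smear[OF f k])
  finally show ?thesis by (simp add: Pp_def)
qed

lemma P1_eq:
  assumes g: "path_loss g" and TR: "0 < T" "0 < R" and f: "prob_density f"
  shows "P1 g f T R c lp = exp (- lp * (\<integral>p. 1 - exp (- c * smear f (kernel g T R) p) \<partial>lborel))"
proof -
  note k = kernel_measurable[OF g TR] kernel_bounds[OF g TR]
  have "(\<lambda>p. 1 - exp (- c * smear f (kernel g T R) p)) \<in> borel_measurable borel"
    using smear_measurable[OF f k] by measurable
  then show ?thesis
    using integral_lborel_uminus[of "\<lambda>p. 1 - exp (- c * smear f (kernel g T R) p)"]
    by (simp add: P1_def beta_eq_smear[OF g TR prob_density_measurable[OF f]])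
qed

text \<open>Cells of side 1 / (n + 1) displace points by at most \<open>\<delta> n\<close>, which 1
  - \<open>kernel_lower\<close> absorbs. The constant in the bound is the same for all n, so n may
  tend to infinity; the lower envelopes converge to the kernel and are dominated by it.\<close>

lemma success_probability_poisson_le_Pp:
  assumes P: "poisson_process M l \<Phi>" and l: "0 < l" and \<mu>: "0 < \<mu>"
    and g: "path_loss g" and T: "0 < T" and R: "0 < R" and f: "prob_density f"
  shows "success_probability M \<Phi> \<mu> g T R \<le> ennreal (4 * l * exp l / (1 - exp (- l)) * Pp g f T R l)"
proof -
  note TR = T R
  define \<delta> where "\<delta> n = 2 / real (Suc n)" for n
  have \<delta>: "\<delta> \<longlonglongrightarrow> 0" "0 < \<delta> n" for n
    unfolding \<delta>_def[abs_def] by (rule LIMSEQ_two_over_Suc) simp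
  have gR: "0 < g (rx R)" using path_loss_pos[OF g, of "rx R"] R by simp
  have el: "0 < 1 - exp (- l)" using l by simp
  let ?L = "\<lambda>n. 4 * l * exp l * exp (- l * (\<integral>x. kernel_lower g T R (\<delta> n) x \<partial>lborel)) / (1 - exp (- l))"
  \<comment> \<open>Points within \<open>\<delta> n\<close> of the origin are then further than
    \<open>\<delta> n\<close> from the receiver, so the trivial branch of the envelope does not
    apply to them.\<close>
  have ev: "\<forall>\<^sub>F n in sequentially. \<delta> n < R / 2" using order_tendstoD(2)[OF \<delta>(1), of "R / 2"] R by simp
  have "\<forall>\<^sub>F n in sequentially. success_probability M \<Phi> \<mu> g T R \<le> ennreal (?L n)"
    using ev
  proof eventually_elim
    case (elim n)
    let ?w = "\<lambda>u. 1 - kernel_lower g T R (\<delta> n) u"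
    \<comment> \<open>A lower bound for the envelope near the origin: the distance to the receiver
      is at most R + \<delta>, and the envelope adds another \<delta>. The value of s drops out of
      the final bound.\<close>
    define s where "s = loss (g (rx R) / T) (g (rx (R + 2 * \<delta> n)))"
    have d: "0 < \<delta> n" by (rule \<delta>)
    have g2: "0 < g (rx (R + 2 * \<delta> n))" using path_loss_pos[OF g, of "rx (R + 2 * \<delta> n)"] R d by simp
    have s: "0 < s" "s \<le> 1"
      using loss_pos[OF kappa_pos[OF g TR] g2] loss_less_1[OF kappa_pos[OF g TR], of "g (rx (R + 2 * \<delta> n))"] g2
      by (auto simp: s_def)
    have w: "admissible ?w"
      using kernel_lower_measurable[OF g TR, of "\<delta> n"] kernel_lower_bounds[OF g TR, of "\<delta> n"]
        kernel_lower_integrable[OF g TR d] d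
      by (auto simp: admissible_def)
    have near: "survival g T (rx R) (u - e) \<le> ?w u" if "norm e \<le> 2 / real (Suc n)" for u e
      using kernel_lower_le[OF g TR d, of e u] that by (simp add: survival_eq[OF g TR] \<delta>_def)
    have ws: "?w e + s \<le> 1" if e: "norm e \<le> 2 / real (Suc n)" for e
    proof -
      have ne: "norm e \<le> \<delta> n" using e by (simp add: \<delta>_def)
      have "R - \<delta> n \<le> norm (e - rx R)" "norm (e - rx R) \<le> R + \<delta> n"
        using ne R norm_triangle_ineq4[of e "rx R"] norm_triangle_ineq3[of e "rx R"] by auto
      moreover from this have "g (rx (R + 2 * \<delta> n)) \<le> g (rx (norm (e - rx R) + \<delta> n))"
        using d elim by (intro path_loss_mono[OF g]) auto
      ultimately show ?thesis
        using elim d g2 by (auto simp: kernel_lower_def[OF g TR] s_def intro!: loss_mono[OF kappa_pos[OF g TR]])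
    qed
    have "success_probability M \<Phi> \<mu> g T R \<le>
        ennreal (4 * l * exp l * exp (- l * (\<integral>x. 1 - ?w x \<partial>lborel))) / ennreal (1 - exp (- l))"
      by (rule success_probability_poisson_le[OF P l \<mu> T gR w _ near s ws]) auto
    then show ?case using l el by (simp add: divide_ennreal)
  qed
  moreover have "(\<lambda>n. ennreal (?L n)) \<longlonglongrightarrow> ennreal (4 * l * exp l * exp (- l * (\<integral>x. kernel g T R x \<partial>lborel)) / (1 - exp (- l)))"
  proof -
    have "(\<lambda>n. \<integral>x. kernel_lower g T R (\<delta> n) x \<partial>lborel) \<longlonglongrightarrow> (\<integral>x. kernel g T R x \<partial>lborel)"
    proof (rule integral_dominated_convergence[where w = "kernel g T R"])
      have "AE x in lborel. x \<noteq> rx R" by (rule AE_lborel_singleton)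
      then show "AE x in lborel. (\<lambda>n. kernel_lower g T R (\<delta> n) x) \<longlonglongrightarrow> kernel g T R x"
        by eventually_elim (intro kernel_lower_upper_tendsto[OF g TR] \<delta>)
      show "AE x in lborel. norm (kernel_lower g T R (\<delta> n) x) \<le> kernel g T R x" for n
        using kernel_lower_le_kernel[OF g TR \<delta>(2)] kernel_lower_bounds(1)[OF g TR, of "\<delta> n"] \<delta>(2)[of n] by auto
    qed (use kernel_integrable[OF g TR] kernel_measurable[OF g TR] kernel_lower_measurable[OF g TR] in auto)
    then show ?thesis using el by (intro tendsto_ennrealI tendsto_intros) auto
  qed
  ultimately have "success_probability M \<Phi> \<mu> g T R \<le>
      ennreal (4 * l * exp l * exp (- l * (\<integral>x. kernel g T R x \<partial>lborel)) / (1 - exp (- l)))"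
    by (intro tendsto_lowerbound) auto
  then show ?thesis by (simp add: Pp_eq[OF g TR f])
qed

text \<open>The same passage to the limit with the upper envelope, which makes 1 -
  \<open>kernel_upper\<close> a minorant of the survival weight. Domination is by the smear of the
  envelope for displacement 1, uniformly in n.\<close>

lemma success_probability_neyman_scott_ge_P1:
  assumes NS: "neyman_scott_process M lp c f \<Phi>" and lp: "0 < lp" and c: "0 < c" and f: "prob_density f"
    and \<mu>: "0 < \<mu>" and g: "path_loss g" and T: "0 < T" and R: "0 < R"
  shows "ennreal (exp (- c) / ((1 + c) * (1 + lp * c)) * P1 g f T R c lp) \<le> success_probability M \<Phi> \<mu> g T R"
proof -
  note TR = T R
  define \<delta> where "\<delta> n = 2 / real (Suc n)" for n
  have \<delta>: "\<delta> \<longlonglongrightarrow> 0" "0 < \<delta> n" for n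
    unfolding \<delta>_def[abs_def] by (rule LIMSEQ_two_over_Suc) simp
  have gR: "0 < g (rx R)" using path_loss_pos[OF g, of "rx R"] R by simp
  \<comment> \<open>The cap at 1 makes the envelope integrable for every n; for large n it is
    inactive and \<open>d n\<close> is the displacement within a cell.\<close>
  define d where "d n = min 1 (\<delta> n)" for n
  have d: "d \<longlonglongrightarrow> 0" "0 < d n" "d n \<le> 1" for n
    using tendsto_min[OF tendsto_const \<delta>(1), of 1] \<delta>(2)[of n] by (auto simp: d_def[abs_def])
  let ?k = "\<lambda>n. kernel_upper g T R (d n)"
  note k = kernel_upper_measurable[OF g TR, of "d _"]
    kernel_upper_bounds(1)[OF g TR less_imp_le[OF d(2)]] kernel_upper_bounds(2)[OF g TR less_imp_le[OF d(2)]]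
    kernel_upper_integrable[OF g TR d(2,3)]
  let ?L = "\<lambda>n. exp (- c) / ((1 + c) * (1 + lp * c)) * exp (- lp * (\<integral>p. 1 - exp (- c * smear f (?k n) p) \<partial>lborel))"
  have ev: "\<forall>\<^sub>F n in sequentially. \<delta> n < min 1 (R / 2)" using order_tendstoD(2)[OF \<delta>(1), of "min 1 (R / 2)"] R by simp
  have "\<forall>\<^sub>F n in sequentially. ennreal (?L n) \<le> success_probability M \<Phi> \<mu> g T R"
    using ev
  proof eventually_elim
    case (elim n)
    then have dn: "d n = 2 / real (Suc n)" by (simp add: d_def \<delta>_def)
    have dR: "d n < R / 2" using elim by (simp add: d_def)
    let ?w = "\<lambda>u. 1 - ?k n u"
    \<comment> \<open>Near the origin the receiver is at distance at least R - d and the envelope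
      subtracts another d; d < R / 2 keeps R - 2 d positive.\<close>
    define s where "s = 1 - loss (g (rx R) / T) (g (rx (R - 2 * d n)))"
    have g2: "0 < g (rx (R - 2 * d n))" using path_loss_pos[OF g, of "rx (R - 2 * d n)"] dR by simp
    have s: "0 < s" "s \<le> 1"
      using loss_nonneg[OF kappa_pos[OF g TR], of "g (rx (R - 2 * d n))"]
        loss_less_1[OF kappa_pos[OF g TR], of "g (rx (R - 2 * d n))"] g2
      by (auto simp: s_def)
    have w: "admissible ?w" using k by (auto simp: admissible_def)
    have near: "?w u \<le> survival g T (rx R) (u - e)" if "norm e \<le> 2 / real (Suc n)" for u e
      using kernel_upper_ge[OF g TR d(2), of e n u] that by (simp add: survival_eq[OF g TR] dn)
    have ws: "s \<le> ?w e" if e: "norm e \<le> 2 / real (Suc n)" for e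
    proof -
      have ne: "norm e \<le> d n" using e by (simp only: dn)
      have n: "R - d n \<le> norm (e - rx R)"
        using ne R norm_triangle_ineq3[of e "rx R"] by auto
      then have "g (rx (norm (e - rx R) - d n)) \<le> g (rx (R - 2 * d n))"
        using d(2)[of n] dR by (intro path_loss_mono[OF g]) auto
      moreover have "0 < g (rx (norm (e - rx R) - d n))"
        using n dR by (intro path_loss_pos[OF g]) auto
      ultimately show ?thesis
        using n dR by (auto simp: kernel_upper_def[OF g TR] s_def intro!: loss_mono[OF kappa_pos[OF g TR]])
    qed
    have "ennreal (exp (- c) / ((1 + c) * (1 + lp * c)) *
      exp (- lp * (\<integral>p. 1 - exp (- c * smear f (\<lambda>x. 1 - ?w x) p) \<partial>lborel)))
      \<le> success_probability M \<Phi> \<mu> g T R"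
      by (rule success_probability_neyman_scott_ge[OF NS lp c f \<mu> T gR w _ near s ws]) auto
    then show ?case by simp
  qed
  moreover have "(\<lambda>n. ennreal (?L n)) \<longlonglongrightarrow> ennreal (exp (- c) / ((1 + c) * (1 + lp * c)) * P1 g f T R c lp)"
  proof -
    note ku = kernel_upper_measurable[OF g TR, of 1] kernel_upper_bounds(1)[OF g TR, of 1, simplified]
      kernel_upper_bounds(2)[OF g TR, of 1, simplified] kernel_upper_1_integrable[OF g TR]
    note kk = kernel_measurable[OF g TR] kernel_bounds[OF g TR]
    have "(\<lambda>n. \<integral>p. 1 - exp (- c * smear f (?k n) p) \<partial>lborel) \<longlonglongrightarrow> (\<integral>p. 1 - exp (- c * smear f (kernel g T R) p) \<partial>lborel)"
    proof (rule integral_dominated_convergence[where w = "\<lambda>p. c * smear f (kernel_upper g T R 1) p"])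
      show "integrable lborel (\<lambda>p. c * smear f (kernel_upper g T R 1) p)"
        using smear_integrable[OF f ku] by simp
      show "AE p in lborel. (\<lambda>n. 1 - exp (- c * smear f (?k n) p)) \<longlonglongrightarrow> 1 - exp (- c * smear f (kernel g T R) p)"
        by (intro AE_I2 tendsto_intros smear_tendsto[OF f k(1-3) kk(1)] kernel_lower_upper_tendsto(2)[OF g TR _ d(1,2)])
      show "AE p in lborel. norm (1 - exp (- c * smear f (?k n) p)) \<le> c * smear f (kernel_upper g T R 1) p" for n
      proof (rule AE_I2)
        fix p
        have S0: "0 \<le> smear f (?k n) p" by (rule smear_nonneg[OF f k(1-3)])
        have "smear f (?k n) p \<le> smear f (kernel_upper g T R 1) p"
          unfolding smear_def
          by (intro integral_mono smear_integrand_integrable[OF f k(1-3)] smear_integrand_integrable[OF f ku(1-3)]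
              mult_right_mono kernel_upper_mono[OF g TR d(2,3)] prob_density_nonneg[OF f])
        then have "c * smear f (?k n) p \<le> c * smear f (kernel_upper g T R 1) p" using c by (intro mult_left_mono) auto
        moreover have "0 \<le> c * smear f (?k n) p" using S0 c by simp
        note exp_diff_bounds[OF this]
        ultimately show "norm (1 - exp (- c * smear f (?k n) p)) \<le> c * smear f (kernel_upper g T R 1) p"
          by (simp only: real_norm_def abs_of_nonneg mult_minus_left)
      qed
      show "(\<lambda>p. 1 - exp (- c * smear f (kernel g T R) p)) \<in> borel_measurable lborel"
        using smear_measurable[OF f kk] by measurable
      show "(\<lambda>p. 1 - exp (- c * smear f (?k n) p)) \<in> borel_measurable lborel" for n
        using smear_measurable[OF f k(1-3), of n] by measurable
    qed
    then show ?thesis unfolding P1_eq[OF g TR f] by (intro tendsto_ennrealI tendsto_intros)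
  qed
  ultimately show ?thesis by (intro tendsto_upperbound) auto
qed

section \<open>Behaviour at large distance\<close>

lemma P2_bounds:
  assumes c: "0 < c" and f: "prob_density f" and g: "path_loss g" and T: "0 < T" and R: "0 < R"
  shows "exp (- c) \<le> P2 g f T R c" "P2 g f T R c \<le> 1"
proof -
  note TR = T R
  note k = kernel_measurable[OF g TR] kernel_bounds[OF g TR]
  let ?E = "\<lambda>y. exp (- c * smear f (kernel g T R) (- y))"
  have P2: "P2 g f T R c = (\<integral>y. ?E y * f y \<partial>lborel)"
    by (simp add: P2_def beta_eq_smear[OF g TR prob_density_measurable[OF f]])
  note [measurable] = smear_measurable[OF f k] prob_density_measurable[OF f]
  have E: "exp (- c) \<le> ?E y" "?E y \<le> 1" for y
    using smear_nonneg[OF f k, of "- y"] smear_le_1[OF f k, of "- y"] c by auto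
  have int: "integrable lborel (\<lambda>y. ?E y * f y)"
  proof (rule Bochner_Integration.integrable_bound[OF prob_density_integrable[OF f]])
    show "(\<lambda>y. ?E y * f y) \<in> borel_measurable lborel" by measurable
    show "AE y in lborel. norm (?E y * f y) \<le> norm (f y)"
      using E(2) prob_density_nonneg[OF f] by (auto simp: abs_mult mult_left_le_one_le)
  qed
  have "(\<integral>y. exp (- c) * f y \<partial>lborel) \<le> (\<integral>y. ?E y * f y \<partial>lborel)"
    using E prob_density_integrable[OF f] prob_density_nonneg[OF f]
    by (intro integral_mono int mult_right_mono) auto
  then show "exp (- c) \<le> P2 g f T R c" by (simp add: P2 prob_density_integral[OF f])
  have "(\<integral>y. ?E y * f y \<partial>lborel) \<le> (\<integral>y. 1 * f y \<partial>lborel)"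
    using E prob_density_integrable[OF f] prob_density_nonneg[OF f]
    by (intro integral_mono int mult_right_mono) auto
  then show "P2 g f T R c \<le> 1" by (simp add: P2 prob_density_integral[OF f])
qed

text \<open>The kernel is a function of the ratio g (rx R) / g (u - rx R), which tends to 1: for a
  remote receiver an interferer at a fixed place is as strong as the transmitter.\<close>

lemma kernel_tendsto_at_top:
  assumes g: "path_loss g" and T: "0 < T"
  shows "((\<lambda>R. kernel g T R u) \<longlongrightarrow> T / (1 + T)) at_top"
proof -
  have "((\<lambda>R. 1 / (g (rx R) / g (u - rx R) / T + 1)) \<longlongrightarrow> 1 / (1 / T + 1)) at_top"
    using T by (intro tendsto_intros path_loss_ratio[OF g]) (auto simp: add_pos_pos add_nonneg_eq_0_iff)
  moreover have "1 / (1 / T + 1) = T / (1 + T)" using T by (simp add: field_simps)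
  moreover have "\<forall>\<^sub>F R in at_top. 1 / (g (rx R) / g (u - rx R) / T + 1) = kernel g T R u"
    using eventually_gt_at_top[of "norm u"]
  proof eventually_elim
    case (elim R)
    then have nz: "u \<noteq> rx R" by auto
    have R: "0 < R" using elim norm_ge_zero[of u] by linarith
    have "0 < g (u - rx R)" "0 < g (rx R)" using nz R by (auto intro!: path_loss_pos[OF g])
    then show ?case using T by (simp add: kernel_def[OF g T R] loss_def field_simps)
  qed
  ultimately show ?thesis by (auto elim: Lim_transform_eventually)
qed

lemma smear_kernel_tendsto_at_top:
  assumes g: "path_loss g" and T: "0 < T" and f: "prob_density f"
  shows "((\<lambda>R. smear f (kernel g T R) p) \<longlongrightarrow> T / (1 + T)) at_top"
proof -
  have "((\<lambda>R. \<integral>d. kernel g T R (p + d) * f d \<partial>lborel) \<longlongrightarrow> (\<integral>d. T / (1 + T) * f d \<partial>lborel)) at_top"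
  proof (rule tendsto_at_topI_sequentially)
    fix X :: "nat \<Rightarrow> real" assume X: "filterlim X at_top sequentially"
    then have "\<forall>\<^sub>F n in sequentially. 0 < X n" by (simp add: filterlim_at_top_dense)
    \<comment> \<open>The kernel lemmas require a positive distance, so an initial segment of the
      sequence is cut off.\<close>
    then obtain n0 where n0: "\<And>n. n \<ge> n0 \<Longrightarrow> 0 < X n" unfolding eventually_sequentially by blast
    then have pos: "0 < X (n + n0)" for n by simp
    note k = kernel_measurable[OF g T pos] kernel_bounds[OF g T pos]
    have "(\<lambda>n. \<integral>d. kernel g T (X (n + n0)) (p + d) * f d \<partial>lborel) \<longlonglongrightarrow> (\<integral>d. T / (1 + T) * f d \<partial>lborel)"
    proof (rule integral_dominated_convergence[where w = f])
      note [measurable] = k(1) prob_density_measurable[OF f]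
      show "(\<lambda>d. kernel g T (X (n + n0)) (p + d) * f d) \<in> borel_measurable lborel" for n by measurable
      show "(\<lambda>d. T / (1 + T) * f d) \<in> borel_measurable lborel" by measurable
      show "integrable lborel f" by (rule prob_density_integrable[OF f])
      show "AE d in lborel. norm (kernel g T (X (n + n0)) (p + d) * f d) \<le> f d" for n
        using k(2,3)[of n] prob_density_nonneg[OF f] by (auto simp: abs_mult mult_left_le_one_le)
      have "filterlim (\<lambda>n. X (n + n0)) at_top sequentially"
        using X by (rule filterlim_compose) (rule filterlim_add_const_nat_at_top)
      then show "AE d in lborel. (\<lambda>n. kernel g T (X (n + n0)) (p + d) * f d) \<longlonglongrightarrow> T / (1 + T) * f d"
        by (intro AE_I2 tendsto_mult tendsto_const filterlim_compose[OF kernel_tendsto_at_top[OF g T]])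
    qed
    then show "(\<lambda>n. \<integral>d. kernel g T (X n) (p + d) * f d \<partial>lborel) \<longlonglongrightarrow> (\<integral>d. T / (1 + T) * f d \<partial>lborel)"
      by (rule LIMSEQ_offset)
  qed
  then show ?thesis by (simp add: smear_def prob_density_integral[OF f])
qed

text \<open>The function c t - 1 + exp (- c t) is nonnegative and positive at the limit value of the
  smeared kernel. On a large box B the integral therefore exceeds Z in the limit, and the rest of
  the plane contributes nonnegatively. Restriction to B provides the finite dominating function;
  over the whole plane the limiting integral is infinite.\<close>

lemma excess_exponent_at_top:
  assumes c: "0 < c" and g: "path_loss g" and T: "0 < T" and f: "prob_density f"
  shows "filterlim (\<lambda>R. \<integral>p. c * smear f (kernel g T R) p - (1 - exp (- c * smear f (kernel g T R) p)) \<partial>lborel) at_top at_top"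
  unfolding filterlim_at_top
proof
  fix Z :: real
  define \<phi> where "\<phi> t = c * t - (1 - exp (- c * t))" for t :: real
  have \<phi>0: "0 \<le> \<phi> t" for t using exp_ge_add_one_self[of "- c * t"] by (simp add: \<phi>_def)
  define t0 where "t0 = T / (1 + T)"
  have t0: "0 < t0" using T by (simp add: t0_def)
  have \<phi>pos: "0 < \<phi> t0"
  proof -
    \<comment> \<open>Equality case of ln y \<le> y - 1 at y = exp (- c t0), which would force y =
      1.\<close>
    have "\<phi> t0 \<noteq> 0"
    proof
      assume "\<phi> t0 = 0"
      then have "ln (exp (- c * t0)) = exp (- c * t0) - 1" unfolding \<phi>_def ln_exp by simp
      from ln_eq_minus_one[OF exp_gt_zero this] show False using c t0 by simp
    qed
    then show ?thesis using \<phi>0[of t0] by simp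
  qed
  \<comment> \<open>The summand 1 makes the comparison with Z strict; the area (n + 1)^2 of B is at
    least n.\<close>
  obtain n :: nat where n: "(Z + 1) / \<phi> t0 \<le> real n" using real_arch_simple by blast
  define B :: "plane set" where "B = cbox 0 (real (Suc n) *\<^sub>R One)"
  have mB: "measure lborel B = (real (Suc n))\<^sup>2"
    by (simp add: B_def measure_def emeasure_lborel_cbox_eq power2_eq_square)
  have Bfin: "emeasure lborel B < \<infinity>" unfolding B_def by (rule emeasure_lborel_cbox_finite)
  have Bs[measurable]: "B \<in> sets borel" by (simp add: B_def)
  let ?S = "\<lambda>R. smear f (kernel g T R)"
  have lim: "((\<lambda>R. \<integral>p. indicator B p * \<phi> (?S R p) \<partial>lborel) \<longlongrightarrow> (\<integral>p. indicator B p * \<phi> t0 \<partial>lborel)) at_top"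
  proof (rule tendsto_at_topI_sequentially)
    fix X :: "nat \<Rightarrow> real" assume X: "filterlim X at_top sequentially"
    then have "\<forall>\<^sub>F n in sequentially. 0 < X n" by (simp add: filterlim_at_top_dense)
    then obtain n0 where n0: "\<And>n. n \<ge> n0 \<Longrightarrow> 0 < X n" unfolding eventually_sequentially by blast
    then have pos: "0 < X (n + n0)" for n by simp
    note k = kernel_measurable[OF g T pos] kernel_bounds[OF g T pos]
    have "(\<lambda>n. \<integral>p. indicator B p * \<phi> (?S (X (n + n0)) p) \<partial>lborel) \<longlonglongrightarrow> (\<integral>p. indicator B p * \<phi> t0 \<partial>lborel)"
    \<comment> \<open>A smear S lies in [0,1], so \<phi> S \<le> c S \<le> c.\<close>
    proof (rule integral_dominated_convergence[where w = "\<lambda>p. indicator B p * c"])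
      note [measurable] = smear_measurable[OF f k]
      show "(\<lambda>p. indicator B p * \<phi> (?S (X (n + n0)) p)) \<in> borel_measurable lborel" for n unfolding \<phi>_def by measurable
      show "(\<lambda>p. indicator B p * \<phi> t0) \<in> borel_measurable lborel" by measurable
      show "integrable lborel (\<lambda>p. indicator B p * c)"
        using Bfin by (intro integrable_mult_left integrable_real_indicator) auto
      show "AE p in lborel. norm (indicator B p * \<phi> (?S (X (n + n0)) p)) \<le> indicator B p * c" for n
      proof (rule AE_I2)
        fix p
        have "0 \<le> ?S (X (n + n0)) p" "?S (X (n + n0)) p \<le> 1"
          by (rule smear_nonneg[OF f k] smear_le_1[OF f k])+
        then have "c * ?S (X (n + n0)) p \<le> c * 1" "0 \<le> c * ?S (X (n + n0)) p"
          using c by (auto intro: mult_left_mono)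
        then have "\<phi> (?S (X (n + n0)) p) \<le> c"
          using exp_diff_bounds(1)[of "c * ?S (X (n + n0)) p"] unfolding \<phi>_def mult_minus_left by linarith
        then show "norm (indicator B p * \<phi> (?S (X (n + n0)) p)) \<le> indicator B p * c"
          using \<phi>0 by (auto simp: indicator_def)
      qed
      have "filterlim (\<lambda>n. X (n + n0)) at_top sequentially"
        using X by (rule filterlim_compose) (rule filterlim_add_const_nat_at_top)
      then have "(\<lambda>n. ?S (X (n + n0)) p) \<longlonglongrightarrow> t0" for p
        unfolding t0_def by (rule filterlim_compose[OF smear_kernel_tendsto_at_top[OF g T f]])
      then show "AE p in lborel. (\<lambda>n. indicator B p * \<phi> (?S (X (n + n0)) p)) \<longlonglongrightarrow> indicator B p * \<phi> t0"
        unfolding \<phi>_def by (intro AE_I2 tendsto_intros)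
    qed
    then show "(\<lambda>n. \<integral>p. indicator B p * \<phi> (?S (X n) p) \<partial>lborel) \<longlonglongrightarrow> (\<integral>p. indicator B p * \<phi> t0 \<partial>lborel)"
      by (rule LIMSEQ_offset)
  qed
  have "Z < (real (Suc n))\<^sup>2 * \<phi> t0"
  proof -
    have "Z + 1 \<le> real n * \<phi> t0" using n \<phi>pos by (simp add: field_simps)
    also have "\<dots> \<le> (real (Suc n))\<^sup>2 * \<phi> t0"
      using \<phi>pos by (intro mult_right_mono) (auto simp: power2_eq_square algebra_simps)
    finally show ?thesis by simp
  qed
  then have "Z < (\<integral>p. indicator B p * \<phi> t0 \<partial>lborel)" by (simp add: mB)
  from order_tendstoD(1)[OF lim this] eventually_gt_at_top[of 0]
  show "\<forall>\<^sub>F R in at_top. Z \<le> (\<integral>p. c * ?S R p - (1 - exp (- c * ?S R p)) \<partial>lborel)"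
  proof eventually_elim
    case (elim R)
    note k = kernel_measurable[OF g T elim(2)] kernel_bounds[OF g T elim(2)]
    have int: "integrable lborel (\<lambda>p. \<phi> (?S R p))"
      unfolding \<phi>_def using c
      by (intro Bochner_Integration.integrable_diff integrable_mult_right smear_integrable[OF f k] exp_smear_integrable[OF f k]
          kernel_integrable[OF g T elim(2)]) auto
    have "(\<integral>p. indicator B p * \<phi> (?S R p) \<partial>lborel) \<le> (\<integral>p. \<phi> (?S R p) \<partial>lborel)"
    proof (rule integral_mono[OF _ int])
      show "integrable lborel (\<lambda>p. indicator B p * \<phi> (?S R p))"
        using integrable_mult_indicator[OF _ int, of B] by simp
      show "indicator B p * \<phi> (?S R p) \<le> \<phi> (?S R p)" for p using \<phi>0 by (auto simp: indicator_def)
    qed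
    then show ?case using elim(1) by (simp add: \<phi>_def)
  qed
qed

text \<open>Preservation of mass rewrites the exponent of Pp as an integral of c times the smeared
  kernel, so that both exponents combine into the single excess integral.\<close>

lemma P1_over_Pp_at_top:
  assumes lp: "0 < lp" and c: "0 < c" and g: "path_loss g" and T: "0 < T" and f: "prob_density f"
  shows "filterlim (\<lambda>R. P1 g f T R c lp / Pp g f T R (lp * c)) at_top at_top"
proof -
  let ?E = "\<lambda>R. \<integral>p. c * smear f (kernel g T R) p - (1 - exp (- c * smear f (kernel g T R) p)) \<partial>lborel"
  have "filterlim (\<lambda>R. exp (lp * ?E R)) at_top at_top"
    by (intro filterlim_compose[OF exp_at_top] filterlim_tendsto_pos_mult_at_top[OF tendsto_const lp]
        excess_exponent_at_top[OF c g T f])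
  moreover have "\<forall>\<^sub>F R in at_top. exp (lp * ?E R) = P1 g f T R c lp / Pp g f T R (lp * c)"
    using eventually_gt_at_top[of 0]
  proof eventually_elim
    case (elim R)
    note k = kernel_measurable[OF g T elim] kernel_bounds[OF g T elim]
    have "?E R = (\<integral>p. c * smear f (kernel g T R) p \<partial>lborel) - (\<integral>p. 1 - exp (- c * smear f (kernel g T R) p) \<partial>lborel)"
      using c by (intro Bochner_Integration.integral_diff integrable_mult_right smear_integrable[OF f k] exp_smear_integrable[OF f k]
          kernel_integrable[OF g T elim]) auto
    then have "lp * ?E R = lp * c * (\<integral>x. kernel g T R x \<partial>lborel) - lp * (\<integral>p. 1 - exp (- c * smear f (kernel g T R) p) \<partial>lborel)"
      by (simp add: integral_smear[OF f k] right_diff_distrib)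
    then show ?case
      unfolding P1_eq[OF g T elim f] Pp_eq[OF g T elim f] by (simp flip: exp_diff)
  qed
  ultimately show ?thesis by (simp cong: filterlim_cong)
qed

theorem mainTheorem8:
  fixes lp c T \<mu> :: real
    and f g :: "plane \<Rightarrow> real"
  assumes "lp > 0" "c > 0" "T > 0" "\<mu> > 0"
    and "prob_density f" "isotropic f"
    and "path_loss g"
  shows "filterlim (clustering_gain g f T lp c) at_top at_top \<and>
    (\<forall>\<^sub>F R in at_top.
       \<forall>(M :: 'w measure) \<Phi> (M' :: 'v measure) \<Psi>.
         neyman_scott_process M lp c f \<Phi> \<longrightarrow>
         poisson_process M' (lp * c) \<Psi> \<longrightarrow>
         success_probability M' \<Psi> \<mu> g T R < success_probability M \<Phi> \<mu> g T R)"
proof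
  note lp = assms(1) and c = assms(2) and T = assms(3) and \<mu> = assms(4) and f = assms(5) and g = assms(7)
  have ratio: "filterlim (\<lambda>R. P1 g f T R c lp / Pp g f T R (lp * c)) at_top at_top"
    by (rule P1_over_Pp_at_top[OF lp c g T f])
  \<comment> \<open>The factor exp (- c) is the lower bound for P2, uniform in R.\<close>
  have "filterlim (\<lambda>R. exp (- c) * (P1 g f T R c lp / Pp g f T R (lp * c))) at_top at_top"
    by (rule filterlim_tendsto_pos_mult_at_top[OF tendsto_const _ ratio]) simp
  moreover have "\<forall>\<^sub>F R in at_top. exp (- c) * (P1 g f T R c lp / Pp g f T R (lp * c)) \<le> clustering_gain g f T lp c R"
    using eventually_gt_at_top[of 0]
  proof eventually_elim
    case (elim R)
    have "exp (- c) * (P1 g f T R c lp / Pp g f T R (lp * c)) \<le> P2 g f T R c * (P1 g f T R c lp / Pp g f T R (lp * c))"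
      by (intro mult_right_mono P2_bounds[OF c f g T elim]) (simp add: P1_def Pp_def)
    then show ?case by (simp add: clustering_gain_def mult_ac)
  qed
  ultimately show "filterlim (clustering_gain g f T lp c) at_top at_top" by (rule filterlim_at_top_mono)
  \<comment> \<open>Constants of the two one-sided bounds; they involve neither R nor the
    processes.\<close>
  define K where "K = 4 * (lp * c) * exp (lp * c) / (1 - exp (- (lp * c)))"
  define \<kappa> where "\<kappa> = exp (- c) / ((1 + c) * (1 + lp * c))"
  have \<kappa>: "0 < \<kappa>" using lp c by (simp add: \<kappa>_def add_pos_pos)
  \<comment> \<open>The threshold for R is fixed here, before any process is introduced, and so
    serves all of them.\<close>
  have "\<forall>\<^sub>F R in at_top. K / \<kappa> < P1 g f T R c lp / Pp g f T R (lp * c)"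
    using ratio unfolding filterlim_at_top_dense by blast
  then show "\<forall>\<^sub>F R in at_top.
       \<forall>(M :: 'w measure) \<Phi> (M' :: 'v measure) \<Psi>.
         neyman_scott_process M lp c f \<Phi> \<longrightarrow>
         poisson_process M' (lp * c) \<Psi> \<longrightarrow>
         success_probability M' \<Psi> \<mu> g T R < success_probability M \<Phi> \<mu> g T R"
    using eventually_gt_at_top[of 0]
  proof eventually_elim
    case (elim R)
    have "K * Pp g f T R (lp * c) < \<kappa> * P1 g f T R c lp"
      using elim(1) \<kappa> by (simp add: Pp_def field_simps)
    then have less: "ennreal (K * Pp g f T R (lp * c)) < ennreal (\<kappa> * P1 g f T R c lp)"
      using \<kappa> by (intro ennreal_lessI) (auto simp: P1_def)
    show ?case
    proof (intro allI impI)
      fix M :: "'w measure" and \<Phi> and M' :: "'v measure" and \<Psi>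
      assume NS: "neyman_scott_process M lp c f \<Phi>" and P: "poisson_process M' (lp * c) \<Psi>"
      have "success_probability M' \<Psi> \<mu> g T R \<le> ennreal (K * Pp g f T R (lp * c))"
        unfolding K_def using lp c by (intro success_probability_poisson_le_Pp[OF P _ \<mu> g T elim(2) f]) simp
      also note less
      also have "ennreal (\<kappa> * P1 g f T R c lp) \<le> success_probability M \<Phi> \<mu> g T R"
        unfolding \<kappa>_def by (rule success_probability_neyman_scott_ge_P1[OF NS lp c f \<mu> g T elim(2)])
      finally show "success_probability M' \<Psi> \<mu> g T R < success_probability M \<Phi> \<mu> g T R" .
    qed
  qed
qed

end
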